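(* Let $n\geqslant 2$ and let $b_1,b_2\in \mathcal{C}^1([0,\infty))\cap L^1([0,\infty))$ be nonnegative functions. Let $p,q>1$ satisfy $$\max\left\{\frac{p+2+q^{-1}}{pq-1},\frac{q+2+p^{-1}}{pq-1}\right\}=\frac{n-1}{2}.$$ Let $R>0$ and assume that $u_0,v_0\in H^1(\mathbb{R}^n)$ and $u_1,v_1\in L^2(\mathbb{R}^n)$ are nonnegative, pairwise nontrivial and compactly supported in $B_R=\{x\in\mathbb{R}^n:|x|\leqslant R\}$. For $\varepsilon>0$ let $(u,v)$ be an energy solution, with lifespan $T=T(\varepsilon)$, of the Cauchy problem $$\begin{cases} u_{tt}-\Delta u+b_1(t)u_t=|v|^p, & x\in\mathbb{R}^n,\ t>0,\\ v_{tt}-\Delta v+b_2(t)v_t=|u|^q, & x\in\mathbb{R}^n,\ t>0,\\ (u,u_t,v,v_t)(0,x)=(\varepsilon u_0,\varepsilon u_1,\varepsilon v_0,\varepsilon v_1)(x), & x\in\mathbb{R}^n,\end{cases}$$ such that $$\operatorname{supp} u,\ \operatorname{supp} v\subset\{(t,x)\in[0,T)\times\mathbb{R}^n:|x|\leqslant t+R\}.$$ Then there exists a positive constant $\varepsilon_0=\varepsilon_0(u_0,u_1,v_0,v_1,n,p,q,b_1,b_2,R)$ such that for any $\varepsilon\in(0,\varepsilon_0]$ the solution $(u,v)$ blows up in finite time. Moreover, the upper bound estimates for the lifespan $$T(\varepsilon)\leqslant\begin{cases}\exp\big(C\varepsilon^{-\min\{q(pq-1),\,p(pq-1)\}}\big)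 & \text{if } p\neq q,\\ \exp\big(C\varepsilon^{-p(p-1)}\big) & \text{if } p=q\end{cases}$$ hold, where $C$ is a positive constant independent of $\varepsilon$.
   Context: Pairwise nontrivial data: $(u_0,u_1)\not\equiv(0,0)$ and $(v_0,v_1)\not\equiv(0,0)$, i.e. at least one of $u_0,u_1$ and at least one of $v_0,v_1$ is not identically zero. Energy solution: $(u,v)$ is an energy solution of the Cauchy problem on $[0,T)$ if $u\in\mathcal{C}([0,T),H^1(\mathbb{R}^n))\cap\mathcal{C}^1([0,T),L^2(\mathbb{R}^n))\cap L^q_{\mathrm{loc}}([0,T)\times\mathbb{R}^n)$ and $v\in\mathcal{C}([0,T),H^1(\mathbb{R}^n))\cap\mathcal{C}^1([0,T),L^2(\mathbb{R}^n))\cap L^p_{\mathrm{loc}}([0,T)\times\mathbb{R}^n)$ satisfy $u(0,x)=\varepsilon u_0(x)$, $v(0,x)=\varepsilon v_0(x)$ in $H^1(\mathbb{R}^n)$ and $$\int_{\mathbb{R}^n}\partial_tu(t,x)\phi(t,x)\,dx-\int_{\mathbb{R}^n}\varepsilon u_1(x)\phi(0,x)\,dx-\int_0^t\!\int_{\mathbb{R}^n}\partial_tu(s,x)\phi_s(s,x)\,dx\,ds+\int_0^t\!\int_{\mathbb{R}^n}\nabla u(s,x)\cdot\nabla\phi(s,x)\,dx\,ds+\int_0^t\!\int_{\mathbb{R}^n}b_1(s)\partial_tu(s,x)\phi(s,x)\,dx\,ds=\int_0^t\!\int_{\mathbb{R}^n}|v(s,x)|^p\phi(s,x)\,dx\,ds,$$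 $$\int_{\mathbb{R}^n}\partial_tv(t,x)\psi(t,x)\,dx-\int_{\mathbb{R}^n}\varepsilon v_1(x)\psi(0,x)\,dx-\int_0^t\!\int_{\mathbb{R}^n}\partial_tv(s,x)\psi_s(s,x)\,dx\,ds+\int_0^t\!\int_{\mathbb{R}^n}\nabla v(s,x)\cdot\nabla\psi(s,x)\,dx\,ds+\int_0^t\!\int_{\mathbb{R}^n}b_2(s)\partial_tv(s,x)\psi(s,x)\,dx\,ds=\int_0^t\!\int_{\mathbb{R}^n}|u(s,x)|^q\psi(s,x)\,dx\,ds$$ for any $\phi,\psi\in\mathcal{C}_0^\infty([0,T)\times\mathbb{R}^n)$ and any $t\in[0,T)$. An energy solution with lifespan $T=T(\varepsilon)$ is an energy solution on $[0,T)$; "blows up in finite time" means $T(\varepsilon)<\infty$, so that the quantitative content is the stated bound on $T(\varepsilon)$. *)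

theory Defs
  imports "HOL-Analysis.Analysis"
begin

text \<open>
  Elements of \<open>L\<^sup>2\<close>, \<open>H\<^sup>1\<close> and \<open>L\<^sup>q\<^sub>l\<^sub>o\<^sub>c\<close> are represented by functions, and equality of such
  elements is equality almost everywhere with respect to Lebesgue measure. Functions of
  time and space are curried, \<open>u t x\<close>; for each \<open>t\<close> the slice \<open>u t\<close> represents the value at
  time \<open>t\<close> of the corresponding map into a function space.
\<close>

primrec Ck :: "nat \<Rightarrow> ('a::euclidean_space \<Rightarrow> real) \<Rightarrow> bool" where
  "Ck 0 f \<longleftrightarrow> continuous_on UNIV f"
| "Ck (Suc k) f \<longleftrightarrow> (\<forall>x. f differentiable (at x)) \<and>
     (\<forall>b\<in>Basis. Ck k (\<lambda>x. frechet_derivative f (at x) b))"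

definition smooth :: "('a::euclidean_space \<Rightarrow> real) \<Rightarrow> bool" where
  "smooth f \<longleftrightarrow> (\<forall>k. Ck k f)"

definition test_function :: "'a::euclidean_space set \<Rightarrow> ('a \<Rightarrow> real) \<Rightarrow> bool" where
  "test_function S \<phi> \<longleftrightarrow>
     smooth \<phi> \<and> (\<exists>K. compact K \<and> K \<subseteq> S \<and> (\<forall>x. x \<notin> K \<longrightarrow> \<phi> x = 0))"

definition grad :: "(real ^ 'n \<Rightarrow> real) \<Rightarrow> real ^ 'n \<Rightarrow> real ^ 'n" where
  "grad \<phi> x = (\<chi> i. frechet_derivative \<phi> (at x) (axis i 1))"

definition L2 :: "(real ^ 'n \<Rightarrow> 'b::euclidean_space) \<Rightarrow> bool" where
  "L2 f \<longleftrightarrow> f \<in> borel_measurable lebesgue \<and> integrable lebesgue (\<lambda>x. (norm (f x))\<^sup>2)"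

definition L2_norm :: "(real ^ 'n \<Rightarrow> 'b::euclidean_space) \<Rightarrow> real" where
  "L2_norm f = sqrt (LINT x|lebesgue. (norm (f x))\<^sup>2)"

definition has_weak_grad :: "(real ^ 'n \<Rightarrow> real) \<Rightarrow> (real ^ 'n \<Rightarrow> real ^ 'n) \<Rightarrow> bool" where
  "has_weak_grad f g \<longleftrightarrow> L2 f \<and> L2 g \<and>
     (\<forall>\<phi>. test_function UNIV \<phi> \<longrightarrow>
        (LINT x|lebesgue. f x *\<^sub>R grad \<phi> x) = - (LINT x|lebesgue. \<phi> x *\<^sub>R g x))"

definition H1 :: "(real ^ 'n \<Rightarrow> real) \<Rightarrow> bool" where
  "H1 f \<longleftrightarrow> (\<exists>g. has_weak_grad f g)"

text \<open>
  The weak gradient is unique up to null sets, so the choice of representative made here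
  does not affect any of the integrals below.
\<close>

definition weak_grad :: "(real ^ 'n \<Rightarrow> real) \<Rightarrow> real ^ 'n \<Rightarrow> real ^ 'n" where
  "weak_grad f = (SOME g. has_weak_grad f g)"

definition H1_norm :: "(real ^ 'n \<Rightarrow> real) \<Rightarrow> real" where
  "H1_norm f = sqrt ((L2_norm f)\<^sup>2 + (L2_norm (weak_grad f))\<^sup>2)"

text \<open>The essential support, relative to \<open>S\<close>, of a function defined almost everywhere on \<open>S\<close>.\<close>

definition ess_supp :: "'a::euclidean_space set \<Rightarrow> ('a \<Rightarrow> real) \<Rightarrow> 'a set" where
  "ess_supp S f = {z \<in> S. \<forall>U. open U \<and> z \<in> U \<longrightarrow>
     \<not> (AE w in lebesgue. w \<in> U \<inter> S \<longrightarrow> f w = 0)}"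

definition time_interval :: "ereal \<Rightarrow> real set" where
  "time_interval T = {t. 0 \<le> t \<and> ereal t < T}"

definition C_L2 :: "real set \<Rightarrow> (real \<Rightarrow> real ^ 'n \<Rightarrow> real) \<Rightarrow> bool" where
  "C_L2 I u \<longleftrightarrow> (\<forall>t\<in>I. L2 (u t)) \<and>
     (\<forall>t\<in>I. ((\<lambda>s. L2_norm (\<lambda>x. u s x - u t x)) \<longlongrightarrow> 0) (at t within I))"

definition C_H1 :: "real set \<Rightarrow> (real \<Rightarrow> real ^ 'n \<Rightarrow> real) \<Rightarrow> bool" where
  "C_H1 I u \<longleftrightarrow> (\<forall>t\<in>I. H1 (u t)) \<and>
     (\<forall>t\<in>I. ((\<lambda>s. H1_norm (\<lambda>x. u s x - u t x)) \<longlongrightarrow> 0) (at t within I))"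

text \<open>\<open>u \<in> C\<^sup>1(I, L\<^sup>2)\<close> with time derivative \<open>ut\<close>.\<close>

definition C1_L2 ::
  "real set \<Rightarrow> (real \<Rightarrow> real ^ 'n \<Rightarrow> real) \<Rightarrow> (real \<Rightarrow> real ^ 'n \<Rightarrow> real) \<Rightarrow> bool" where
  "C1_L2 I u ut \<longleftrightarrow> C_L2 I u \<and> C_L2 I ut \<and>
     (\<forall>t\<in>I. ((\<lambda>s. L2_norm (\<lambda>x. (u s x - u t x) / (s - t) - ut t x)) \<longlongrightarrow> 0) (at t within I))"

definition Lloc :: "real \<Rightarrow> real set \<Rightarrow> (real \<Rightarrow> real ^ 'n \<Rightarrow> real) \<Rightarrow> bool" where
  "Lloc r I u \<longleftrightarrow>
     (\<lambda>(t, x). u t x) \<in> borel_measurable (lebesgue_on (I \<times> UNIV)) \<and>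
     (\<forall>K. compact K \<and> K \<subseteq> I \<times> UNIV \<longrightarrow>
        set_integrable lebesgue K (\<lambda>(t, x). \<bar>u t x\<bar> powr r))"

definition C1_halfline :: "(real \<Rightarrow> real) \<Rightarrow> bool" where
  "C1_halfline b \<longleftrightarrow> (\<exists>b'. continuous_on {0..} b' \<and>
     (\<forall>t\<ge>0. (b has_real_derivative b' t) (at t within {0..})))"

text \<open>
  The weak form of \<open>u\<^sub>t\<^sub>t - \<Delta>u + b(t) u\<^sub>t = f\<close> with initial velocity \<open>w1\<close>. The test functions
  on \<open>[0,T) \<times> \<real>\<^sup>n\<close> are the restrictions of smooth functions on \<open>\<real> \<times> \<real>\<^sup>n\<close> with compact support
  in \<open>(-\<infinity>,T) \<times> \<real>\<^sup>n\<close>; they need not vanish at time \<open>0\<close>.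
\<close>

definition weak_damped_wave ::
  "ereal \<Rightarrow> (real \<Rightarrow> real) \<Rightarrow> (real ^ 'n \<Rightarrow> real) \<Rightarrow> (real \<Rightarrow> real ^ 'n \<Rightarrow> real) \<Rightarrow>
   (real \<Rightarrow> real ^ 'n \<Rightarrow> real) \<Rightarrow> (real \<Rightarrow> real ^ 'n \<Rightarrow> real) \<Rightarrow> bool" where
  "weak_damped_wave T b w1 u ut f \<longleftrightarrow>
     (\<forall>\<phi>. test_function ({s. ereal s < T} \<times> UNIV) \<phi> \<longrightarrow>
       (\<forall>t\<in>time_interval T.
          (LINT x|lebesgue. ut t x * \<phi> (t, x))
          - (LINT x|lebesgue. w1 x * \<phi> (0, x))
          - (LINT s:{0..t}|lebesgue. (LINT x|lebesgue. ut s x * deriv (\<lambda>r. \<phi> (r, x)) s))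
          + (LINT s:{0..t}|lebesgue. (LINT x|lebesgue. weak_grad (u s) x \<bullet> grad (\<lambda>y. \<phi> (s, y)) x))
          + (LINT s:{0..t}|lebesgue. (LINT x|lebesgue. b s * ut s x * \<phi> (s, x)))
          = (LINT s:{0..t}|lebesgue. (LINT x|lebesgue. f s x * \<phi> (s, x)))))"

definition energy_solution ::
  "real \<Rightarrow> real \<Rightarrow> (real \<Rightarrow> real) \<Rightarrow> (real \<Rightarrow> real) \<Rightarrow> real \<Rightarrow>
   (real ^ 'n \<Rightarrow> real) \<Rightarrow> (real ^ 'n \<Rightarrow> real) \<Rightarrow> (real ^ 'n \<Rightarrow> real) \<Rightarrow> (real ^ 'n \<Rightarrow> real) \<Rightarrow>
   ereal \<Rightarrow> (real \<Rightarrow> real ^ 'n \<Rightarrow> real) \<Rightarrow> (real \<Rightarrow> real ^ 'n \<Rightarrow> real) \<Rightarrow> bool" where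
  "energy_solution p q b1 b2 \<epsilon> u0 u1 v0 v1 T u v \<longleftrightarrow>
     C_H1 (time_interval T) u \<and> Lloc q (time_interval T) u \<and>
     C_H1 (time_interval T) v \<and> Lloc p (time_interval T) v \<and>
     (AE x in lebesgue. u 0 x = \<epsilon> * u0 x) \<and>
     (AE x in lebesgue. v 0 x = \<epsilon> * v0 x) \<and>
     (\<exists>ut vt. C1_L2 (time_interval T) u ut \<and> C1_L2 (time_interval T) v vt \<and>
        weak_damped_wave T b1 (\<lambda>x. \<epsilon> * u1 x) u ut (\<lambda>s x. \<bar>v s x\<bar> powr p) \<and>
        weak_damped_wave T b2 (\<lambda>x. \<epsilon> * v1 x) v vt (\<lambda>s x. \<bar>u s x\<bar> powr q))"

end

theory Submission
  imports Defs "HOL-Probability.Probability"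
begin

text \<open>
  Testing the equation for \<open>u\<close> with \<open>exp (\<xi> \<bullet> x)\<close> (cut off outside the cone) turns it into a scalar
  damped equation for the moment \<open>F \<xi> t = \<integral> u(t,x) exp (\<xi> \<bullet> x) dx\<close>. Multiplying by
  \<open>exp (-\<bar>\<xi>\<bar> s)\<close> and using \<open>b \<ge> 0\<close>, \<open>F \<ge> 0\<close>, the damping costs only the factor
  \<open>M = exp (\<integral> b)\<close>: \<open>F\<close> is at least \<open>1/M\<close> times the solution of the undamped equation.

  These bounds are superposed over \<open>\<xi>\<close>. By subordination to Gaussians, \<open>(\<tau>\<^sup>2 - \<bar>x\<bar>\<^sup>2) powr -\<gamma>\<close> is, for
  every \<open>\<gamma> > 0\<close>, a positive superposition of the exponentials \<open>exp (\<xi> \<bullet> x)\<close> whose density is bounded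
  below for \<open>\<bar>\<xi>\<bar> \<tau> \<ge> 1\<close>. With \<open>\<tau> = t + R + 2\<close>, \<open>N = (n - 1)/2\<close> and
  \<open>U(t) = \<integral> u(t,x) (\<tau>\<^sup>2 - \<bar>x\<bar>\<^sup>2) powr -\<gamma> dx\<close> this gives
  \<open>U(t) \<ge> c \<tau> powr (N-1-\<gamma>) \<integral>\<^sub>0\<^sup>t (t-s) (s+R+2) powr (1-N-\<gamma>) \<integral> \<bar>v(s,x)\<bar> powr p dx ds\<close>,
  and the initial data give \<open>U(t) \<ge> c \<epsilon> \<tau> powr (N-\<gamma>)\<close> for \<open>t \<ge> 1\<close>. Conversely, Hoelder's
  inequality bounds \<open>\<integral> \<bar>u\<bar> powr q\<close> below by a power of \<open>U\<close>; for \<open>\<gamma> = 1 - 1/q\<close> this loses exactly a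
  logarithm. In the critical case the powers of \<open>\<tau>\<close> cancel, so \<open>X = \<tau> powr (\<gamma>-N) U\<close> satisfies an
  inequality of the type \<open>X(t) \<ge> c \<integral> (1 - s/t) (log s) powr -a X(s) powr P ds/s\<close> with
  \<open>X \<ge> \<delta> log t\<close>. Iterating lower bounds \<open>D\<^sub>j log (\<tau>/l\<^sub>j) powr \<beta>\<^sub>j\<close> with bounded \<open>l\<^sub>j\<close> forces
  \<open>X = \<infinity>\<close> once \<open>log t\<close> exceeds a multiple of \<open>\<delta> powr (-(P-1)/(P-a))\<close>.
  If \<open>p > q\<close> then \<open>P = pq\<close>, \<open>a = p(q-1)\<close>, \<open>\<delta> \<sim> \<epsilon> powr (pq)\<close>; if \<open>p = q\<close> then \<open>P = p\<close>, \<open>a = p-1\<close>,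
  \<open>\<delta> \<sim> \<epsilon> powr p\<close>.
\<close>

section \<open>Smooth test functions\<close>

text \<open>The exponent \<gamma> = 1 - 1/q is forced from two sides. For larger \<gamma> the time
  integral against the critical source converges; for smaller \<gamma> the power of \<tau> gained in
  time is exactly the power lost in Hoelder's inequality. In both ranges a round of the iteration
  only reproduces the power it started from. At the borderline every round gains a logarithm, while
  the boundary of the cone takes back only part of them; the surplus P - a > 0 fixes the lifespan
  exponent.

  No sign of the solution itself is available, only nonnegativity of its exponential moments. The
  lower bounds for the moments are linear in data and source with nonnegative coefficients, so a
  nonnegative superposition over \<xi> preserves them, and for estimates a lower bound of the
  density suffices. Its exact transform is needed for one purpose: to recognise the superposed
  moments as a weighted spatial mean of \<open>u\<close>, to which Hoelder's inequality
  applies.\<close>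

lemma frechet_derivativeI: "(f has_derivative f') (at x) \<Longrightarrow> frechet_derivative f (at x) = f'"
  by (metis frechet_derivative_at)

lemma Ck_SucD: "Ck (Suc k) f \<Longrightarrow> Ck k f"
proof (induction k arbitrary: f)
  case 0
  then show ?case
    by (auto intro!: continuous_at_imp_continuous_on differentiable_imp_continuous_within)
next
  case (Suc k)
  then show ?case by auto
qed

lemma Ck_SucI:
  assumes "\<And>x. (f has_derivative f' x) (at x)" "\<And>b. b \<in> Basis \<Longrightarrow> Ck k (\<lambda>x. f' x b)"
  shows "Ck (Suc k) f"
proof -
  have "frechet_derivative f (at x) = f' x" for x
    using assms(1) by (rule frechet_derivativeI)
  then show ?thesis using assms by (auto simp: differentiable_def)
qed

lemma Ck_SucE:
  assumes "Ck (Suc k) f"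
  obtains f' where "\<And>x. (f has_derivative f' x) (at x)" "\<And>b. b \<in> Basis \<Longrightarrow> Ck k (\<lambda>x. f' x b)"
  using assms by (intro that[of "\<lambda>x. frechet_derivative f (at x)"])
    (auto simp: frechet_derivative_works)

lemma Ck_const: "Ck k (\<lambda>x. c)"
proof (induction k arbitrary: c)
  case (Suc k)
  show ?case by (rule Ck_SucI[where f'="\<lambda>_ _. 0"]) (auto intro: Suc)
qed auto

lemma Ck_add: "Ck k f \<Longrightarrow> Ck k g \<Longrightarrow> Ck k (\<lambda>x. f x + g x)"
proof (induction k arbitrary: f g)
  case (Suc k)
  obtain f' g' where "\<And>x. (f has_derivative f' x) (at x)" "\<And>b. b \<in> Basis \<Longrightarrow> Ck k (\<lambda>x. f' x b)"
     "\<And>x. (g has_derivative g' x) (at x)" "\<And>b. b \<in> Basis \<Longrightarrow> Ck k (\<lambda>x. g' x b)"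
    using Suc.prems by (metis Ck_SucE)
  then show ?case
    by (intro Ck_SucI[where f'="\<lambda>x h. f' x h + g' x h"] Suc.IH) (auto intro!: derivative_eq_intros)
qed (auto intro: continuous_intros)

lemma Ck_mult: "Ck k f \<Longrightarrow> Ck k g \<Longrightarrow> Ck k (\<lambda>x. f x * g x)"
proof (induction k arbitrary: f g)
  case (Suc k)
  obtain f' g' where *: "\<And>x. (f has_derivative f' x) (at x)" "\<And>b. b \<in> Basis \<Longrightarrow> Ck k (\<lambda>x. f' x b)"
     "\<And>x. (g has_derivative g' x) (at x)" "\<And>b. b \<in> Basis \<Longrightarrow> Ck k (\<lambda>x. g' x b)"
    using Suc.prems by (metis Ck_SucE)
  show ?case
    using * Suc.prems[THEN Ck_SucD]
    by (intro Ck_SucI[where f'="\<lambda>x h. f x * g' x h + f' x h * g x"] Ck_add Suc.IH)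
       (auto intro!: derivative_eq_intros)
qed (auto intro: continuous_intros)

lemma Ck_sum: "(\<And>i. i \<in> S \<Longrightarrow> Ck k (f i)) \<Longrightarrow> Ck k (\<lambda>x. \<Sum>i\<in>S. f i x)"
  by (induction S rule: infinite_finite_induct) (auto intro: Ck_const Ck_add)

lemma Ck_prod: "(\<And>i. i \<in> S \<Longrightarrow> Ck k (f i)) \<Longrightarrow> Ck k (\<lambda>x. \<Prod>i\<in>S. f i x)"
  by (induction S rule: infinite_finite_induct) (auto intro: Ck_const Ck_mult)

lemma Ck_compose_linear:
  fixes A :: "'a::euclidean_space \<Rightarrow> 'b::euclidean_space"
  assumes A: "linear A"
  shows "Ck k f \<Longrightarrow> Ck k (\<lambda>x. f (A x))"
proof (induction k arbitrary: f)
  case 0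
  then show ?case
    using continuous_on_compose2[of UNIV f UNIV A] linear_continuous_on[of A UNIV] A
    by (auto simp: linear_conv_bounded_linear)
next
  case (Suc k)
  obtain f' where *: "\<And>x. (f has_derivative f' x) (at x)" "\<And>b. b \<in> Basis \<Longrightarrow> Ck k (\<lambda>x. f' x b)"
    using Suc.prems by (metis Ck_SucE)
  have dA: "(A has_derivative A) (at x)" for x
    using A by (simp add: linear_conv_bounded_linear bounded_linear_imp_has_derivative)
  \<comment> \<open>\<open>Ck\<close> controls derivatives in basis directions only, while
    \<open>A b\<close> is an arbitrary vector; linearity of \<open>f' y\<close> reduces its
    direction to basis directions.\<close>
  have eq: "f' y h = (\<Sum>c\<in>Basis. (h \<bullet> c) * f' y c)" for y h
  proof -
    have "linear (f' y)" using has_derivative_bounded_linear[OF *(1)] by (simp add: linear_conv_bounded_linear)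
    then show ?thesis
      by (subst euclidean_representation[of h, symmetric]) (simp add: linear_sum linear_scale)
  qed
  show ?case
  proof (rule Ck_SucI)
    show "((\<lambda>x. f (A x)) has_derivative (\<lambda>h. f' (A x) (A h))) (at x)" for x
      using diff_chain_at[OF dA *(1)] by (simp add: o_def)
    show "Ck k (\<lambda>x. f' (A x) (A b))" for b
      by (subst eq) (auto intro!: Ck_sum Ck_mult Ck_const Suc.IH *(2))
  qed
qed

lemma smooth_mult: "smooth f \<Longrightarrow> smooth g \<Longrightarrow> smooth (\<lambda>x. f x * g x)"
  by (simp add: smooth_def Ck_mult)
lemma smooth_prod: "(\<And>i. i \<in> S \<Longrightarrow> smooth (f i)) \<Longrightarrow> smooth (\<lambda>x. \<Prod>i\<in>S. f i x)"
  by (simp add: smooth_def Ck_prod)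
lemma smooth_compose_linear: "linear A \<Longrightarrow> smooth f \<Longrightarrow> smooth (\<lambda>x. f (A x))"
  by (simp add: smooth_def Ck_compose_linear)

lemma smooth_frechet: "smooth f \<Longrightarrow> b \<in> Basis \<Longrightarrow> smooth (\<lambda>x. frechet_derivative f (at x) b)"
  unfolding smooth_def by (metis Ck.simps(2))

lemma smooth_differentiable: "smooth f \<Longrightarrow> f differentiable (at x)"
  unfolding smooth_def by (metis Ck.simps(2))

lemma smooth_continuous: "smooth f \<Longrightarrow> continuous_on S f"
  unfolding smooth_def by (metis Ck.simps(1) continuous_on_subset subset_UNIV)

text \<open>A family closed under differentiation is smooth without any formula for iterated
  derivatives. It serves \<open>exp\<close> as a constant family and \<open>flat\<close> as a
  genuine one.\<close>

lemma smooth_deriv_seq: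
  fixes D :: "nat \<Rightarrow> real \<Rightarrow> real"
  assumes "\<And>k x. (D k has_real_derivative D (Suc k) x) (at x)"
  shows "smooth (D j)"
proof -
  have "Ck k (D j)" for k
  proof (induction k arbitrary: j)
    case 0
    then show ?case using assms by (auto intro!: continuous_at_imp_continuous_on DERIV_isCont)
  next
    case (Suc k)
    show ?case
      by (rule Ck_SucI[where f'="\<lambda>x h. D (Suc j) x * h"])
         (use assms Suc in \<open>auto simp: has_field_derivative_def\<close>)
  qed
  then show ?thesis by (simp add: smooth_def)
qed

lemma smooth_antiderivative:
  fixes f g :: "real \<Rightarrow> real"
  assumes "\<And>x. (f has_real_derivative g x) (at x)" "smooth g"
  shows "smooth f"
proof -
  have "Ck (Suc k) f" for k
    by (rule Ck_SucI[where f'="\<lambda>x h. g x * h"])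
       (use assms in \<open>auto simp: has_field_derivative_def smooth_def\<close>)
  then show ?thesis by (meson Ck_SucD smooth_def)
qed

lemma smooth_compose_affine:
  fixes f :: "real \<Rightarrow> real"
  assumes "smooth f"
  shows "smooth (\<lambda>x. f (a + c * x))"
proof -
  have "Ck k g \<Longrightarrow> Ck k (\<lambda>x. g (a + c * x))" for k and g :: "real \<Rightarrow> real"
  proof (induction k arbitrary: g)
    case 0
    then show ?case by (auto intro!: continuous_on_compose2[of UNIV g] continuous_intros)
  next
    case (Suc k)
    obtain g' where *: "\<And>x. (g has_derivative g' x) (at x)" "\<And>b. b \<in> Basis \<Longrightarrow> Ck k (\<lambda>x. g' x b)"
      using Suc.prems by (metis Ck_SucE)
    have lin: "g' y (c * h) = c * g' y h" for y h
      using linear_scale[of "g' y" c h] has_derivative_bounded_linear[OF *(1), of y]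
      by (simp add: linear_conv_bounded_linear)
    show ?case
    proof (rule Ck_SucI)
      have "((\<lambda>x. a + c * x) has_derivative (\<lambda>h. c * h)) (at x)" for x
        by (auto intro!: derivative_eq_intros)
      from diff_chain_at[OF this *(1)]
      show "((\<lambda>x. g (a + c * x)) has_derivative (\<lambda>h. g' (a + c * x) (c * h))) (at x)" for x
        by (simp add: o_def)
      show "Ck k (\<lambda>x. g' (a + c * x) (c * b))" if "b \<in> Basis" for b
        unfolding lin using that by (auto intro!: Ck_mult Ck_const Suc.IH *(2))
    qed
  qed
  then show ?thesis using assms by (simp add: smooth_def)
qed

lemma smooth_exp: "smooth (exp :: real \<Rightarrow> real)"
  using smooth_deriv_seq[of "\<lambda>_. exp"] by (auto intro: derivative_eq_intros)

text \<open>
  The \<open>k\<close>-th derivative of \<open>exp (-1/x)\<close> on \<open>x > 0\<close> is \<open>P\<^sub>k(1/x) exp (-1/x)\<close> with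
  \<open>P\<^sub>k\<^sub>+\<^sub>1(y) = y\<^sup>2 (P\<^sub>k(y) - P\<^sub>k'(y))\<close>.
\<close>

definition bump_poly :: "nat \<Rightarrow> real poly" where
  "bump_poly k = ((\<lambda>P. [:0,0,1:] * (P - pderiv P)) ^^ k) 1"

definition flat :: "nat \<Rightarrow> real \<Rightarrow> real" where
  "flat k x = (if 0 < x then poly (bump_poly k) (1 / x) * exp (- (1 / x)) else 0)"

text \<open>Read with \<open>y = 1/x\<close>: polynomial growth in \<open>1/x\<close> cannot compete
  with \<open>exp (-1/x)\<close>, which is why all derivatives of the flat function join smoothly to
  0 at the origin.\<close>

lemma poly_exp_neg_tendsto_0: "((\<lambda>y. poly P y * exp (- y)) \<longlongrightarrow> (0::real)) at_top"
proof -
  have p: "((\<lambda>y. y ^ k / exp y) \<longlongrightarrow> (0::real)) at_top" for k :: nat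
    by (rule tendsto_power_div_exp_0)
  have "((\<lambda>y. \<Sum>i\<le>degree P. coeff P i * (y ^ i / exp y)) \<longlongrightarrow> (\<Sum>i\<le>degree P. coeff P i * 0)) at_top"
    by (intro tendsto_intros p)
  then show ?thesis
    by (simp only: poly_altdef exp_minus sum_distrib_right sum_distrib_left) (simp add: divide_inverse mult.assoc)
qed

lemma flat_deriv: "(flat k has_real_derivative flat (Suc k) x) (at x)"
proof -
  consider "x > 0" | "x < 0" | "x = 0" by linarith
  then show ?thesis
  proof cases
    case 1
    have "((\<lambda>x. poly (bump_poly k) (1 / x) * exp (- (1 / x))) has_real_derivative flat (Suc k) x) (at x)"
      using 1 by (auto intro!: derivative_eq_intros poly_DERIV[THEN DERIV_chain2] simp: flat_def bump_poly_def field_simps power2_eq_square)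
    then show ?thesis
      by (rule has_field_derivative_transform_within_open[where S="{0<..}"]) (use 1 in \<open>auto simp: flat_def\<close>)
  next
    case 2
    have "((\<lambda>x. 0) has_real_derivative flat (Suc k) x) (at x)" using 2 by (auto simp: flat_def)
    then show ?thesis
      by (rule has_field_derivative_transform_within_open[where S="{..<0}"]) (use 2 in \<open>auto simp: flat_def\<close>)
  next
    case 3
    have "((\<lambda>h. flat k h / h) \<longlongrightarrow> 0) (at 0)"
    proof (rule filterlim_split_at)
      have "\<forall>\<^sub>F h in at_left 0. 0 = flat k h / h"
        by (auto simp: flat_def eventually_at_filter)
      then show "((\<lambda>h. flat k h / h) \<longlongrightarrow> 0) (at_left 0)"
        by (rule tendsto_cong[THEN iffD1]) auto
      \<comment> \<open>Dividing by \<open>h\<close> multiplies the polynomial in \<open>1/h\<close>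
        by its variable, whence \<open>pCons 0\<close>.\<close>
      have "((\<lambda>h. poly (pCons 0 (bump_poly k)) (inverse h) * exp (- inverse h)) \<longlongrightarrow> 0) (at_right (0::real))"
        by (rule filterlim_compose[OF poly_exp_neg_tendsto_0 filterlim_inverse_at_top_right])
      moreover have "\<forall>\<^sub>F h in at_right 0. poly (pCons 0 (bump_poly k)) (inverse h) * exp (- inverse h) = flat k h / h"
        by (auto simp: flat_def eventually_at_filter divide_inverse)
      ultimately show "((\<lambda>h. flat k h / h) \<longlongrightarrow> 0) (at_right 0)"
        by (rule tendsto_cong[THEN iffD1, rotated])
    qed
    then show ?thesis using 3 by (simp add: DERIV_def flat_def)
  qed
qed

lemma smooth_flat: "smooth (flat k)"
  using smooth_deriv_seq flat_deriv by blast

text \<open>The step is the normalised antiderivative of a bump \<open>g\<close> that is positive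
  exactly on (0,1).\<close>

lemma ex_smooth_step:
  obtains S :: "real \<Rightarrow> real" where "smooth S" "\<And>x. x \<le> 0 \<Longrightarrow> S x = 0" "\<And>x. x \<ge> 1 \<Longrightarrow> S x = 1"
proof -
  define g where "g x = flat 0 x * flat 0 (1 + (-1) * x)" for x
  have sg: "smooth g"
    unfolding g_def by (intro smooth_mult smooth_flat smooth_compose_affine)
  have g0: "g x = 0" if "x \<le> 0 \<or> x \<ge> 1" for x
    using that by (auto simp: g_def flat_def)
  have g1: "g x \<ge> 0" for x by (auto simp: g_def flat_def bump_poly_def)
  have cg: "continuous_on A g" for A by (rule smooth_continuous[OF sg])
  \<comment> \<open>The lower limit -1 lies strictly left of the support of \<open>g\<close>. Both
    branches vanish on an overlap, so \<open>G\<close> is differentiable everywhere by a local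
    argument on one of two open half-lines.\<close>
  define G where "G x = (if x \<ge> -1 then integral {-1..x} g else 0)" for x
  have ig: "integral {-1..x} g = 0" if "x \<le> 0" for x
    using that by (subst integral_cong[where g="\<lambda>_. 0"]) (auto simp: g0)
  have G0: "G x = 0" if "x \<le> 0" for x
    using that ig by (auto simp: G_def)
  have dG: "(G has_real_derivative g x) (at x)" for x
  proof (cases "x > -1")
    case True
    have "((\<lambda>x. integral {-1..x} g) has_real_derivative g x) (at x within {-1..x+1})"
      by (rule integral_has_real_derivative[OF cg]) (use True in auto)
    then have "((\<lambda>x. integral {-1..x} g) has_real_derivative g x) (at x)"
      using True by (subst (asm) at_within_interior) auto
    then show ?thesis
      by (rule has_field_derivative_transform_within_open[where S="{-1<..}"]) (use True in \<open>auto simp: G_def\<close>)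
  next
    case False
    have "((\<lambda>x. 0) has_real_derivative g x) (at x)" using False by (auto simp: g0)
    then show ?thesis
      by (rule has_field_derivative_transform_within_open[where S="{..<0}"]) (use False in \<open>auto simp: G0\<close>)
  qed
  have G1: "G x = G 1" if "x \<ge> 1" for x
  proof -
    have "integral {-1..1} g + integral {1..x} g = integral {-1..x} g"
      using that by (intro Henstock_Kurzweil_Integration.integral_combine integrable_continuous_interval cg) auto
    moreover have "integral {1..x} g = 0"
      by (subst integral_cong[where g="\<lambda>_. 0"]) (auto simp: g0)
    ultimately show ?thesis using that by (auto simp: G_def)
  qed
  have "G 1 > 0"
  proof -
    have dpos: "\<exists>y. (G has_real_derivative y) (at x) \<and> 0 < y" if "0 < x" "x < 1" for x
      using dG[of x] that by (intro exI[of _ "g x"]) (auto simp: g_def flat_def bump_poly_def)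
    have cG: "continuous_on {0..1} G"
      using dG by (auto intro!: continuous_at_imp_continuous_on DERIV_isCont)
    have "G 0 < G 1"
      by (rule DERIV_pos_imp_increasing_open[OF zero_less_one dpos cG])
    then show ?thesis using G0[of 0] by simp
  qed
  show ?thesis
  proof (rule that)
    show "smooth (\<lambda>x. G x * (1 / G 1))"
      by (intro smooth_mult smooth_antiderivative[OF dG sg]) (simp add: smooth_def Ck_const)
    show "G x * (1 / G 1) = 0" if "x \<le> 0" for x using G0[OF that] by simp
    show "G x * (1 / G 1) = 1" if "x \<ge> 1" for x using G1[OF that] \<open>G 1 > 0\<close> by simp
  qed
qed

section \<open>Plateau functions and cut-off exponentials in space and time\<close>

lemma ex_smooth_plateau:
  assumes "a < b" "c < d"
  obtains \<eta> :: "real \<Rightarrow> real" where "smooth \<eta>" "\<And>x. x \<le> a \<or> x \<ge> d \<Longrightarrow> \<eta> x = 0"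
    "\<And>x. b \<le> x \<Longrightarrow> x \<le> c \<Longrightarrow> \<eta> x = 1"
proof -
  obtain S :: "real \<Rightarrow> real" where S: "smooth S" "\<And>x. x \<le> 0 \<Longrightarrow> S x = 0" "\<And>x. x \<ge> 1 \<Longrightarrow> S x = 1"
    using ex_smooth_step by blast
  define \<eta> where "\<eta> x = S (- a / (b - a) + (1 / (b - a)) * x) * S (d / (d - c) + (- (1 / (d - c))) * x)" for x
  have e1: "- a / (b - a) + (1 / (b - a)) * x = (x - a) / (b - a)" for x
    using assms by (simp add: divide_simps)
  have e2: "d / (d - c) + (- (1 / (d - c))) * x = (d - x) / (d - c)" for x
    using assms by (simp add: divide_simps)
  show ?thesis
  proof (rule that[of \<eta>])
    show "smooth \<eta>" unfolding \<eta>_def by (intro smooth_mult smooth_compose_affine S)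
    show "\<eta> x = 0" if "x \<le> a \<or> x \<ge> d" for x
      using that assms S(2)[of "(x - a) / (b - a)"] S(2)[of "(d - x) / (d - c)"]
      unfolding \<eta>_def e1 e2 by (auto simp: divide_nonpos_pos)
    show "\<eta> x = 1" if "b \<le> x" "x \<le> c" for x
      using that assms S(3)[of "(x - a) / (b - a)"] S(3)[of "(d - x) / (d - c)"]
      unfolding \<eta>_def e1 e2 by (auto simp: pos_le_divide_eq)
  qed
qed

lemma smooth_exp_inner: "smooth (\<lambda>x::'a::euclidean_space. exp (\<xi> \<bullet> x))"
  by (rule smooth_compose_linear[OF _ smooth_exp]) (auto intro: linearI simp: inner_add_right)

text \<open>The cut-off is a product of one-dimensional plateaus in the coordinates rather than a
  radial function: each factor is smooth as a composition with a linear form, and the norm never has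
  to be differentiated.\<close>

lemma ex_exp_test_function:
  fixes \<xi> :: "'a::euclidean_space"
  obtains \<psi> where "test_function UNIV \<psi>" "\<And>x. norm x \<le> L \<Longrightarrow> \<psi> x = exp (\<xi> \<bullet> x)"
proof -
  obtain \<eta> :: "real \<Rightarrow> real" where \<eta>: "smooth \<eta>" "\<And>x. x \<le> -L-1 \<or> x \<ge> L+1 \<Longrightarrow> \<eta> x = 0"
    "\<And>x. -L \<le> x \<Longrightarrow> x \<le> L \<Longrightarrow> \<eta> x = 1"
    using ex_smooth_plateau[of "-L-1" "-L" L "L+1"] by auto
  define \<psi> where "\<psi> x = exp (\<xi> \<bullet> x) * (\<Prod>b\<in>Basis. \<eta> (x \<bullet> b))" for x :: 'a
  show ?thesis
  proof (rule that[of \<psi>])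
    have "smooth \<psi>" unfolding \<psi>_def
      by (intro smooth_mult smooth_exp_inner smooth_prod smooth_compose_linear[OF _ \<eta>(1)])
         (auto intro: linearI simp: inner_add_left)
    moreover have "\<psi> x = 0" if "x \<notin> cbox (\<Sum>b\<in>Basis. (-L-1) *\<^sub>R b) (\<Sum>b\<in>Basis. (L+1) *\<^sub>R b)" for x
    proof -
      from that obtain b where "b \<in> Basis" "\<eta> (x \<bullet> b) = 0"
        using \<eta>(2) by (auto simp: mem_box)
      then show ?thesis by (auto simp: \<psi>_def intro!: prod_zero)
    qed
    ultimately show "test_function UNIV \<psi>"
      unfolding test_function_def by (auto intro!: exI[of _ "cbox (\<Sum>b\<in>Basis. (-L-1) *\<^sub>R b) (\<Sum>b\<in>Basis. (L+1) *\<^sub>R b)"])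
    show "\<psi> x = exp (\<xi> \<bullet> x)" if "norm x \<le> L" for x
    proof -
      have "\<eta> (x \<bullet> b) = 1" if b: "b \<in> Basis" for b
        using Basis_le_norm[OF b, of x] \<open>norm x \<le> L\<close> by (intro \<eta>(3)) auto
      then show ?thesis by (simp add: \<psi>_def)
    qed
  qed
qed

lemma test_function_Times:
  assumes "test_function A f" "test_function B g"
  shows "test_function (A \<times> B) (\<lambda>(s, x). f s * g x)"
proof -
  obtain K K' where K: "compact K" "K \<subseteq> A" "\<And>x. x \<notin> K \<Longrightarrow> f x = 0"
     "compact K'" "K' \<subseteq> B" "\<And>x. x \<notin> K' \<Longrightarrow> g x = 0" "smooth f" "smooth g"
    using assms unfolding test_function_def by blast
  have "smooth (\<lambda>z. f (fst z) * g (snd z))"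
    using K by (intro smooth_mult smooth_compose_linear[of fst] smooth_compose_linear[of snd] linear_fst linear_snd)
  moreover have "compact (K \<times> K')" "K \<times> K' \<subseteq> A \<times> B" using K by (auto intro: compact_Times)
  ultimately show ?thesis
    unfolding test_function_def case_prod_beta using K(3,6)
    by (intro conjI exI[of _ "K \<times> K'"]) (auto simp: mem_Times_iff)
qed

text \<open>The agreement with the exponential extends beyond both ends of \<open>{0..t0}\<close>,
  so that the derivatives at the two end points are those of the exponential as well. The value at
  time 0 is kept on purpose: through it the initial velocity enters the weak form.\<close>

lemma ex_time_test_function:
  fixes T :: ereal
  assumes "0 \<le> t0" "ereal t0 < T"
  obtains \<theta> t1 where "test_function {s. ereal s < T} \<theta>" "t0 < t1"
     "\<And>s. - 1 < s \<Longrightarrow> s < t1 \<Longrightarrow> \<theta> s = exp (\<mu> * s)"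
proof -
  obtain t2 where t2: "ereal t0 < ereal t2" "ereal t2 < T"
    using assms by (metis ereal_dense2)
  define t1 where "t1 = (t0 + t2) / 2"
  obtain \<eta> :: "real \<Rightarrow> real" where \<eta>: "smooth \<eta>" "\<And>x. x \<le> -2 \<or> x \<ge> t2 \<Longrightarrow> \<eta> x = 0"
    "\<And>x. -1 \<le> x \<Longrightarrow> x \<le> t1 \<Longrightarrow> \<eta> x = 1"
    using ex_smooth_plateau[of "-2" "-1" t1 t2] t2 unfolding t1_def by auto
  show ?thesis
  proof (rule that[of "\<lambda>s. \<eta> s * exp (\<mu> * s)" t1])
    have "smooth (\<lambda>s. \<eta> s * exp (\<mu> * s))"
      using smooth_compose_affine[OF smooth_exp, of 0 \<mu>] by (intro smooth_mult \<eta>) auto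
    moreover have "{-2..t2} \<subseteq> {s. ereal s < T}"
      using t2 by (auto intro: le_less_trans[rotated])
    ultimately show "test_function {s. ereal s < T} (\<lambda>s. \<eta> s * exp (\<mu> * s))"
      using \<eta>(2) unfolding test_function_def by (auto intro!: exI[of _ "{-2..t2}"])
  qed (use t2 \<eta> in \<open>auto simp: t1_def\<close>)
qed

lemma test_function_frechet:
  assumes "test_function UNIV \<psi>" "b \<in> Basis"
  shows "test_function UNIV (\<lambda>x. frechet_derivative \<psi> (at x) b)"
proof -
  obtain K where K: "compact K" "\<And>x. x \<notin> K \<Longrightarrow> \<psi> x = 0" "smooth \<psi>"
    using assms unfolding test_function_def by blast
  have "frechet_derivative \<psi> (at x) b = 0" if "x \<notin> K" for x
  proof -
    have "(\<psi> has_derivative (\<lambda>_. 0)) (at x)"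
      by (rule has_derivative_transform_within_open[of "\<lambda>_. 0" _ x UNIV "- K"])
         (use K that compact_imp_closed in auto)
    then show ?thesis by (simp add: frechet_derivativeI)
  qed
  then show ?thesis
    using K smooth_frechet assms unfolding test_function_def by blast
qed

section \<open>Pairings in L2 and essential supports\<close>

lemma L2_measurable: "L2 f \<Longrightarrow> f \<in> borel_measurable lebesgue"
  by (simp add: L2_def)

lemma L2_real_iff: "L2 (f :: real ^ 'n \<Rightarrow> real) \<longleftrightarrow> f \<in> borel_measurable lebesgue \<and> integrable lebesgue (\<lambda>x. (f x)\<^sup>2)"
  by (simp add: L2_def)

lemma L2_mult_integrable:
  fixes f g :: "real ^ 'n \<Rightarrow> real"
  assumes "L2 f" "L2 g"
  shows "integrable lebesgue (\<lambda>x. f x * g x)"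
proof (rule Bochner_Integration.integrable_bound)
  show "integrable lebesgue (\<lambda>x. (f x)\<^sup>2 + (g x)\<^sup>2)"
    using assms by (auto simp: L2_real_iff)
  show "(\<lambda>x. f x * g x) \<in> borel_measurable lebesgue"
    using assms[THEN L2_measurable] by measurable
  have "\<bar>f x * g x\<bar> \<le> (f x)\<^sup>2 + (g x)\<^sup>2" for x
    using sum_squares_bound[of "\<bar>f x\<bar>" "\<bar>g x\<bar>"] abs_ge_zero[of "f x * g x"] unfolding power2_abs abs_mult by linarith
  then show "AE x in lebesgue. norm (f x * g x) \<le> norm ((f x)\<^sup>2 + (g x)\<^sup>2)" by simp
qed

lemma L2_add:
  fixes f g :: "real ^ 'n \<Rightarrow> real"
  assumes "L2 f" "L2 g" shows "L2 (\<lambda>x. f x + g x)"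
proof -
  have "integrable lebesgue (\<lambda>x. (f x)\<^sup>2 + 2 * (f x * g x) + (g x)\<^sup>2)"
    using assms L2_mult_integrable[OF assms] by (auto simp: L2_real_iff)
  moreover have "(\<lambda>x. f x + g x) \<in> borel_measurable lebesgue"
    using assms[THEN L2_measurable] by measurable
  ultimately show ?thesis by (simp add: L2_real_iff power2_sum algebra_simps)
qed

lemma L2_cmult:
  fixes f :: "real ^ 'n \<Rightarrow> real"
  assumes "L2 f" shows "L2 (\<lambda>x. c * f x)"
  using assms by (auto simp: L2_real_iff power_mult_distrib)

lemma L2_diff:
  fixes f g :: "real ^ 'n \<Rightarrow> real"
  assumes "L2 f" "L2 g" shows "L2 (\<lambda>x. f x - g x)"
  using L2_add[OF assms(1) L2_cmult[OF assms(2), of "-1"]] by simp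

lemma L2_Cauchy_Schwarz:
  fixes f g :: "real ^ 'n \<Rightarrow> real"
  assumes f: "L2 f" and g: "L2 g"
  shows "\<bar>LINT x|lebesgue. f x * g x\<bar> \<le> L2_norm f * L2_norm g"
proof -
  have m: "f \<in> borel_measurable lebesgue" "g \<in> borel_measurable lebesgue" using f g by (auto simp: L2_def)
  have "(\<integral>\<^sup>+x. ennreal \<bar>f x\<bar> * ennreal \<bar>g x\<bar> \<partial>lebesgue)\<^sup>2
     \<le> (\<integral>\<^sup>+x. (ennreal \<bar>f x\<bar>)\<^sup>2 \<partial>lebesgue) * (\<integral>\<^sup>+x. (ennreal \<bar>g x\<bar>)\<^sup>2 \<partial>lebesgue)"
    using m by (intro Cauchy_Schwarz_nn_integral) auto
  also have "(\<integral>\<^sup>+x. (ennreal \<bar>f x\<bar>)\<^sup>2 \<partial>lebesgue) = ennreal (LINT x|lebesgue. (f x)\<^sup>2)"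
    using f by (subst nn_integral_eq_integral[symmetric]) (auto simp: L2_real_iff ennreal_power)
  also have "(\<integral>\<^sup>+x. (ennreal \<bar>g x\<bar>)\<^sup>2 \<partial>lebesgue) = ennreal (LINT x|lebesgue. (g x)\<^sup>2)"
    using g by (subst nn_integral_eq_integral[symmetric]) (auto simp: L2_real_iff ennreal_power)
  also have "(\<integral>\<^sup>+x. ennreal \<bar>f x\<bar> * ennreal \<bar>g x\<bar> \<partial>lebesgue) = ennreal (LINT x|lebesgue. \<bar>f x * g x\<bar>)"
    using integrable_abs[OF L2_mult_integrable[OF f g]]
    by (subst nn_integral_eq_integral[symmetric]) (auto simp: abs_mult ennreal_mult)
  finally have "(LINT x|lebesgue. \<bar>f x * g x\<bar>)\<^sup>2 \<le> (LINT x|lebesgue. (f x)\<^sup>2) * (LINT x|lebesgue. (g x)\<^sup>2)"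
    by (simp add: ennreal_power ennreal_mult[symmetric])
  then have "LINT x|lebesgue. \<bar>f x * g x\<bar> \<le> sqrt ((LINT x|lebesgue. (f x)\<^sup>2) * (LINT x|lebesgue. (g x)\<^sup>2))"
    by (rule real_le_rsqrt)
  also have "\<dots> = L2_norm f * L2_norm g" by (simp add: L2_norm_def real_sqrt_mult)
  finally show ?thesis using integral_abs_bound[of lebesgue "\<lambda>x. f x * g x"] by linarith
qed

lemma L2_pairing_tendsto:
  fixes \<psi> :: "real ^ 'n \<Rightarrow> real"
  assumes "((\<lambda>s. L2_norm (f s)) \<longlongrightarrow> 0) F" "\<forall>\<^sub>F s in F. L2 (f s)" "L2 \<psi>"
  shows "((\<lambda>s. LINT x|lebesgue. f s x * \<psi> x) \<longlongrightarrow> 0) F"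
proof (rule Lim_null_comparison)
  show "\<forall>\<^sub>F s in F. norm (LINT x|lebesgue. f s x * \<psi> x) \<le> L2_norm (f s) * L2_norm \<psi>"
    using assms(2) by eventually_elim (use L2_Cauchy_Schwarz assms(3) in auto)
  show "((\<lambda>s. L2_norm (f s) * L2_norm \<psi>) \<longlongrightarrow> 0) F"
    using tendsto_mult_right[OF assms(1), of "L2_norm \<psi>"] by simp
qed

lemma C_L2_pairing_continuous:
  assumes "C_L2 I u" "L2 \<psi>"
  shows "continuous_on I (\<lambda>t. LINT x|lebesgue. u t x * \<psi> x)"
  unfolding continuous_on_def
proof
  fix t assume t: "t \<in> I"
  have ev: "\<forall>\<^sub>F s in at t within I. s \<in> I" by (auto simp: eventually_at_filter)
  have L: "L2 (u s)" if "s \<in> I" for s using that assms by (auto simp: C_L2_def)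
  have "((\<lambda>s. LINT x|lebesgue. (u s x - u t x) * \<psi> x) \<longlongrightarrow> 0) (at t within I)"
    using assms t ev by (intro L2_pairing_tendsto) (auto simp: C_L2_def elim!: eventually_mono intro!: L2_diff)
  moreover have "(LINT x|lebesgue. (u s x - u t x) * \<psi> x) = (LINT x|lebesgue. u s x * \<psi> x) - (LINT x|lebesgue. u t x * \<psi> x)"
    if "s \<in> I" for s
    using L2_mult_integrable[OF L[OF that] assms(2)] L2_mult_integrable[OF L[OF t] assms(2)]
    by (simp add: left_diff_distrib)
  ultimately have "((\<lambda>s. (LINT x|lebesgue. u s x * \<psi> x) - (LINT x|lebesgue. u t x * \<psi> x)) \<longlongrightarrow> 0) (at t within I)"
    using ev by (elim tendsto_cong[THEN iffD1, rotated]) (auto elim: eventually_mono)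
  then show "((\<lambda>s. LINT x|lebesgue. u s x * \<psi> x) \<longlongrightarrow> (LINT x|lebesgue. u t x * \<psi> x)) (at t within I)"
    by (rule Lim_null[THEN iffD2])
qed

text \<open>Norm differentiability in L2 passes to pairings by the Cauchy-Schwarz inequality. This
  is the step from an evolution in a function space to an ordinary differential equation for a
  scalar.\<close>

lemma C1_L2_pairing_deriv:
  assumes "C1_L2 I u ut" "L2 \<psi>" and t: "t \<in> I"
  shows "((\<lambda>t. LINT x|lebesgue. u t x * \<psi> x) has_real_derivative (LINT x|lebesgue. ut t x * \<psi> x)) (at t within I)"
  unfolding has_field_derivative_iff
proof -
  have ev: "\<forall>\<^sub>F s in at t within I. s \<in> I \<and> s \<noteq> t" by (auto simp: eventually_at_filter)
  have L: "L2 (u s)" "L2 (ut s)" if "s \<in> I" for s using that assms by (auto simp: C1_L2_def C_L2_def)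
  have Ld: "L2 (\<lambda>x. (u s x - u t x) / (s - t))" if "s \<in> I" for s
    using L2_cmult[OF L2_diff[OF L(1)[OF that] L(1)[OF t]], of "1 / (s - t)"] by simp
  have "((\<lambda>s. LINT x|lebesgue. ((u s x - u t x) / (s - t) - ut t x) * \<psi> x) \<longlongrightarrow> 0) (at t within I)"
    using assms ev by (intro L2_pairing_tendsto) (auto simp: C1_L2_def elim!: eventually_mono intro!: L2_diff Ld L t)
  moreover have "(LINT x|lebesgue. ((u s x - u t x) / (s - t) - ut t x) * \<psi> x)
     = ((LINT x|lebesgue. u s x * \<psi> x) - (LINT x|lebesgue. u t x * \<psi> x)) / (s - t) - (LINT x|lebesgue. ut t x * \<psi> x)"
    if "s \<in> I" for s
  proof -
    have "((u s x - u t x) / (s - t) - ut t x) * \<psi> x = (u s x * \<psi> x - u t x * \<psi> x) / (s - t) - ut t x * \<psi> x" for x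
      by (simp add: left_diff_distrib divide_inverse)
    then show ?thesis
      using L2_mult_integrable[OF L(1)[OF that] assms(2)] L2_mult_integrable[OF L(1)[OF t] assms(2)]
        L2_mult_integrable[OF L(2)[OF t] assms(2)] by simp
  qed
  ultimately have "((\<lambda>s. ((LINT x|lebesgue. u s x * \<psi> x) - (LINT x|lebesgue. u t x * \<psi> x)) / (s - t)
      - (LINT x|lebesgue. ut t x * \<psi> x)) \<longlongrightarrow> 0) (at t within I)"
    using ev by (elim tendsto_cong[THEN iffD1, rotated]) (auto elim: eventually_mono)
  then show "((\<lambda>s. ((LINT x|lebesgue. u s x * \<psi> x) - (LINT x|lebesgue. u t x * \<psi> x)) / (s - t))
      \<longlongrightarrow> (LINT x|lebesgue. ut t x * \<psi> x)) (at t within I)"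
    by (rule Lim_null[THEN iffD2])
qed

lemma test_function_L2:
  fixes \<psi> :: "real ^ 'n \<Rightarrow> real"
  assumes "test_function UNIV \<psi>"
  shows "L2 \<psi>"
proof -
  obtain K where K: "compact K" "\<And>x. x \<notin> K \<Longrightarrow> \<psi> x = 0" "smooth \<psi>"
    using assms unfolding test_function_def by blast
  have c: "continuous_on A \<psi>" for A using K(3) by (rule smooth_continuous)
  have [measurable]: "\<psi> \<in> borel_measurable borel" using c by (rule borel_measurable_continuous_onI)
  have "integrable lborel (\<lambda>x. indicator K x *\<^sub>R (\<psi> x)\<^sup>2)"
    by (intro borel_integrable_compact K continuous_intros c)
  also have "(\<lambda>x. indicator K x *\<^sub>R (\<psi> x)\<^sup>2) = (\<lambda>x. (\<psi> x)\<^sup>2)" using K(2) by (auto simp: fun_eq_iff indicator_def)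
  finally have "integrable lebesgue (\<lambda>x. (\<psi> x)\<^sup>2)" by (subst integrable_completion) auto
  moreover have "\<psi> \<in> borel_measurable lebesgue" by (intro measurable_completion) auto
  ultimately show ?thesis by (simp add: L2_real_iff)
qed

text \<open>Every point outside the essential support has a neighbourhood on which \<open>f\<close>
  vanishes almost everywhere, but there are uncountably many such neighbourhoods. Lindelof's theorem
  leaves a countable family, hence a countable union of null sets.\<close>

lemma AE_ess_supp:
  assumes "ess_supp S f \<subseteq> C"
  shows "AE w in lebesgue. w \<in> S - C \<longrightarrow> f w = 0"
proof -
  define F where "F = {U. open U \<and> (AE w in lebesgue. w \<in> U \<inter> S \<longrightarrow> f w = 0)}"
  obtain F' where F': "F' \<subseteq> F" "countable F'" "\<Union>F' = \<Union>F"
    using Lindelof[of F] by (auto simp: F_def)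
  have "AE w in lebesgue. \<forall>U\<in>F'. w \<in> U \<inter> S \<longrightarrow> f w = 0"
    using F' by (subst AE_ball_countable) (auto simp: F_def)
  moreover have "w \<in> \<Union>F'" if "w \<in> S - C" for w
  proof -
    have "w \<notin> ess_supp S f" using assms that by auto
    then show ?thesis using that unfolding F'(3) by (auto simp: ess_supp_def F_def)
  qed
  ultimately show ?thesis by (auto elim!: eventually_mono)
qed

text \<open>Lebesgue measure on a product is the completion of the product of Borel measures, so the
  slicing of null sets is done for \<open>lborel\<close> and transferred back.\<close>

lemma AE_lebesgue_pair:
  assumes "AE z in lebesgue. P (z :: 'a::euclidean_space \<times> 'b::euclidean_space)"
  shows "AE x in lebesgue. AE y in lebesgue. P (x, y)"
proof -
  have "AE z in lborel. P z" using assms by (simp add: AE_completion_iff)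
  then have "AE z in lborel \<Otimes>\<^sub>M lborel. P z" unfolding lborel_prod .
  then have "AE x in lborel. AE y in lborel. P (x, y)" by (rule lborel_pair.AE_pair)
  then show ?thesis by (simp add: AE_completion_iff)
qed

lemma has_weak_grad_weak_grad: "H1 f \<Longrightarrow> has_weak_grad f (weak_grad f)"
  unfolding H1_def weak_grad_def by (rule someI_ex[of "has_weak_grad f"])

lemma grad_nth: "grad \<phi> x $ i = frechet_derivative \<phi> (at x) (axis i 1)"
  by (simp add: grad_def)

text \<open>The weak gradient is defined by its pairing with scalar test functions. Inserting each
  partial derivative of \<psi> as test function and reading off the matching component moves the
  second derivative onto \<psi>; the sum over the components is the Laplacian.\<close>

lemma weak_grad_pairing:
  fixes f \<psi> :: "real ^ 'n \<Rightarrow> real"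
  assumes f: "H1 f" and \<psi>: "test_function UNIV \<psi>"
  shows "(LINT x|lebesgue. weak_grad f x \<bullet> grad \<psi> x)
    = - (LINT x|lebesgue. f x * (\<Sum>i\<in>UNIV. frechet_derivative (\<lambda>y. frechet_derivative \<psi> (at y) (axis i 1)) (at x) (axis i 1)))"
proof -
  let ?d = "\<lambda>i y. frechet_derivative \<psi> (at y) (axis i 1)"
  let ?dd = "\<lambda>i x. frechet_derivative (?d i) (at x) (axis i 1)"
  let ?g = "weak_grad f"
  have bas: "axis i (1::real) \<in> Basis" for i :: 'n by (simp add: axis_in_Basis_iff)
  have wg: "has_weak_grad f ?g" by (rule has_weak_grad_weak_grad[OF f])
  then have Lf: "L2 f" and Lg: "L2 ?g" by (auto simp: has_weak_grad_def)
  have Lgi: "L2 (\<lambda>x. ?g x $ i)" for i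
  proof -
    have m[measurable]: "?g \<in> borel_measurable lebesgue" using Lg by (simp add: L2_def)
    have mi: "(\<lambda>x. ?g x $ i) \<in> borel_measurable lebesgue"
      using borel_measurable_inner[OF m borel_measurable_const[of "axis i 1"]] by (simp add: inner_axis)
    moreover have "integrable lebesgue (\<lambda>x. (?g x $ i)\<^sup>2)"
    proof (rule Bochner_Integration.integrable_bound)
      show "integrable lebesgue (\<lambda>x. (norm (?g x))\<^sup>2)" using Lg by (simp add: L2_def)
      show "AE x in lebesgue. norm ((?g x $ i)\<^sup>2) \<le> norm ((norm (?g x))\<^sup>2)"
      proof (intro AE_I2)
        fix x
        have "\<bar>?g x $ i\<bar>\<^sup>2 \<le> (norm (?g x))\<^sup>2" by (intro power_mono component_le_norm_cart) auto
        then show "norm ((?g x $ i)\<^sup>2) \<le> norm ((norm (?g x))\<^sup>2)" by simp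
      qed
    qed (use mi in measurable)
    ultimately show ?thesis by (simp add: L2_real_iff)
  qed
  have tf: "test_function UNIV (?d i)" for i by (rule test_function_frechet[OF \<psi> bas])
  have tfd: "test_function UNIV (\<lambda>x. frechet_derivative (?d i) (at x) (axis j 1))" for i j
    by (rule test_function_frechet[OF tf bas])
  have Ld: "L2 (?d i)" for i by (rule test_function_L2[OF tf])
  have comp: "(LINT x|lebesgue. ?d i x * ?g x $ i) = - (LINT x|lebesgue. f x * ?dd i x)" for i
  proof -
    have e: "(LINT x|lebesgue. f x *\<^sub>R grad (?d i) x) = - (LINT x|lebesgue. ?d i x *\<^sub>R ?g x)"
      using wg tf[of i] by (simp add: has_weak_grad_def)
    \<comment> \<open>A component can be taken inside a vector-valued Bochner integral only for an
      integrable integrand; this is checked coordinate by coordinate.\<close>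
    have i1: "integrable lebesgue (\<lambda>x. f x *\<^sub>R grad (?d i) x)"
    proof -
      have "f x *\<^sub>R grad (?d i) x = (\<Sum>j\<in>UNIV. (f x * frechet_derivative (?d i) (at x) (axis j 1)) *\<^sub>R axis j 1)" for x
        by (simp add: vec_eq_iff grad_def axis_def if_distrib cong: if_cong)
      then show ?thesis
        by (simp only:) (intro Bochner_Integration.integrable_sum integrable_scaleR_left L2_mult_integrable[OF Lf] test_function_L2[OF tfd])
    qed
    have i2: "integrable lebesgue (\<lambda>x. ?d i x *\<^sub>R ?g x)"
    proof -
      have "?d i x *\<^sub>R ?g x = (\<Sum>j\<in>UNIV. (?d i x * ?g x $ j) *\<^sub>R axis j 1)" for x
        by (simp add: vec_eq_iff axis_def if_distrib cong: if_cong)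
      then show ?thesis
        by (simp only:) (intro Bochner_Integration.integrable_sum integrable_scaleR_left L2_mult_integrable Ld Lgi)
    qed
    have "(LINT x|lebesgue. f x *\<^sub>R grad (?d i) x) \<bullet> axis i 1 = - (LINT x|lebesgue. ?d i x *\<^sub>R ?g x) \<bullet> axis i 1"
      by (simp only: e inner_minus_left)
    then show ?thesis
      by (simp only: integral_inner_left[OF i1, symmetric] integral_inner_left[OF i2, symmetric] inner_minus_left)
         (simp add: inner_axis grad_nth)
  qed
  have "(LINT x|lebesgue. ?g x \<bullet> grad \<psi> x) = (LINT x|lebesgue. (\<Sum>i\<in>UNIV. ?d i x * ?g x $ i))"
    by (intro Bochner_Integration.integral_cong) (auto simp: inner_vec_def grad_nth mult.commute)
  also have "\<dots> = (\<Sum>i\<in>UNIV. (LINT x|lebesgue. ?d i x * ?g x $ i))"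
    by (intro Bochner_Integration.integral_sum L2_mult_integrable Ld Lgi)
  also have "\<dots> = - (\<Sum>i\<in>UNIV. (LINT x|lebesgue. f x * ?dd i x))"
    by (simp add: comp sum_negf)
  also have "(\<Sum>i\<in>UNIV. (LINT x|lebesgue. f x * ?dd i x)) = (LINT x|lebesgue. (\<Sum>i\<in>UNIV. f x * ?dd i x))"
    by (intro Bochner_Integration.integral_sum[symmetric] L2_mult_integrable Lf test_function_L2 tfd)
  finally show ?thesis by (simp add: sum_distrib_left)
qed

text \<open>Agreement with the exponential on a closed ball determines the derivatives only in its
  interior, hence the strict inequality on \<open>norm x\<close>.\<close>

lemma exp_local_laplacian:
  fixes \<psi> :: "real ^ 'n \<Rightarrow> real"
  assumes \<psi>: "\<And>x. norm x \<le> L \<Longrightarrow> \<psi> x = exp (\<xi> \<bullet> x)" and x: "norm x < L"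
  shows "(\<Sum>i\<in>UNIV. frechet_derivative (\<lambda>y. frechet_derivative \<psi> (at y) (axis i 1)) (at x) (axis i 1)) = (norm \<xi>)\<^sup>2 * \<psi> x"
proof -
  have d: "frechet_derivative f (at y) (axis i 1) = c * \<xi> $ i * exp (\<xi> \<bullet> y)"
    if "\<And>x. norm x < L \<Longrightarrow> f x = c * exp (\<xi> \<bullet> x)" "norm y < L" for f y i c
  proof -
    have "((\<lambda>x. c * exp (\<xi> \<bullet> x)) has_derivative (\<lambda>h. c * (exp (\<xi> \<bullet> y) * (\<xi> \<bullet> h)))) (at y)"
      by (auto intro!: derivative_eq_intros)
    then have "(f has_derivative (\<lambda>h. c * (exp (\<xi> \<bullet> y) * (\<xi> \<bullet> h)))) (at y)"
      by (rule has_derivative_transform_within_open[of _ _ _ _ "ball 0 L"]) (use that in auto)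
    then show ?thesis by (simp add: frechet_derivativeI inner_axis)
  qed
  have 1: "frechet_derivative \<psi> (at y) (axis i 1) = \<xi> $ i * exp (\<xi> \<bullet> y)" if "norm y < L" for y i
    using d[of \<psi> 1 y i] that \<psi> by simp
  have "frechet_derivative (\<lambda>y. frechet_derivative \<psi> (at y) (axis i 1)) (at x) (axis i 1) = \<xi> $ i * \<xi> $ i * exp (\<xi> \<bullet> x)" for i
    using d[of "\<lambda>y. frechet_derivative \<psi> (at y) (axis i 1)" "\<xi> $ i" x i] 1 x by simp
  then show ?thesis using \<psi>[of x] x
    by (simp add: power2_norm_eq_inner inner_vec_def sum_distrib_right)
qed

section \<open>A damped scalar equation\<close>

text \<open>
  With \<open>k\<close> the damping integral, the assumed equation reads \<open>exp (-\<lambda>t) (F' + \<lambda>F) = a - k\<close>. Since \<open>F \<ge> 0\<close>,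
  \<open>k' \<le> b (a - k)\<close>, so Gronwall's inequality gives \<open>a - k \<ge> exp (- \<integral> b) a\<close> because \<open>a\<close> is monotone.
  Only monotonicity of \<open>a\<close> is used, which is why the source need not be continuous in time.
\<close>

lemma damped_ode_core:
  fixes F H a b :: "real \<Rightarrow> real"
  assumes t0: "0 \<le> t0" and lam: "0 < lam"
    and dF: "\<And>t. t \<in> {0..t0} \<Longrightarrow> (F has_real_derivative H t) (at t within {0..t0})"
    and cH: "continuous_on {0..t0} H" and cb: "continuous_on {0..t0} b"
    and b0: "\<And>t. t \<in> {0..t0} \<Longrightarrow> 0 \<le> b t" and bM: "integral {0..t0} b \<le> Bm"
    and ma: "\<And>s t. 0 \<le> s \<Longrightarrow> s \<le> t \<Longrightarrow> t \<le> t0 \<Longrightarrow> a s \<le> a t" and a0: "0 \<le> a 0"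
    and eq: "\<And>t. t \<in> {0..t0} \<Longrightarrow>
       exp (- lam * t) * (H t + lam * F t) = a t - integral {0..t} (\<lambda>s. b s * exp (- lam * s) * H s)"
    and F0: "\<And>t. t \<in> {0..t0} \<Longrightarrow> 0 \<le> F t"
  shows "F t0 \<ge> exp (- lam * t0) * F 0 + exp (- Bm) * integral {0..t0} (\<lambda>s. exp (2 * lam * s - lam * t0) * a s)"
    (is "_ \<ge> ?R") and "continuous_on {0..t0} a"
proof -
  define f where "f s = b s * exp (- lam * s) * H s" for s
  define k where "k t = integral {0..t} f" for t
  define \<beta> where "\<beta> t = integral {0..t} b" for t
  have cf: "continuous_on {0..t0} f" unfolding f_def by (intro continuous_intros cb cH)
  have dk: "(k has_real_derivative f t) (at t within {0..t0})" if "t \<in> {0..t0}" for t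
    unfolding k_def by (rule integral_has_real_derivative[OF cf that])
  have db: "(\<beta> has_real_derivative b t) (at t within {0..t0})" if "t \<in> {0..t0}" for t
    unfolding \<beta>_def by (rule integral_has_real_derivative[OF cb that])
  have ck: "continuous_on {0..t0} k" and c\<beta>: "continuous_on {0..t0} \<beta>" and cF: "continuous_on {0..t0} F"
    using DERIV_continuous_on dk db dF by blast+
  have eq': "exp (- lam * t) * (H t + lam * F t) = a t - k t" if "t \<in> {0..t0}" for t
    using eq[OF that] by (simp add: k_def f_def[abs_def])
  \<comment> \<open>Continuity of \<open>a\<close> is read off from the equation, all of whose other
    terms are continuous.\<close>
  have "continuous_on {0..t0} (\<lambda>t. exp (- lam * t) * (H t + lam * F t) + k t)"
    by (intro continuous_intros cH cF ck)
  then show ca: "continuous_on {0..t0} a"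
    by (rule continuous_on_eq) (use eq' in auto)
  have key: "exp (- Bm) * a t \<le> a t - k t" if t: "t \<in> {0..t0}" for t
  proof -
    \<comment> \<open>Integrating factor \<open>exp (\<beta> s)\<close> for the Gronwall argument,
      with \<open>a\<close> frozen at the final time \<open>t\<close>: no derivative of
      \<open>a\<close> is available, but \<open>a s \<le> a t\<close> gives the sign of the
      derivative of \<Phi>.\<close>
    define \<Phi> where "\<Phi> s = - (exp (\<beta> s) * (k s - a t))" for s
    have "\<Phi> 0 \<le> \<Phi> t"
    proof (rule DERIV_nonneg_imp_increasing_open[where f=\<Phi>])
      fix s assume s: "0 < s" "s < t"
      then have at: "at s within {0..t0} = at s" using t by (intro at_within_Icc_at) auto
      have s': "s \<in> {0..t0}" using s t by auto
      have "(\<Phi> has_real_derivative exp (\<beta> s) * b s * ((a t - k s) - exp (- lam * s) * H s)) (at s)"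
        unfolding \<Phi>_def using dk[OF s'] db[OF s'] unfolding at f_def
        by (auto intro!: derivative_eq_intros simp: algebra_simps)
      moreover have "exp (- lam * s) * H s \<le> exp (- lam * s) * (H s + lam * F s)"
        using F0[OF s'] lam by (intro mult_left_mono) auto
      then have "exp (- lam * s) * H s \<le> a t - k s"
        unfolding eq'[OF s'] using ma[of s t] s t by auto
      then have "0 \<le> exp (\<beta> s) * b s * ((a t - k s) - exp (- lam * s) * H s)"
        using b0[OF s'] by (intro mult_nonneg_nonneg) auto
      ultimately show "\<exists>y. DERIV \<Phi> s :> y \<and> 0 \<le> y" by blast
    next
      have "continuous_on {0..t} k" "continuous_on {0..t} \<beta>"
        using ck c\<beta> t by (auto intro: continuous_on_subset)
      then show "continuous_on {0..t} \<Phi>" unfolding \<Phi>_def by (intro continuous_intros)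
    qed (use t in auto)
    then have "exp (\<beta> t) * (k t - a t) \<le> - a t" by (simp add: \<Phi>_def k_def \<beta>_def)
    then have "exp (- \<beta> t) * (exp (\<beta> t) * (k t - a t)) \<le> exp (- \<beta> t) * (- a t)"
      by (intro mult_left_mono) auto
    then have "exp (- \<beta> t) * a t \<le> a t - k t"
      by (simp add: mult.assoc[symmetric] exp_add[symmetric])
    moreover have "\<beta> t \<le> Bm"
    proof -
      have "\<beta> t \<le> \<beta> t0" unfolding \<beta>_def
        using t b0 cb by (intro integral_subset_le integrable_continuous_interval) (auto intro: continuous_on_subset)
      then show ?thesis using bM by (simp add: \<beta>_def)
    qed
    moreover have "0 \<le> a t" using ma[of 0 t] a0 t by auto
    ultimately show ?thesis
      by (meson dual_order.trans exp_le_cancel_iff le_imp_neg_le mult_right_mono)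
  qed
  \<comment> \<open>Multiplication of the equation by \<open>exp (2 * lam * t)\<close> makes its
    left side the derivative of \<open>exp (lam * t) * F t\<close>.\<close>
  have "((\<lambda>t. exp (2 * lam * t) * (a t - k t)) has_integral (exp (lam * t0) * F t0 - exp (lam * 0) * F 0)) {0..t0}"
  proof (rule fundamental_theorem_of_calculus[OF t0])
    fix t assume t: "t \<in> {0..t0}"
    have "((\<lambda>t. exp (lam * t) * F t) has_real_derivative exp (lam * t) * (H t + lam * F t)) (at t within {0..t0})"
      using dF[OF t] by (auto intro!: derivative_eq_intros simp: algebra_simps)
    moreover have "exp (lam * t) * (H t + lam * F t) = exp (2 * lam * t) * (a t - k t)"
      unfolding eq'[OF t, symmetric] mult.assoc[symmetric] exp_add[symmetric] by (simp add: algebra_simps)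
    ultimately show "((\<lambda>t. exp (lam * t) * F t) has_vector_derivative exp (2 * lam * t) * (a t - k t)) (at t within {0..t0})"
      by (simp add: has_real_derivative_iff_has_vector_derivative)
  qed
  then have "exp (lam * t0) * F t0 - F 0 = integral {0..t0} (\<lambda>t. exp (2 * lam * t) * (a t - k t))"
    by (simp add: integral_unique)
  also have "\<dots> \<ge> integral {0..t0} (\<lambda>t. exp (2 * lam * t) * (exp (- Bm) * a t))"
    by (intro integral_le integrable_continuous_interval continuous_intros ca ck mult_left_mono key) auto
  finally have "exp (- (lam * t0)) * (integral {0..t0} (\<lambda>t. exp (2 * lam * t) * (exp (- Bm) * a t)) + F 0)
      \<le> exp (- (lam * t0)) * (exp (lam * t0) * F t0)"
    by (intro mult_left_mono) auto
  also have "\<dots> = F t0" by (simp add: mult.assoc[symmetric] exp_add[symmetric])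
  finally have 1: "exp (- (lam * t0)) * integral {0..t0} (\<lambda>t. exp (2 * lam * t) * (exp (- Bm) * a t)) + exp (- (lam * t0)) * F 0 \<le> F t0"
    by (simp add: algebra_simps)
  have "exp (- (lam * t0)) * integral {0..t0} (\<lambda>t. exp (2 * lam * t) * (exp (- Bm) * a t))
     = integral {0..t0} (\<lambda>t. exp (- (lam * t0)) * (exp (2 * lam * t) * (exp (- Bm) * a t)))"
    by simp
  also have "(\<lambda>t. exp (- (lam * t0)) * (exp (2 * lam * t) * (exp (- Bm) * a t))) =
     (\<lambda>t. exp (- Bm) * (exp (2 * lam * t - lam * t0) * a t))"
    by (simp add: exp_diff exp_minus divide_inverse ac_simps)
  also have "integral {0..t0} \<dots> = exp (- Bm) * integral {0..t0} (\<lambda>s. exp (2 * lam * s - lam * t0) * a s)"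
    by simp
  finally show "F t0 \<ge> ?R" using 1 by simp
qed

text \<open>Continuation argument: \<open>damped_ode_core\<close> presupposes
  \<open>F \<ge> 0\<close> on an interval and then yields strict positivity at its right end,
  because \<open>a 0 > 0\<close>. Thus the supremum \<open>m\<close> of the times up to which
  \<open>F\<close> is nonnegative cannot be smaller than \<open>t0\<close>.\<close>

lemma damped_ode_nonneg:
  fixes F H a b :: "real \<Rightarrow> real"
  assumes t0: "0 \<le> t0" and lam: "0 < lam"
    and dF: "\<And>t. t \<in> {0..t0} \<Longrightarrow> (F has_real_derivative H t) (at t within {0..t0})"
    and cH: "continuous_on {0..t0} H" and cb: "continuous_on {0..t0} b"
    and b0: "\<And>t. t \<in> {0..t0} \<Longrightarrow> 0 \<le> b t"
    and ma: "\<And>s t. 0 \<le> s \<Longrightarrow> s \<le> t \<Longrightarrow> t \<le> t0 \<Longrightarrow> a s \<le> a t" and a0: "0 < a 0"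
    and eq: "\<And>t. t \<in> {0..t0} \<Longrightarrow>
       exp (- lam * t) * (H t + lam * F t) = a t - integral {0..t} (\<lambda>s. b s * exp (- lam * s) * H s)"
    and F0: "0 \<le> F 0" and H0: "0 \<le> H 0" and t: "t \<in> {0..t0}"
  shows "0 \<le> F t"
proof -
  define S where "S = {t \<in> {0..t0}. \<forall>s\<in>{0..t}. 0 \<le> F s}"
  define m where "m = Sup S"
  have S0: "0 \<in> S" using F0 t0 by (auto simp: S_def)
  have bdd: "bdd_above S" by (auto simp: S_def intro: bdd_aboveI[of _ t0])
  have m0: "0 \<le> m" "m \<le> t0"
  proof -
    show "0 \<le> m" unfolding m_def by (rule cSup_upper[OF S0 bdd])
    show "m \<le> t0" unfolding m_def using S0 by (intro cSup_least) (auto simp: S_def)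
  qed
  have cF: "continuous_on {0..t0} F" using DERIV_continuous_on dF by blast
  have lt: "0 \<le> F s" if s: "0 \<le> s" "s < m" for s
  proof -
    have "S \<noteq> {}" using S0 by auto
    then obtain x where "x \<in> S" "s < x" using s bdd less_cSup_iff[of S s] unfolding m_def by auto
    then show ?thesis using s by (auto simp: S_def)
  qed
  have le: "0 \<le> F s" if "s \<in> {0..m}" for s
  proof (cases "s < m \<or> s = 0")
    case True
    then show ?thesis using lt that F0 by auto
  next
    case False
    then have s: "s = m" "0 < m" using that by auto
    have "closure {0..<m} = {0..m}" using s by simp
    moreover have "continuous_on {0..m} F" using cF m0 by (auto intro: continuous_on_subset)
    ultimately show ?thesis
      using continuous_ge_on_closure[of "{0..<m}" F s 0] lt s by auto
  qed
  have mS: "m = t0"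
  proof (rule ccontr)
    assume "m \<noteq> t0"
    then have mt: "m < t0" using m0 by auto
    have "\<exists>d>0. \<forall>s\<in>{0..t0}. m < s \<longrightarrow> s < m + d \<longrightarrow> 0 \<le> F s"
    proof (cases "F m > 0")
      case True
      from cF have "continuous (at m within {0..t0}) F" using m0 by (auto simp: continuous_on_eq_continuous_within)
      with True obtain d where "d > 0" "\<And>s. s \<in> {0..t0} \<Longrightarrow> dist s m < d \<Longrightarrow> dist (F s) (F m) < F m"
        unfolding continuous_within_eps_delta by meson
      then show ?thesis by (intro exI[of _ d]) (force simp: dist_real_def)
    next
      case False
      have m: "m = 0"
      proof (rule ccontr)
        assume "m \<noteq> 0"
        then have mpos: "0 < m" using m0 by auto
        have sub: "{0..m} \<subseteq> {0..t0}" using m0 by auto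
        have "F m \<ge> exp (- lam * m) * F 0 + exp (- integral {0..m} b) * integral {0..m} (\<lambda>s. exp (2 * lam * s - lam * m) * a s)"
          and ca: "continuous_on {0..m} a"
          by (rule damped_ode_core[where Bm="integral {0..m} b", OF m0(1) lam DERIV_subset[OF dF sub]
                continuous_on_subset[OF cH sub] continuous_on_subset[OF cb sub]]; use sub m0 a0 le ma b0 eq in force)+
        moreover have "integral {0..m} (\<lambda>s. exp (- lam * m) * a 0) \<le> integral {0..m} (\<lambda>s. exp (2 * lam * s - lam * m) * a s)"
        proof (intro integral_le integrable_continuous_interval continuous_intros ca)
          fix s assume s: "s \<in> {0..m}"
          have "a 0 \<le> a s" using ma[of 0 s] s m0 by auto
          then show "exp (- lam * m) * a 0 \<le> exp (2 * lam * s - lam * m) * a s"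
            using a0 lam s by (intro mult_mono) auto
        qed
        moreover have "0 < integral {0..m} (\<lambda>s. exp (- lam * m) * a 0)"
          using a0 mpos by simp
        ultimately have "0 < F m"
          using F0 by (smt (verit) exp_gt_zero mult_nonneg_nonneg mult_pos_pos)
        then show False using False by simp
      qed
      \<comment> \<open>What remains is \<open>m = 0\<close> with \<open>F 0 = 0\<close>. There the
        equation reduces to \<open>H 0 = a 0 > 0\<close>, so \<open>F\<close> leaves 0
        upwards.\<close>
      then have "F 0 = 0" using False F0 by auto
      have "H 0 = a 0" using eq[of 0] t0 \<open>F 0 = 0\<close> by auto
      then have "0 < H 0" using a0 by simp
      from has_real_derivative_pos_inc_right[OF dF this] t0
      obtain d where "d > 0" "\<forall>h>0. 0 + h \<in> {0..t0} \<longrightarrow> h < d \<longrightarrow> F 0 < F (0 + h)"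
        by auto
      then show ?thesis using m \<open>F 0 = 0\<close> by (intro exI[of _ d]) (auto simp: less_imp_le)
    qed
    then obtain d where d: "d > 0" "\<And>s. s \<in> {0..t0} \<Longrightarrow> m < s \<Longrightarrow> s < m + d \<Longrightarrow> 0 \<le> F s" by auto
    define r where "r = min t0 (m + d / 2)"
    have r: "m < r" "r \<le> t0" "r < m + d" using d mt by (auto simp: r_def)
    have "r \<in> S"
      unfolding S_def using r m0 le d(2) by (auto simp: not_le[symmetric]) (metis atLeastAtMost_iff le_less_trans linorder_not_le order_trans)
    then have "r \<le> m" unfolding m_def by (intro cSup_upper bdd)
    then show False using r by simp
  qed
  show ?thesis using le t mS by auto
qed

lemma damped_ode_lower_bound:
  fixes F H a b :: "real \<Rightarrow> real"
  assumes t0: "0 \<le> t0" and lam: "0 < lam"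
    and dF: "\<And>t. t \<in> {0..t0} \<Longrightarrow> (F has_real_derivative H t) (at t within {0..t0})"
    and cH: "continuous_on {0..t0} H" and cb: "continuous_on {0..t0} b"
    and b0: "\<And>t. t \<in> {0..t0} \<Longrightarrow> 0 \<le> b t" and bM: "integral {0..t0} b \<le> Bm"
    and ma: "\<And>s t. 0 \<le> s \<Longrightarrow> s \<le> t \<Longrightarrow> t \<le> t0 \<Longrightarrow> a s \<le> a t" and a0: "0 < a 0"
    and eq: "\<And>t. t \<in> {0..t0} \<Longrightarrow>
       exp (- lam * t) * (H t + lam * F t) = a t - integral {0..t} (\<lambda>s. b s * exp (- lam * s) * H s)"
    and F0: "0 \<le> F 0" and H0: "0 \<le> H 0"
  shows "F t0 \<ge> exp (- lam * t0) * F 0 + exp (- Bm) * integral {0..t0} (\<lambda>s. exp (2 * lam * s - lam * t0) * a s)"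
    and "continuous_on {0..t0} a"
  using damped_ode_core[OF t0 lam dF cH cb b0 bM ma _ eq] a0
    damped_ode_nonneg[OF t0 lam dF cH cb b0 ma a0 eq F0 H0] by auto

section \<open>The damped wave equation tested with exponentials\<close>

lemma AE_ex_in_interval:
  assumes "AE s in lebesgue. P s" "a < (b::real)"
  shows "\<exists>s\<in>{a<..<b}. P s"
proof (rule ccontr)
  assume "\<not> ?thesis"
  moreover have "AE s in lborel. P s" using assms(1) by (simp add: AE_completion_iff)
  ultimately have "AE s in lborel. s \<notin> {a<..<b}" by (auto elim: eventually_mono)
  then have "{a<..<b} \<in> null_sets lborel" by (subst AE_iff_null_sets) auto
  then show False using assms(2) by (simp add: null_sets_def)
qed

lemma set_integral_lebesgue_continuous:
  fixes f :: "real \<Rightarrow> real"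
  shows "continuous_on {a..b} f \<Longrightarrow> (LINT s:{a..b}|lebesgue. f s) = integral {a..b} f"
  by (intro set_lebesgue_integral_eq_integral absolutely_integrable_continuous_real)

lemma set_integral_lebesgue_cong:
  fixes f g :: "real \<Rightarrow> real"
  assumes "\<And>s. s \<in> A \<Longrightarrow> f s = g s"
  shows "(LINT s:A|lebesgue. f s) = (LINT s:A|lebesgue. g s)"
  unfolding set_lebesgue_integral_def using assms
  by (intro Bochner_Integration.integral_cong) (auto simp: indicator_def)

text \<open>One equation of the system in isolation, with an abstract nonnegative source
  \<open>g\<close>. The system is two instances of it, each having a power of the other component as
  source. Later the locale also serves as a predicate under quantifiers, so that constants can be
  fixed before \<epsilon>, the lifespan and the solution.\<close>

locale damped_wave =
  fixes b :: "real \<Rightarrow> real" and R \<epsilon> :: real and w0 w1 :: "real ^ 'n \<Rightarrow> real" and T :: ereal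
    and u ut g :: "real \<Rightarrow> real ^ 'n \<Rightarrow> real"
  assumes b_C1: "C1_halfline b" and b_int: "b absolutely_integrable_on {0..}"
    and b_nonneg: "\<And>t. 0 \<le> t \<Longrightarrow> 0 \<le> b t"
    and R_pos: "0 < R" and eps_pos: "0 < \<epsilon>" and T_pos: "0 < T"
    and u_H1: "\<And>t. t \<in> time_interval T \<Longrightarrow> H1 (u t)"
    and u_C1: "C1_L2 (time_interval T) u ut"
    and u_init: "AE x in lebesgue. u 0 x = \<epsilon> * w0 x"
    and u_eq: "weak_damped_wave T b (\<lambda>x. \<epsilon> * w1 x) u ut g"
    and w_L2: "L2 w0" "L2 w1"
    and w_nonneg: "AE x in lebesgue. 0 \<le> w0 x" "AE x in lebesgue. 0 \<le> w1 x"
    and w_supp: "AE x in lebesgue. R < norm x \<longrightarrow> w0 x = 0" "AE x in lebesgue. R < norm x \<longrightarrow> w1 x = 0"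
    and w_nontrivial: "\<not> ((AE x in lebesgue. w0 x = 0) \<and> (AE x in lebesgue. w1 x = 0))"
    and u_supp: "AE (s, x) in lebesgue. s \<in> time_interval T \<longrightarrow> s + R < norm x \<longrightarrow> u s x = 0"
    and g_nonneg: "\<And>s x. 0 \<le> g s x"
    and g_meas: "(\<lambda>(s, x). g s x) \<in> borel_measurable (lebesgue_on (time_interval T \<times> UNIV))"
    and g_int: "\<And>K. compact K \<Longrightarrow> K \<subseteq> time_interval T \<times> UNIV \<Longrightarrow> set_integrable lebesgue K (\<lambda>(s, x). g s x)"
    and g_supp: "AE (s, x) in lebesgue. s \<in> time_interval T \<longrightarrow> s + R < norm x \<longrightarrow> g s x = 0"
begin

abbreviation "I \<equiv> time_interval T"

lemma zero_I: "0 \<in> I" using T_pos by (simp add: time_interval_def zero_ereal_def)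

lemma Icc_I: "t \<in> I \<Longrightarrow> {0..t} \<subseteq> I"
  by (auto simp: time_interval_def intro: le_less_trans[rotated])

lemma I_nonneg: "t \<in> I \<Longrightarrow> 0 \<le> t" by (simp add: time_interval_def)

lemma u_L2: "t \<in> I \<Longrightarrow> L2 (u t)" using u_C1 by (auto simp: C1_L2_def C_L2_def)

lemma b_cont: "continuous_on {0..t} b"
proof -
  obtain b' where "\<And>t. 0 \<le> t \<Longrightarrow> (b has_real_derivative b' t) (at t within {0..})"
    using b_C1 by (auto simp: C1_halfline_def)
  then have "continuous_on {0..} b" using DERIV_continuous_on[of "{0..}" b b'] by auto
  then show ?thesis by (rule continuous_on_subset) auto
qed

lemma b_bound: "integral {0..t} b \<le> integral {0..} b"
  using b_nonneg set_lebesgue_integral_eq_integral(1)[OF b_int] b_cont[of t]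
  by (intro integral_subset_le) (auto intro: integrable_continuous_interval)

text \<open>
  The support condition only speaks about almost every \<open>s\<close>; continuity in \<open>L\<^sup>2\<close> transfers it to every \<open>t\<close>,
  at the price of enlarging the cone by \<open>1\<close>, which is harmless below.
\<close>

lemma u_cone:
  assumes t: "t \<in> I"
  shows "AE x in lebesgue. t + R + 1 < norm x \<longrightarrow> u t x = 0"
proof -
  define good where "good s \<longleftrightarrow> (AE x in lebesgue. s \<in> I \<longrightarrow> s + R < norm x \<longrightarrow> u s x = 0)" for s
  have good: "AE s in lebesgue. good s"
    using AE_lebesgue_pair[OF u_supp] by (simp add: good_def)
  define A where "A = {x::real^'n. t + R + 1 < norm x}"
  have A: "A \<in> sets lebesgue"
  proof -
    have "open A" unfolding A_def by (intro open_Collect_less continuous_intros)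
    then show ?thesis by simp
  qed
  have int: "integrable lebesgue (\<lambda>x. indicator A x * (u t x)\<^sup>2)"
    using integrable_real_mult_indicator[OF A, of "\<lambda>x. (u t x)\<^sup>2"] u_L2[OF t] by (simp add: L2_real_iff mult.commute)
  define c where "c = (LINT x|lebesgue. indicator A x * (u t x)\<^sup>2)"
  have "c = 0"
  proof (rule ccontr)
    assume "c \<noteq> 0"
    moreover have "0 \<le> c" unfolding c_def by (intro integral_nonneg_AE) auto
    ultimately have "0 < sqrt c" by simp
    have "((\<lambda>s. L2_norm (\<lambda>x. u s x - u t x)) \<longlongrightarrow> 0) (at t within I)"
      using u_C1 t by (auto simp: C1_L2_def C_L2_def)
    from tendstoD[OF this \<open>0 < sqrt c\<close>]
    obtain d where d: "d > 0" "\<And>s. s \<in> I \<Longrightarrow> s \<noteq> t \<Longrightarrow> dist s t < d \<Longrightarrow> dist (L2_norm (\<lambda>x. u s x - u t x)) 0 < sqrt c"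
      unfolding eventually_at by blast
    obtain t' where t': "ereal t < ereal t'" "ereal t' < T"
      using t ereal_dense2[of "ereal t" T] by (auto simp: time_interval_def)
    \<comment> \<open>The three bounds on \<open>s\<close> have separate purposes:
      \<open>t + d\<close> for closeness in L2, \<open>t + 1\<close> so that the cone at time
      \<open>s\<close> stays inside the enlarged cone at time \<open>t\<close>, and
      \<open>t'\<close> for staying within the lifespan.\<close>
    define m where "m = min (min (t + d) (t + 1)) t'"
    have "t < m" using d t' by (auto simp: m_def)
    from AE_ex_in_interval[OF good this] obtain s where s: "t < s" "s < m" "good s" by auto
    have "ereal s < ereal t'" using s by (simp add: m_def)
    then have "ereal s < T" using t'(2) by (rule less_trans)
    then have sI: "s \<in> I" using s t by (auto simp: time_interval_def)
    have L: "L2 (\<lambda>x. u s x - u t x)" by (intro L2_diff u_L2 sI t)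
    have "c \<le> (LINT x|lebesgue. (u s x - u t x)\<^sup>2)"
      unfolding c_def
    proof (rule integral_mono_AE[OF int])
      show "integrable lebesgue (\<lambda>x. (u s x - u t x)\<^sup>2)" using L by (simp add: L2_real_iff)
      show "AE x in lebesgue. indicator A x * (u t x)\<^sup>2 \<le> (u s x - u t x)\<^sup>2"
        using s(3) unfolding good_def
        by (rule eventually_mono) (use s sI in \<open>auto simp: A_def m_def indicator_def\<close>)
    qed
    then have "sqrt c \<le> L2_norm (\<lambda>x. u s x - u t x)" by (simp add: L2_norm_def)
    moreover have "dist s t < d" using s by (auto simp: m_def dist_real_def)
    ultimately show False using d(2)[OF sI] s by (auto simp: dist_real_def)
  qed
  then have "AE x in lebesgue. indicator A x * (u t x)\<^sup>2 = 0"
    unfolding c_def using int by (subst (asm) integral_nonneg_eq_0_iff_AE) auto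
  then show ?thesis by (rule eventually_mono) (auto simp: A_def indicator_def split: if_splits)
qed

section \<open>Pairings of the solution with a fixed cut-off exponential\<close>

context
  fixes \<psi> :: "real ^ 'n \<Rightarrow> real" and \<xi> :: "real ^ 'n" and t0 L :: real
  assumes t0: "t0 \<in> I" and L: "t0 + R + 1 < L"
    and \<psi>: "test_function UNIV \<psi>" and \<psi>_exp: "\<And>x. norm x \<le> L \<Longrightarrow> \<psi> x = exp (\<xi> \<bullet> x)"
begin

definition "F\<psi> t = (LINT x|lebesgue. u t x * \<psi> x)"
definition "H\<psi> t = (LINT x|lebesgue. ut t x * \<psi> x)"

lemma \<psi>_L2: "L2 \<psi>" by (rule test_function_L2[OF \<psi>])

lemma F\<psi>_exp:
  assumes "t \<in> {0..t0}"
  shows "AE x in lebesgue. u t x * \<psi> x = u t x * exp (\<xi> \<bullet> x)" "F\<psi> t = (LINT x|lebesgue. u t x * exp (\<xi> \<bullet> x))"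
proof -
  have t: "t \<in> I" using assms Icc_I[OF t0] by auto
  show ae: "AE x in lebesgue. u t x * \<psi> x = u t x * exp (\<xi> \<bullet> x)"
    using u_cone[OF t]
  proof eventually_elim
    case (elim x)
    then show ?case using \<psi>_exp[of x] assms L by (cases "norm x \<le> L") auto
  qed
  have m: "(\<lambda>x. u t x * \<psi> x) \<in> borel_measurable lebesgue"
    using u_L2[OF t] \<psi>_L2 by (auto intro!: borel_measurable_times simp: L2_def)
  show "F\<psi> t = (LINT x|lebesgue. u t x * exp (\<xi> \<bullet> x))"
    unfolding F\<psi>_def by (rule integral_cong_AE[OF m borel_measurable_AE[OF m ae] ae])
qed

lemma F\<psi>_deriv: "t \<in> {0..t0} \<Longrightarrow> (F\<psi> has_real_derivative H\<psi> t) (at t within {0..t0})"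
  unfolding F\<psi>_def[abs_def] H\<psi>_def
  using C1_L2_pairing_deriv[OF u_C1 \<psi>_L2] Icc_I[OF t0] by (blast intro: DERIV_subset)

lemma H\<psi>_cont: "continuous_on {0..t0} H\<psi>"
  unfolding H\<psi>_def[abs_def]
  using C_L2_pairing_continuous[of I ut, OF _ \<psi>_L2] Icc_I[OF t0] u_C1
  by (auto simp: C1_L2_def intro: continuous_on_subset)

lemma F\<psi>_cont: "continuous_on {0..t0} F\<psi>"
  using F\<psi>_deriv DERIV_continuous_on by blast

lemma laplacian_pairing:
  assumes "s \<in> {0..t0}"
  shows "(LINT x|lebesgue. weak_grad (u s) x \<bullet> grad \<psi> x) = - (norm \<xi>)\<^sup>2 * F\<psi> s"
proof -
  have s: "s \<in> I" using assms Icc_I[OF t0] by auto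
  let ?dd = "\<lambda>x. \<Sum>i\<in>UNIV. frechet_derivative (\<lambda>y. frechet_derivative \<psi> (at y) (axis i 1)) (at x) (axis i 1)"
  have m: "(\<lambda>x. (norm \<xi>)\<^sup>2 * (u s x * \<psi> x)) \<in> borel_measurable lebesgue"
    using u_L2[OF s] \<psi>_L2 by (auto intro!: borel_measurable_times simp: L2_def)
  have ae: "AE x in lebesgue. (norm \<xi>)\<^sup>2 * (u s x * \<psi> x) = u s x * ?dd x"
    using u_cone[OF s]
  proof eventually_elim
    case (elim x)
    then show ?case using exp_local_laplacian[OF \<psi>_exp, of L x] assms L by (cases "norm x < L") auto
  qed
  have "(LINT x|lebesgue. u s x * ?dd x) = (LINT x|lebesgue. (norm \<xi>)\<^sup>2 * (u s x * \<psi> x))"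
    using integral_cong_AE[OF m borel_measurable_AE[OF m ae] ae] by simp
  then show ?thesis
    using weak_grad_pairing[OF u_H1[OF s] \<psi>] by (simp add: F\<psi>_def)
qed

text \<open>
  The test function is \<open>exp (-\<bar>\<xi>\<bar> s) \<psi>(x)\<close>: with this time factor the terms without damping combine to a total
  derivative, and no time derivative falls on the source.
\<close>

lemma weak_identity:
  assumes t: "t \<in> {0..t0}"
  defines "l \<equiv> norm \<xi>"
  shows "exp (- l * t) * (H\<psi> t + l * F\<psi> t) =
     H\<psi> 0 + l * F\<psi> 0 + (LINT s:{0..t}|lebesgue. exp (- l * s) * (LINT x|lebesgue. g s x * \<psi> x))
      - integral {0..t} (\<lambda>s. b s * exp (- l * s) * H\<psi> s)"
    and "H\<psi> 0 = \<epsilon> * (LINT x|lebesgue. w1 x * \<psi> x)"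
proof -
  obtain \<theta> t1 where \<theta>: "test_function {s. ereal s < T} \<theta>" "t0 < t1"
     "\<And>s. - 1 < s \<Longrightarrow> s < t1 \<Longrightarrow> \<theta> s = exp (- l * s)"
    using ex_time_test_function[of t0 T "- l"] t0 by (auto simp: time_interval_def)
  have tf: "test_function ({s. ereal s < T} \<times> UNIV) (\<lambda>(s, x). \<theta> s * \<psi> x)"
    by (rule test_function_Times[OF \<theta>(1) \<psi>])
  have th: "\<theta> s = exp (- l * s)" if "s \<in> {0..t0}" for s using \<theta> that by auto
  have dth: "deriv (\<lambda>r. \<theta> r * c) s = - l * exp (- l * s) * c" if "s \<in> {0..t0}" for s c
  proof (rule DERIV_imp_deriv)
    have "((\<lambda>r. exp (- l * r) * c) has_real_derivative - l * exp (- l * s) * c) (at s)"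
      by (auto intro!: derivative_eq_intros)
    then show "((\<lambda>r. \<theta> r * c) has_real_derivative - l * exp (- l * s) * c) (at s)"
      by (rule has_field_derivative_transform_within_open[where S="{-1<..<t1}"]) (use \<theta> that in auto)
  qed
  have gr: "grad (\<lambda>y. \<theta> s * \<psi> y) x = \<theta> s *\<^sub>R grad \<psi> x" for s x
  proof -
    have "\<psi> differentiable (at x)" using \<psi> by (auto simp: test_function_def intro: smooth_differentiable)
    then have "(\<psi> has_derivative frechet_derivative \<psi> (at x)) (at x)" by (simp add: frechet_derivative_works)
    then have "((\<lambda>y. \<theta> s * \<psi> y) has_derivative (\<lambda>h. \<theta> s * frechet_derivative \<psi> (at x) h)) (at x)"
      by (auto intro!: derivative_eq_intros)
    then show ?thesis by (simp add: grad_def frechet_derivativeI vec_eq_iff)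
  qed
  have main: "exp (- l * t) * H\<psi> t - \<epsilon> * (LINT x|lebesgue. w1 x * \<psi> x)
      + integral {0..t} (\<lambda>s. l * exp (- l * s) * H\<psi> s)
      + integral {0..t} (\<lambda>s. exp (- l * s) * (- l\<^sup>2 * F\<psi> s))
      + integral {0..t} (\<lambda>s. b s * exp (- l * s) * H\<psi> s)
      = (LINT s:{0..t}|lebesgue. exp (- l * s) * (LINT x|lebesgue. g s x * \<psi> x))"
    if t: "t \<in> {0..t0}" for t
  proof -
    have tI: "t \<in> I" using t Icc_I[OF t0] by auto
    have sub: "{0..t} \<subseteq> {0..t0}" using t by auto
    have s0: "s \<in> {0..t0}" if "s \<in> {0..t}" for s using that t by auto
    have cH: "continuous_on {0..t} H\<psi>" and cF: "continuous_on {0..t} F\<psi>"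
      using H\<psi>_cont F\<psi>_cont sub by (auto intro: continuous_on_subset)
    have e1: "(LINT x|lebesgue. ut t x * (\<theta> t * \<psi> x)) = exp (- l * t) * H\<psi> t"
    proof -
      have "(LINT x|lebesgue. ut t x * (\<theta> t * \<psi> x)) = (LINT x|lebesgue. exp (- l * t) * (ut t x * \<psi> x))"
        by (intro Bochner_Integration.integral_cong) (simp_all add: th[OF t] mult_ac)
      then show ?thesis by (simp add: H\<psi>_def)
    qed
    have e2: "(LINT x|lebesgue. \<epsilon> * w1 x * (\<theta> 0 * \<psi> x)) = \<epsilon> * (LINT x|lebesgue. w1 x * \<psi> x)"
      using th[of 0] t by (simp add: mult.assoc)
    have e3: "(LINT s:{0..t}|lebesgue. (LINT x|lebesgue. ut s x * deriv (\<lambda>r. \<theta> r * \<psi> x) s))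
      = - integral {0..t} (\<lambda>s. l * exp (- l * s) * H\<psi> s)"
    proof -
      have "(LINT s:{0..t}|lebesgue. (LINT x|lebesgue. ut s x * deriv (\<lambda>r. \<theta> r * \<psi> x) s))
         = (LINT s:{0..t}|lebesgue. - (l * exp (- l * s) * H\<psi> s))"
      proof (rule set_integral_lebesgue_cong)
        fix s assume s: "s \<in> {0..t}"
        have "(LINT x|lebesgue. ut s x * deriv (\<lambda>r. \<theta> r * \<psi> x) s) = (LINT x|lebesgue. (- l * exp (- l * s)) * (ut s x * \<psi> x))"
          by (rule Bochner_Integration.integral_cong[OF refl], simp only: dth[OF s0[OF s]], simp add: mult_ac)
        also have "\<dots> = (- l * exp (- l * s)) * (LINT x|lebesgue. ut s x * \<psi> x)" by (rule integral_mult_right_zero)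
        finally show "(LINT x|lebesgue. ut s x * deriv (\<lambda>r. \<theta> r * \<psi> x) s) = - (l * exp (- l * s) * H\<psi> s)"
          by (simp add: H\<psi>_def)
      qed
      also have "\<dots> = integral {0..t} (\<lambda>s. - (l * exp (- l * s) * H\<psi> s))"
        by (intro set_integral_lebesgue_continuous continuous_intros cH)
      finally show ?thesis by simp
    qed
    have e4: "(LINT s:{0..t}|lebesgue. (LINT x|lebesgue. weak_grad (u s) x \<bullet> grad (\<lambda>y. \<theta> s * \<psi> y) x))
      = integral {0..t} (\<lambda>s. exp (- l * s) * (- l\<^sup>2 * F\<psi> s))"
    proof -
      have "(LINT s:{0..t}|lebesgue. (LINT x|lebesgue. weak_grad (u s) x \<bullet> grad (\<lambda>y. \<theta> s * \<psi> y) x))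
         = (LINT s:{0..t}|lebesgue. exp (- l * s) * (- l\<^sup>2 * F\<psi> s))"
      proof (rule set_integral_lebesgue_cong)
        fix s assume s: "s \<in> {0..t}"
        have "(LINT x|lebesgue. weak_grad (u s) x \<bullet> grad (\<lambda>y. \<theta> s * \<psi> y) x) = (LINT x|lebesgue. exp (- l * s) * (weak_grad (u s) x \<bullet> grad \<psi> x))"
          by (rule Bochner_Integration.integral_cong[OF refl], simp only: gr inner_scaleR_right, simp only: th[OF s0[OF s]])
        then show "(LINT x|lebesgue. weak_grad (u s) x \<bullet> grad (\<lambda>y. \<theta> s * \<psi> y) x) = exp (- l * s) * (- l\<^sup>2 * F\<psi> s)"
          using laplacian_pairing[OF s0[OF s]] by (simp add: l_def)
      qed
      also have "\<dots> = integral {0..t} (\<lambda>s. exp (- l * s) * (- l\<^sup>2 * F\<psi> s))"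
        by (intro set_integral_lebesgue_continuous continuous_intros cF)
      finally show ?thesis .
    qed
    have e5: "(LINT s:{0..t}|lebesgue. (LINT x|lebesgue. b s * ut s x * (\<theta> s * \<psi> x)))
      = integral {0..t} (\<lambda>s. b s * exp (- l * s) * H\<psi> s)"
    proof -
      have "(LINT s:{0..t}|lebesgue. (LINT x|lebesgue. b s * ut s x * (\<theta> s * \<psi> x)))
         = (LINT s:{0..t}|lebesgue. b s * exp (- l * s) * H\<psi> s)"
      proof (rule set_integral_lebesgue_cong)
        fix s assume s: "s \<in> {0..t}"
        have "(LINT x|lebesgue. b s * ut s x * (\<theta> s * \<psi> x)) = (LINT x|lebesgue. (b s * exp (- l * s)) * (ut s x * \<psi> x))"
          by (intro Bochner_Integration.integral_cong) (simp_all add: th[OF s0[OF s]] mult_ac)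
        also have "\<dots> = (b s * exp (- l * s)) * (LINT x|lebesgue. ut s x * \<psi> x)" by (rule integral_mult_right_zero)
        finally show "(LINT x|lebesgue. b s * ut s x * (\<theta> s * \<psi> x)) = b s * exp (- l * s) * H\<psi> s"
          by (simp add: H\<psi>_def)
      qed
      also have "\<dots> = integral {0..t} (\<lambda>s. b s * exp (- l * s) * H\<psi> s)"
        by (intro set_integral_lebesgue_continuous continuous_intros cH b_cont)
      finally show ?thesis .
    qed
    have e6: "(LINT s:{0..t}|lebesgue. (LINT x|lebesgue. g s x * (\<theta> s * \<psi> x)))
      = (LINT s:{0..t}|lebesgue. exp (- l * s) * (LINT x|lebesgue. g s x * \<psi> x))"
    proof (rule set_integral_lebesgue_cong)
      fix s assume s: "s \<in> {0..t}"
      have "(LINT x|lebesgue. g s x * (\<theta> s * \<psi> x)) = (LINT x|lebesgue. exp (- l * s) * (g s x * \<psi> x))"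
        by (intro Bochner_Integration.integral_cong) (simp_all add: th[OF s0[OF s]] mult_ac)
      then show "(LINT x|lebesgue. g s x * (\<theta> s * \<psi> x)) = exp (- l * s) * (LINT x|lebesgue. g s x * \<psi> x)" by simp
    qed
    from u_eq[unfolded weak_damped_wave_def, rule_format, OF tf tI]
    show ?thesis
      unfolding prod.case e1 e2 e3 e4 e5 e6 by simp
  qed
  \<comment> \<open>At time 0 all time integrals run over a null set, so that the weak form itself
    yields the initial velocity.\<close>
  show H0: "H\<psi> 0 = \<epsilon> * (LINT x|lebesgue. w1 x * \<psi> x)"
  proof -
    have "(LINT s:{0..0}|lebesgue. exp (- l * s) * (LINT x|lebesgue. g s x * \<psi> x)) = 0"
      unfolding set_lebesgue_integral_def
      by (rule integral_eq_zero_AE) (auto simp: AE_completion_iff intro!: eventually_mono[OF AE_lborel_singleton[of 0]])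
    then show ?thesis using main[of 0] I_nonneg[OF t0] by simp
  qed
  have cH: "continuous_on {0..t} H\<psi>" and cF: "continuous_on {0..t} F\<psi>"
    using H\<psi>_cont F\<psi>_cont t by (auto intro: continuous_on_subset)
  have "((\<lambda>s. l * exp (- l * s) * H\<psi> s + exp (- l * s) * (- l\<^sup>2 * F\<psi> s)) has_integral
      (l * exp (- l * t) * F\<psi> t - l * exp (- l * 0) * F\<psi> 0)) {0..t}"
  proof (rule fundamental_theorem_of_calculus)
    fix s assume s: "s \<in> {0..t}"
    have "(F\<psi> has_real_derivative H\<psi> s) (at s within {0..t})"
      using s t by (intro DERIV_subset[OF F\<psi>_deriv]) auto
    then have "((\<lambda>s. l * exp (- l * s) * F\<psi> s) has_real_derivative
        l * exp (- l * s) * H\<psi> s + exp (- l * s) * (- l\<^sup>2 * F\<psi> s)) (at s within {0..t})"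
      by (auto intro!: derivative_eq_intros simp: power2_eq_square algebra_simps)
    then show "((\<lambda>s. l * exp (- l * s) * F\<psi> s) has_vector_derivative
        l * exp (- l * s) * H\<psi> s + exp (- l * s) * (- l\<^sup>2 * F\<psi> s)) (at s within {0..t})"
      by (simp add: has_real_derivative_iff_has_vector_derivative)
  qed (use t in auto)
  then have "integral {0..t} (\<lambda>s. l * exp (- l * s) * H\<psi> s + exp (- l * s) * (- l\<^sup>2 * F\<psi> s)) = l * exp (- l * t) * F\<psi> t - l * F\<psi> 0"
    by (simp add: integral_unique)
  moreover have "integral {0..t} (\<lambda>s. l * exp (- l * s) * H\<psi> s + exp (- l * s) * (- l\<^sup>2 * F\<psi> s))
     = integral {0..t} (\<lambda>s. l * exp (- l * s) * H\<psi> s) + integral {0..t} (\<lambda>s. exp (- l * s) * (- l\<^sup>2 * F\<psi> s))"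
    by (intro Henstock_Kurzweil_Integration.integral_add integrable_continuous_interval continuous_intros cH cF)
  ultimately show "exp (- l * t) * (H\<psi> t + l * F\<psi> t) =
     H\<psi> 0 + l * F\<psi> 0 + (LINT s:{0..t}|lebesgue. exp (- l * s) * (LINT x|lebesgue. g s x * \<psi> x))
      - integral {0..t} (\<lambda>s. b s * exp (- l * s) * H\<psi> s)"
    using main[OF t] unfolding H0 by (simp add: algebra_simps)
qed

end

end

section \<open>The source on space-time and lower bounds for exponential moments\<close>

lemma sets_time_interval [measurable]: "time_interval T \<in> sets borel"
proof -
  have "{t. ereal t < T} \<in> sets borel" by measurable
  moreover have "time_interval T = {0..} \<inter> {t. ereal t < T}" by (auto simp: time_interval_def)
  ultimately show ?thesis by (metis atLeast_borel sets.Int)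
qed

context damped_wave
begin

text \<open>
  The source is only Lebesgue measurable on \<open>[0,T) \<times> \<real>\<^sup>n\<close>; Tonelli's theorem is applied to a Borel representative
  that vanishes outside the cone.
\<close>

lemma ex_borel_source:
  "\<exists>g'. g' \<in> borel_measurable borel \<and> (\<forall>z. 0 \<le> g' z) \<and> (\<forall>s x. s \<notin> I \<or> s + R < norm x \<longrightarrow> g' (s, x) = 0) \<and>
     (AE z in lebesgue. fst z \<in> I \<longrightarrow> g' z = g (fst z) (snd z))"
proof -
  have IU: "I \<times> (UNIV :: (real ^ 'n) set) \<in> sets borel"
    unfolding borel_prod[symmetric] by (intro pair_measureI) auto
  then have "(\<lambda>z. if z \<in> I \<times> UNIV then (\<lambda>(s, x). g s x) z else 0) \<in> borel_measurable lebesgue"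
    by (intro borel_measurable_if_I g_meas) auto
  from completion_ex_borel_measurable_real[OF this]
  obtain g1 where g1: "g1 \<in> borel_measurable lborel"
     "AE z in lborel. (if z \<in> I \<times> UNIV then (\<lambda>(s, x). g s x) z else 0) = g1 z" by blast
  have [measurable]: "g1 \<in> borel_measurable borel" using g1 by simp
  define C where "C = {z. norm (snd z :: real ^ 'n) \<le> fst z + R}"
  have "closed C" unfolding C_def by (intro closed_Collect_le continuous_intros)
  then have [measurable]: "C \<in> sets borel" by simp
  define g' where "g' z = max 0 (g1 z) * indicator (I \<times> UNIV) z * indicator C z" for z
  have "AE z in lebesgue. fst z \<in> I \<longrightarrow> g' z = g (fst z) (snd z)"
    using AE_completion[OF g1(2)] g_supp
  proof eventually_elim
    case (elim z)
    obtain s x where z: "z = (s, x)" by (cases z)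
    show ?case using elim g_nonneg[of s x] by (cases "norm x \<le> s + R") (auto simp: z g'_def C_def)
  qed
  moreover have "g' \<in> borel_measurable borel" unfolding g'_def using IU by measurable
  ultimately show ?thesis by (intro exI[of _ g']) (auto simp: g'_def C_def indicator_def)
qed

definition source_rep :: "real \<times> (real ^ 'n) \<Rightarrow> real" where
  "source_rep = (SOME g'. g' \<in> borel_measurable borel \<and> (\<forall>z. 0 \<le> g' z) \<and> (\<forall>s x. s \<notin> I \<or> s + R < norm x \<longrightarrow> g' (s, x) = 0) \<and>
     (AE z in lebesgue. fst z \<in> I \<longrightarrow> g' z = g (fst z) (snd z)))"

lemma source_rep: shows source_rep_measurable [measurable]: "source_rep \<in> borel_measurable borel" and source_rep_nonneg: "0 \<le> source_rep z"
  and source_rep_zero: "s \<notin> I \<or> s + R < norm x \<Longrightarrow> source_rep (s, x) = 0"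
  and source_rep_AE: "AE z in lebesgue. fst z \<in> I \<longrightarrow> source_rep z = g (fst z) (snd z)"
  using someI_ex[OF ex_borel_source] unfolding source_rep_def[symmetric] by blast+

text \<open>Its integral over space-time is the part of the monotone function \<open>a\<close> of
  the scalar equation that comes from the source; the indicator in time makes the monotonicity
  evident.\<close>

definition source :: "real \<Rightarrow> real ^ 'n \<Rightarrow> real \<times> (real ^ 'n) \<Rightarrow> real" where
  "source t \<xi> z = indicator {0..t} (fst z) * exp (- norm \<xi> * fst z) * source_rep z * exp (\<xi> \<bullet> snd z)"

lemma source_measurable [measurable]: "source t \<xi> \<in> borel_measurable borel"
proof -
  have [measurable]: "fst \<in> borel_measurable (borel :: (real \<times> (real ^ 'n)) measure)"
    "snd \<in> borel_measurable (borel :: (real \<times> (real ^ 'n)) measure)"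
    by (auto intro!: borel_measurable_continuous_onI continuous_intros)
  show ?thesis unfolding source_def by measurable
qed

lemma source_nonneg: "0 \<le> source t \<xi> z"
  unfolding source_def using source_rep_nonneg by simp

lemma source_integrable:
  assumes t: "t \<in> I"
  shows "integrable lborel (source t \<xi>)"
proof -
  define K where "K = {0..t} \<times> cball (0::real ^ 'n) (t + R)"
  have K: "compact K" "K \<subseteq> I \<times> UNIV" using Icc_I[OF t] by (auto simp: K_def intro: compact_Times)
  have [measurable]: "K \<in> sets borel" using K by (simp add: borel_compact)
  have "integrable lebesgue (\<lambda>z. indicator K z *\<^sub>R (\<lambda>(s, x). g s x) z)"
    using g_int[OF K] by (simp add: set_integrable_def)
  moreover have "AE z in lebesgue. indicator K z *\<^sub>R (\<lambda>(s, x). g s x) z = indicator K z * source_rep z"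
    using source_rep_AE by eventually_elim (use K in \<open>auto simp: indicator_def split: prod.splits\<close>)
  ultimately have "integrable lebesgue (\<lambda>z. indicator K z * source_rep z)"
    by (rule_tac integrable_cong_AE_imp) (auto intro: measurable_completion)
  then have "integrable lborel (\<lambda>z. indicator K z * source_rep z)" by (subst (asm) integrable_completion) auto
  then have i: "integrable lborel (\<lambda>z. exp (norm \<xi> * (t + R)) * (indicator K z * source_rep z))" by simp
  show ?thesis
  proof (rule Bochner_Integration.integrable_bound[OF i])
    show "AE z in lborel. norm (source t \<xi> z) \<le> norm (exp (norm \<xi> * (t + R)) * (indicator K z * source_rep z))"
    proof (intro AE_I2)
      fix z :: "real \<times> (real ^ 'n)"
      obtain s x where z: "z = (s, x)" by (cases z)
      show "norm (source t \<xi> z) \<le> norm (exp (norm \<xi> * (t + R)) * (indicator K z * source_rep z))"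
      proof (cases "s \<in> {0..t} \<and> norm x \<le> s + R")
        case True
        have "\<xi> \<bullet> x \<le> norm \<xi> * norm x" by (rule norm_cauchy_schwarz)
        also have "\<dots> \<le> norm \<xi> * (t + R)" using True by (intro mult_left_mono) auto
        finally have "exp (- norm \<xi> * s) * exp (\<xi> \<bullet> x) \<le> 1 * exp (norm \<xi> * (t + R))"
          using True by (intro mult_mono) auto
        then have "(exp (- norm \<xi> * s) * exp (\<xi> \<bullet> x)) * source_rep (s, x) \<le> exp (norm \<xi> * (t + R)) * source_rep (s, x)"
          using source_rep_nonneg by (intro mult_right_mono) auto
        then show ?thesis using True source_rep_nonneg[of "(s, x)"] by (simp add: z source_def K_def indicator_def mult_ac)
      next
        case False
        then have "source t \<xi> z = 0" using source_rep_zero[of s x] by (auto simp: z source_def indicator_def)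
        then show ?thesis by simp
      qed
    qed
  qed simp
qed

text \<open>Two replacements are made at once: \<open>g\<close> by its Borel representative and
  \<psi> by the full exponential. The second is invisible because the representative vanishes
  outside the cone, where the cut-off would matter. Joint integrability makes the iterated Bochner
  integral equal to the one over space-time.\<close>

lemma source_integral:
  assumes t0: "t0 \<in> I" and L: "t0 + R + 1 < L"
    and \<psi>: "test_function UNIV \<psi>" and \<psi>_exp: "\<And>x. norm x \<le> L \<Longrightarrow> \<psi> x = exp (\<xi> \<bullet> x)"
    and t: "t \<in> {0..t0}"
  shows "(LINT s:{0..t}|lebesgue. exp (- norm \<xi> * s) * (LINT x|lebesgue. g s x * \<psi> x)) = (LINT z|lborel. source t \<xi> z)"
proof -
  have tI: "t \<in> I" using t Icc_I[OF t0] by auto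
  have m2: "source t \<xi> \<in> borel_measurable (lborel \<Otimes>\<^sub>M lborel)" unfolding lborel_prod by simp
  have int2: "integrable (lborel \<Otimes>\<^sub>M lborel) (\<lambda>(s, x). source t \<xi> (s, x))"
    using source_integrable[OF tI] unfolding lborel_prod by simp
  have ms: "(\<lambda>x. source t \<xi> (s, x)) \<in> borel_measurable borel" for s
    using measurable_compose[OF measurable_Pair1' m2, of s] by simp
  define n where "n s = (LINT x|lborel. source t \<xi> (s, x))" for s
  have mn[measurable]: "n \<in> borel_measurable borel"
    unfolding n_def using lborel.borel_measurable_lebesgue_integral[of "\<lambda>s x. source t \<xi> (s, x)" lborel] m2 by simp
  have "AE s in lebesgue. AE x in lebesgue. s \<in> I \<longrightarrow> source_rep (s, x) = g s x"
    using AE_lebesgue_pair[OF source_rep_AE] by simp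
  then have ae: "AE s in lebesgue. n s = indicator {0..t} s *\<^sub>R (exp (- norm \<xi> * s) * (LINT x|lebesgue. g s x * \<psi> x))"
  proof eventually_elim
    case (elim s)
    show ?case
    proof (cases "s \<in> {0..t}")
      case False
      then have "source t \<xi> (s, x) = 0" for x by (simp add: source_def)
      then show ?thesis using False by (simp add: n_def)
    next
      case True
      have sI: "s \<in> I" using True t Icc_I[OF t0] by auto
      have ae: "AE x in lebesgue. source t \<xi> (s, x) = exp (- norm \<xi> * s) * (g s x * \<psi> x)"
        using elim
      proof eventually_elim
        case (elim x)
        show ?case
        proof (cases "norm x \<le> L")
          case True
          then show ?thesis using elim sI \<psi>_exp[of x] \<open>s \<in> {0..t}\<close> by (simp add: source_def mult.assoc)
        next
          case False
          then have "source_rep (s, x) = 0" using True t L by (intro source_rep_zero) auto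
          then show ?thesis using elim sI by (simp add: source_def)
        qed
      qed
      have m: "(\<lambda>x. source t \<xi> (s, x)) \<in> borel_measurable lebesgue"
        using ms by (intro measurable_completion) auto
      have "n s = (LINT x|lebesgue. source t \<xi> (s, x))"
        unfolding n_def using ms by (subst integral_completion) auto
      also have "\<dots> = (LINT x|lebesgue. exp (- norm \<xi> * s) * (g s x * \<psi> x))"
        by (rule integral_cong_AE[OF m borel_measurable_AE[OF m ae] ae])
      finally show ?thesis using True by simp
    qed
  qed
  have mn': "n \<in> borel_measurable lebesgue" by (intro measurable_completion) auto
  have "(LINT s:{0..t}|lebesgue. exp (- norm \<xi> * s) * (LINT x|lebesgue. g s x * \<psi> x)) = (LINT s|lebesgue. n s)"
    unfolding set_lebesgue_integral_def
    by (rule integral_cong_AE[OF mn' borel_measurable_AE[OF mn' ae] ae, symmetric])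
  also have "\<dots> = (LINT s|lborel. n s)" by (subst integral_completion) auto
  also have "\<dots> = (LINT z|lborel. source t \<xi> z)"
    using lborel_pair.integral_fst'[of "source t \<xi>"] source_integrable[OF tI] unfolding n_def lborel_prod by simp
  finally show ?thesis .
qed

definition B where "B = integral {0..} b"

lemma data_integrable:
  "integrable lebesgue (\<lambda>x. w0 x * exp (\<xi> \<bullet> x))" "integrable lebesgue (\<lambda>x. w1 x * exp (\<xi> \<bullet> x))"
proof -
  obtain \<psi> where \<psi>: "test_function UNIV \<psi>" "\<And>x. norm x \<le> R \<Longrightarrow> \<psi> x = exp (\<xi> \<bullet> x)"
    using ex_exp_test_function[of R \<xi>] by blast
  have *: "integrable lebesgue (\<lambda>x. w x * exp (\<xi> \<bullet> x))" if "L2 w" "AE x in lebesgue. R < norm x \<longrightarrow> w x = 0" for w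
  proof -
    have m: "integrable lebesgue (\<lambda>x. w x * \<psi> x)"
      by (intro L2_mult_integrable test_function_L2 that \<psi>)
    have ae: "AE x in lebesgue. w x * \<psi> x = w x * exp (\<xi> \<bullet> x)"
      using that(2)
    proof eventually_elim
      case (elim x)
      then show ?case using \<psi>(2)[of x] by (cases "norm x \<le> R") auto
    qed
    have "(\<lambda>x. w x * \<psi> x) \<in> borel_measurable lebesgue" using m by (rule borel_measurable_integrable)
    from integrable_cong_AE_imp[OF m borel_measurable_AE[OF this ae]] ae show ?thesis
      by (simp add: eq_commute[of "w _ * \<psi> _"])
  qed
  show "integrable lebesgue (\<lambda>x. w0 x * exp (\<xi> \<bullet> x))" by (rule *[OF w_L2(1) w_supp(1)])
  show "integrable lebesgue (\<lambda>x. w1 x * exp (\<xi> \<bullet> x))" by (rule *[OF w_L2(2) w_supp(2)])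
qed

definition "D0 \<xi> = (LINT x|lebesgue. w0 x * exp (\<xi> \<bullet> x))"
definition "D1 \<xi> = (LINT x|lebesgue. w1 x * exp (\<xi> \<bullet> x))"

lemma D_nonneg: "0 \<le> D0 \<xi>" "0 \<le> D1 \<xi>"
  unfolding D0_def D1_def using w_nonneg by (auto intro!: integral_nonneg_AE elim: eventually_mono)

text \<open>The place where nontriviality of the data enters: it makes \<open>a 0\<close> positive
  in the scalar equation.\<close>

lemma D_pos: "0 < D0 \<xi> + D1 \<xi>"
proof -
  have "D0 \<xi> = 0 \<Longrightarrow> AE x in lebesgue. w0 x = 0"
    unfolding D0_def using w_nonneg(1) data_integrable(1)
    by (subst (asm) integral_nonneg_eq_0_iff_AE) (auto elim: eventually_mono)
  moreover have "D1 \<xi> = 0 \<Longrightarrow> AE x in lebesgue. w1 x = 0"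
    unfolding D1_def using w_nonneg(2) data_integrable(2)
    by (subst (asm) integral_nonneg_eq_0_iff_AE) (auto elim: eventually_mono)
  ultimately show ?thesis using D_nonneg[of \<xi>] w_nontrivial by (metis add_nonneg_eq_0_iff add_nonneg_nonneg order_less_le)
qed

definition "exp_moment \<xi> t = (LINT x|lebesgue. u t x * exp (\<xi> \<bullet> x))"

text \<open>Both bounds come from one scalar estimate by discarding either the source or the data.
  Without the factor \<open>exp (- B)\<close> the data bound would be the solution of
  \<open>F'' = l^2 F\<close>, since \<open>exp (- l t) D0 + (D1 + l D0) sinh (l t) / l\<close>
  equals \<open>cosh (l t) D0 + sinh (l t) D1 / l\<close>. The source bound is stated in
  \<open>ennreal\<close> to be ready for Tonelli's theorem in \<xi>.\<close>

lemma exp_moment_lower_bounds: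
  assumes t0: "t0 \<in> I" and \<xi>: "\<xi> \<noteq> 0"
  defines "l \<equiv> norm \<xi>"
  shows exp_moment_data: "exp_moment \<xi> t0 \<ge> exp (- l * t0) * (\<epsilon> * D0 \<xi>) + exp (- B) * (\<epsilon> * (D1 \<xi> + l * D0 \<xi>) * (sinh (l * t0) / l))"
    and exp_moment_source: "ennreal (exp_moment \<xi> t0) \<ge> ennreal (exp (- B)) *
      (\<integral>\<^sup>+z. ennreal (indicator {0..t0} (fst z) * (sinh (l * (t0 - fst z)) / l) * source_rep z * exp (\<xi> \<bullet> snd z)) \<partial>lborel)"
proof -
  have l: "0 < l" using \<xi> by (simp add: l_def)
  have t00: "0 \<le> t0" by (rule I_nonneg[OF t0])
  define L where "L = t0 + R + 2"
  have L: "t0 + R + 1 < L" by (simp add: L_def)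
  obtain \<psi> where \<psi>: "test_function UNIV \<psi>" "\<And>x. norm x \<le> L \<Longrightarrow> \<psi> x = exp (\<xi> \<bullet> x)"
    using ex_exp_test_function[of L \<xi>] by blast
  note ctx = t0 L \<psi>
  let ?F = "F\<psi> \<psi>" and ?H = "H\<psi> \<psi>"
  have FF: "?F t = exp_moment \<xi> t" if "t \<in> {0..t0}" for t
    using F\<psi>_exp(2)[OF ctx that] by (simp add: exp_moment_def)
  have F0: "?F 0 = \<epsilon> * D0 \<xi>"
  proof -
    have m: "(\<lambda>x. u 0 x * exp (\<xi> \<bullet> x)) \<in> borel_measurable lebesgue"
      using L2_measurable[OF u_L2[OF zero_I]] by (rule borel_measurable_times) (auto intro: measurable_completion)
    have ae: "AE x in lebesgue. u 0 x * exp (\<xi> \<bullet> x) = \<epsilon> * (w0 x * exp (\<xi> \<bullet> x))"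
      using u_init by eventually_elim simp
    show ?thesis using FF[of 0] t00 integral_cong_AE[OF m borel_measurable_AE[OF m ae] ae]
      by (simp add: exp_moment_def D0_def)
  qed
  have H0: "?H 0 = \<epsilon> * D1 \<xi>"
  proof -
    have m: "(\<lambda>x. w1 x * \<psi> x) \<in> borel_measurable lebesgue"
      using L2_measurable[OF w_L2(2)] L2_measurable[OF test_function_L2[OF \<psi>(1)]] by (intro borel_measurable_times)
    have ae: "AE x in lebesgue. w1 x * \<psi> x = w1 x * exp (\<xi> \<bullet> x)"
      using w_supp(2)
    proof eventually_elim
      case (elim x)
      then show ?case using \<psi>(2)[of x] t00 by (cases "norm x \<le> R") (auto simp: L_def)
    qed
    show ?thesis using weak_identity(2)[OF ctx, of 0] t00 integral_cong_AE[OF m borel_measurable_AE[OF m ae] ae]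
      by (simp add: D1_def)
  qed
  define a0 where "a0 = \<epsilon> * (D1 \<xi> + l * D0 \<xi>)"
  define S where "S t = (LINT z|lborel. source t \<xi> z)" for t
  have a0: "0 < a0"
    using D_pos[of \<xi>] D_nonneg[of \<xi>] l eps_pos unfolding a0_def
    by (metis add_cancel_right_left add_nonneg_pos add_pos_nonneg less_eq_real_def mult_eq_0_iff mult_pos_pos)
  have S0: "0 \<le> S t" for t unfolding S_def using source_nonneg by (intro integral_nonneg_AE) auto
  have Smono: "S s \<le> S t" if "0 \<le> s" "s \<le> t" "t \<le> t0" for s t
    unfolding S_def using that Icc_I[OF t0] source_rep_nonneg
    by (intro integral_mono source_integrable) (auto simp: source_def indicator_def)
  have sub: "Bm \<le> B" if "Bm = integral {0..t0} b" for Bm using that b_bound by (simp add: B_def)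
  have eqn: "exp (- l * t) * (?H t + l * ?F t) = (a0 + S t) - integral {0..t} (\<lambda>s. b s * exp (- l * s) * ?H s)"
    if "t \<in> {0..t0}" for t
    using weak_identity(1)[OF ctx that] source_integral[OF ctx that]
    by (simp add: l_def a0_def S_def F0 H0 algebra_simps)
  have dF: "(?F has_real_derivative ?H t) (at t within {0..t0})" if "t \<in> {0..t0}" for t
    by (rule F\<psi>_deriv[OF ctx that])
  have lower: "?F t0 \<ge> exp (- l * t0) * ?F 0 + exp (- B) * integral {0..t0} (\<lambda>s. exp (2 * l * s - l * t0) * (a0 + S s))"
    and ca: "continuous_on {0..t0} (\<lambda>t. a0 + S t)"
    by (rule damped_ode_lower_bound[OF t00 l dF H\<psi>_cont[OF ctx] b_cont _ _ _ _ eqn, where Bm=B];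
        use b_nonneg sub Smono a0 S0[of 0] F0 H0 D_nonneg eps_pos in auto)+
  have "continuous_on {0..t0} (\<lambda>t. (a0 + S t) - a0)" by (intro continuous_intros ca)
  then have cS: "continuous_on {0..t0} S" by simp
  have split: "integral {0..t0} (\<lambda>s. exp (2 * l * s - l * t0) * (a0 + S s)) =
     integral {0..t0} (\<lambda>s. exp (2 * l * s - l * t0) * a0) + integral {0..t0} (\<lambda>s. exp (2 * l * s - l * t0) * S s)"
    unfolding distrib_left
    by (intro Henstock_Kurzweil_Integration.integral_add integrable_continuous_interval continuous_intros cS)
  have expint: "((\<lambda>s. exp (2 * l * s - l * t0)) has_integral (sinh (l * t0) / l)) {0..t0}"
  proof -
    have "((\<lambda>s. exp (2 * l * s - l * t0)) has_integral (exp (2 * l * t0 - l * t0) / (2 * l) - exp (2 * l * 0 - l * t0) / (2 * l))) {0..t0}"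
      using l t00 by (intro fundamental_theorem_of_calculus)
        (auto intro!: derivative_eq_intros simp: has_real_derivative_iff_has_vector_derivative[symmetric])
    then show ?thesis by (simp add: sinh_field_def diff_divide_distrib)
  qed
  have i1: "integral {0..t0} (\<lambda>s. exp (2 * l * s - l * t0) * a0) = a0 * (sinh (l * t0) / l)"
    using integral_unique[OF has_integral_mult_left[OF expint, of a0]] by simp
  have i2: "0 \<le> integral {0..t0} (\<lambda>s. exp (2 * l * s - l * t0) * S s)"
    using S0 by (intro Henstock_Kurzweil_Integration.integral_nonneg integrable_continuous_interval continuous_intros cS) auto
  have Ft0: "?F t0 = exp_moment \<xi> t0" using FF t00 by simp
  show "exp_moment \<xi> t0 \<ge> exp (- l * t0) * (\<epsilon> * D0 \<xi>) + exp (- B) * (\<epsilon> * (D1 \<xi> + l * D0 \<xi>) * (sinh (l * t0) / l))"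
  proof -
    have "exp (- B) * (a0 * (sinh (l * t0) / l)) \<le> exp (- B) * integral {0..t0} (\<lambda>s. exp (2 * l * s - l * t0) * (a0 + S s))"
      unfolding split i1 using i2 by (intro mult_left_mono exp_ge_zero) linarith
    then show ?thesis using lower unfolding Ft0 F0 a0_def by linarith
  qed
  have "exp_moment \<xi> t0 \<ge> exp (- B) * integral {0..t0} (\<lambda>s. exp (2 * l * s - l * t0) * S s)"
  proof -
    have "0 \<le> exp (- l * t0) * ?F 0" using F0 D_nonneg[of \<xi>] eps_pos by simp
    moreover have "0 \<le> a0 * (sinh (l * t0) / l)" using a0 l t00 by simp
    then have "exp (- B) * integral {0..t0} (\<lambda>s. exp (2 * l * s - l * t0) * S s) \<le> exp (- B) * integral {0..t0} (\<lambda>s. exp (2 * l * s - l * t0) * (a0 + S s))"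
      unfolding split i1 by (intro mult_left_mono exp_ge_zero) linarith
    ultimately show ?thesis using lower unfolding Ft0 by linarith
  qed
  then have "ennreal (exp_moment \<xi> t0) \<ge> ennreal (exp (- B)) * ennreal (integral {0..t0} (\<lambda>s. exp (2 * l * s - l * t0) * S s))"
    by (simp add: ennreal_mult'[symmetric] ennreal_leI)
  also have "ennreal (integral {0..t0} (\<lambda>s. exp (2 * l * s - l * t0) * S s)) =
     (\<integral>\<^sup>+s. ennreal (indicator {0..t0} s * (exp (2 * l * s - l * t0) * S s)) \<partial>lborel)"
    using S0 by (intro nn_integral_has_integral_lebesgue[symmetric] integrable_integral integrable_continuous_interval continuous_intros cS) auto
  also have "\<dots> = (\<integral>\<^sup>+s. (\<integral>\<^sup>+z. ennreal (indicator {0..t0} s * exp (2 * l * s - l * t0) * source s \<xi> z) \<partial>lborel) \<partial>lborel)"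
  proof (intro nn_integral_cong)
    fix s
    show "ennreal (indicator {0..t0} s * (exp (2 * l * s - l * t0) * S s)) =
      (\<integral>\<^sup>+z. ennreal (indicator {0..t0} s * exp (2 * l * s - l * t0) * source s \<xi> z) \<partial>lborel)"
    proof (cases "s \<in> {0..t0}")
      case True
      then have sI: "s \<in> I" using Icc_I[OF t0] by auto
      have "(\<integral>\<^sup>+z. ennreal (indicator {0..t0} s * exp (2 * l * s - l * t0) * source s \<xi> z) \<partial>lborel)
        = (\<integral>\<^sup>+z. ennreal (exp (2 * l * s - l * t0)) * ennreal (source s \<xi> z) \<partial>lborel)"
        using True by (simp add: ennreal_mult')
      also have "\<dots> = ennreal (exp (2 * l * s - l * t0)) * (\<integral>\<^sup>+z. ennreal (source s \<xi> z) \<partial>lborel)"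
        by (intro nn_integral_cmult) simp
      also have "(\<integral>\<^sup>+z. ennreal (source s \<xi> z) \<partial>lborel) = ennreal (S s)"
        unfolding S_def using source_nonneg by (intro nn_integral_eq_integral source_integrable sI) auto
      finally show ?thesis using True by (simp add: ennreal_mult')
    qed simp
  qed
  \<comment> \<open>With the \<open>s\<close> integral innermost, a source at time \<open>r\<close>
    is integrated over \<open>{r..t0}\<close> against an exponential, which produces the kernel
    \<open>sinh (l * (t0 - r)) / l\<close> of the undamped equation.\<close>
  also have "\<dots> = (\<integral>\<^sup>+z. (\<integral>\<^sup>+s. ennreal (indicator {0..t0} s * exp (2 * l * s - l * t0) * source s \<xi> z) \<partial>lborel) \<partial>lborel)"
  proof (rule lborel_pair.Fubini')
    define h where "h z = exp (- norm \<xi> * fst z) * source_rep z * exp (\<xi> \<bullet> snd z)" for z :: "real \<times> (real ^ 'n)"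
    have hm: "h \<in> borel_measurable borel"
      unfolding h_def
      by (intro borel_measurable_times source_rep_measurable) (auto intro!: borel_measurable_continuous_onI continuous_intros)
    define A where "A = {p :: (real \<times> (real ^ 'n)) \<times> real. 0 \<le> fst (fst p) \<and> fst (fst p) \<le> snd p}"
    have "closed A" unfolding A_def by (intro closed_Collect_conj closed_Collect_le continuous_intros)
    then have A: "indicator A \<in> borel_measurable (borel :: ((real \<times> (real ^ 'n)) \<times> real) measure)"
      by (intro borel_measurable_indicator) simp
    have hs: "(\<lambda>p :: (real \<times> (real ^ 'n)) \<times> real. h (fst p)) \<in> borel_measurable borel"
      by (rule measurable_compose[OF _ hm]) (intro borel_measurable_continuous_onI continuous_intros)
    have c: "(\<lambda>p :: (real \<times> (real ^ 'n)) \<times> real. indicator {0..t0} (snd p) * exp (2 * l * snd p - l * t0)) \<in> borel_measurable borel"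
      by (rule measurable_compose[of snd _ borel "\<lambda>s. indicator {0..t0} s * exp (2 * l * s - l * t0)"])
         (auto intro!: borel_measurable_continuous_onI continuous_intros)
    have "(\<lambda>(z, s). ennreal (indicator {0..t0} s * exp (2 * l * s - l * t0) * source s \<xi> z)) =
      (\<lambda>p. ennreal ((indicator {0..t0} (snd p) * exp (2 * l * snd p - l * t0)) * (indicator A p * h (fst p))))"
      by (auto simp: fun_eq_iff source_def h_def A_def indicator_def mult.assoc)
    moreover have "(\<lambda>p. ennreal ((indicator {0..t0} (snd p) * exp (2 * l * snd p - l * t0)) * (indicator A p * h (fst p)))) \<in> borel_measurable borel"
      by (intro measurable_compose[OF _ measurable_ennreal] borel_measurable_times c A hs)
    ultimately show "(\<lambda>(z, s). ennreal (indicator {0..t0} s * exp (2 * l * s - l * t0) * source s \<xi> z)) \<in> borel_measurable (lborel \<Otimes>\<^sub>M lborel)"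
      unfolding lborel_prod by simp
  qed
  also have "\<dots> = (\<integral>\<^sup>+z. ennreal (indicator {0..t0} (fst z) * (sinh (l * (t0 - fst z)) / l) * source_rep z * exp (\<xi> \<bullet> snd z)) \<partial>lborel)"
  proof (intro nn_integral_cong)
    fix z :: "real \<times> (real ^ 'n)"
    obtain r x where z: "z = (r, x)" by (cases z)
    show "(\<integral>\<^sup>+s. ennreal (indicator {0..t0} s * exp (2 * l * s - l * t0) * source s \<xi> z) \<partial>lborel)
      = ennreal (indicator {0..t0} (fst z) * (sinh (l * (t0 - fst z)) / l) * source_rep z * exp (\<xi> \<bullet> snd z))"
    proof (cases "r \<in> {0..t0}")
      case True
      have "(\<integral>\<^sup>+s. ennreal (indicator {0..t0} s * exp (2 * l * s - l * t0) * source s \<xi> z) \<partial>lborel)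
        = (\<integral>\<^sup>+s. ennreal (exp (- l * r) * source_rep z * exp (\<xi> \<bullet> x)) * (ennreal (exp (2 * l * s - l * t0)) * indicator {r..t0} s) \<partial>lborel)"
        using True source_rep_nonneg[of z]
        by (intro nn_integral_cong) (auto simp: source_def z l_def indicator_def ennreal_mult'[symmetric] mult_ac)
      also have "\<dots> = ennreal (exp (- l * r) * source_rep z * exp (\<xi> \<bullet> x)) * (\<integral>\<^sup>+s\<in>{r..t0}. ennreal (exp (2 * l * s - l * t0)) \<partial>lborel)"
        by (intro nn_integral_cmult) simp
      also have "(\<integral>\<^sup>+s\<in>{r..t0}. ennreal (exp (2 * l * s - l * t0)) \<partial>lborel)
        = ennreal (exp (2 * l * t0 - l * t0) / (2 * l) - exp (2 * l * r - l * t0) / (2 * l))"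
        using l True by (intro nn_integral_FTC_Icc) (auto intro!: derivative_eq_intros)
      also have "ennreal (exp (- l * r) * source_rep z * exp (\<xi> \<bullet> x)) * \<dots>
         = ennreal ((exp (- l * r) * source_rep z * exp (\<xi> \<bullet> x)) * (exp (2 * l * t0 - l * t0) / (2 * l) - exp (2 * l * r - l * t0) / (2 * l)))"
        using source_rep_nonneg[of z] by (simp add: ennreal_mult')
      also have "(exp (- l * r) * source_rep z * exp (\<xi> \<bullet> x)) * (exp (2 * l * t0 - l * t0) / (2 * l) - exp (2 * l * r - l * t0) / (2 * l))
        = ((exp (- l * r) * exp (2 * l * t0 - l * t0) - exp (- l * r) * exp (2 * l * r - l * t0)) / (2 * l)) * source_rep z * exp (\<xi> \<bullet> x)"
      proof -
        have "(a * c * d) * (p / k - q / k) = ((a * p - a * q) / k) * c * d" for a c d p q k :: real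
          by (simp add: diff_divide_distrib algebra_simps)
        then show ?thesis .
      qed
      also have "(exp (- l * r) * exp (2 * l * t0 - l * t0) - exp (- l * r) * exp (2 * l * r - l * t0)) / (2 * l) = sinh (l * (t0 - r)) / l"
      proof -
        have "- l * r + (2 * l * t0 - l * t0) = l * (t0 - r)" "- l * r + (2 * l * r - l * t0) = - (l * (t0 - r))"
          by (simp_all add: algebra_simps)
        then show ?thesis unfolding exp_add[symmetric] by (simp only: sinh_field_def)
      qed
      finally show ?thesis using True by (simp add: z)
    next
      case False
      then have "indicator {0..t0} s * exp (2 * l * s - l * t0) * source s \<xi> z = 0" for s
        by (cases "s \<in> {0..t0}"; cases "r \<in> {0..s}") (auto simp: source_def z)
      then have "(\<integral>\<^sup>+s. ennreal (indicator {0..t0} s * exp (2 * l * s - l * t0) * source s \<xi> z) \<partial>lborel) = (\<integral>\<^sup>+s. 0 \<partial>(lborel :: real measure))"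
        by (intro nn_integral_cong) (simp only: ennreal_0)
      then show ?thesis using False by (simp add: z)
    qed
  qed
  finally show "ennreal (exp_moment \<xi> t0) \<ge> ennreal (exp (- B)) *
      (\<integral>\<^sup>+z. ennreal (indicator {0..t0} (fst z) * (sinh (l * (t0 - fst z)) / l) * source_rep z * exp (\<xi> \<bullet> snd z)) \<partial>lborel)" .
qed

end

section \<open>Superpositions of exponentials\<close>

lemma nn_integral_gaussian_exp:
  fixes x :: "'a::euclidean_space"
  assumes k: "0 < k"
  shows "(\<integral>\<^sup>+\<xi>. ennreal (exp (- (norm \<xi>)\<^sup>2 / (4 * k) + \<xi> \<bullet> x)) \<partial>lborel)
    = ennreal ((4 * pi * k) powr (real DIM('a) / 2) * exp (k * (norm x)\<^sup>2))"
proof -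
  let ?f = "\<lambda>b y. exp (- y\<^sup>2 / (4 * k) + y * (x \<bullet> b))"
  have norm2: "(norm z)\<^sup>2 = (\<Sum>b\<in>Basis. (z \<bullet> b)\<^sup>2)" for z :: 'a
    by (subst power2_norm_eq_inner, subst euclidean_inner) (simp add: power2_eq_square)
  have one: "(\<integral>\<^sup>+y. ennreal (exp (- y\<^sup>2 / (4 * k) + y * c)) \<partial>lborel) = ennreal (sqrt (4 * pi * k) * exp (k * c\<^sup>2))" for c :: real
  proof -
    \<comment> \<open>Completing the square exhibits a normal density with mean
      \<open>2 * k * c\<close> and variance \<open>2 * k\<close>.\<close>
    have e: "exp (- y\<^sup>2 / (4 * k) + y * c) = (sqrt (4 * pi * k) * exp (k * c\<^sup>2)) * normal_density (2 * k * c) (sqrt (2 * k)) y" for y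
    proof -
      have "- y\<^sup>2 / (4 * k) + y * c = k * c\<^sup>2 + - (y - 2 * k * c)\<^sup>2 / (2 * (sqrt (2 * k))\<^sup>2)"
        using k by (simp add: field_simps power2_eq_square)
      then have "exp (- y\<^sup>2 / (4 * k) + y * c) = exp (k * c\<^sup>2) * exp (- (y - 2 * k * c)\<^sup>2 / (2 * (sqrt (2 * k))\<^sup>2))"
        by (simp only: exp_add)
      moreover have "sqrt (2 * pi * (sqrt (2 * k))\<^sup>2) = sqrt (4 * pi * k)" using k by (simp add: mult_ac)
      moreover have "exp (k * c\<^sup>2) * B = s * exp (k * c\<^sup>2) * (1 / s * B)" if "s > 0" for s B :: real
        using that by simp
      from this[of "sqrt (4 * pi * k)"] have "exp (k * c\<^sup>2) * B = sqrt (4 * pi * k) * exp (k * c\<^sup>2) * (1 / sqrt (4 * pi * k) * B)" for B :: real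
        using k by (simp only: real_sqrt_gt_zero mult_pos_pos pi_gt_zero zero_less_numeral)
      ultimately show ?thesis
        unfolding normal_density_def by (simp only:)
    qed
    have "(\<integral>\<^sup>+y. ennreal (normal_density (2 * k * c) (sqrt (2 * k)) y) \<partial>lborel) = 1"
      using k by (subst nn_integral_eq_integral) auto
    then show ?thesis
      unfolding e using k by (simp add: ennreal_mult' nn_integral_cmult)
  qed
  have "exp (- (norm \<xi>)\<^sup>2 / (4 * k) + \<xi> \<bullet> x) = (\<Prod>b\<in>Basis. ?f b (\<xi> \<bullet> b))" for \<xi>
  proof -
    have "- (norm \<xi>)\<^sup>2 / (4 * k) + \<xi> \<bullet> x = (\<Sum>b\<in>Basis. - (\<xi> \<bullet> b)\<^sup>2 / (4 * k) + (\<xi> \<bullet> b) * (x \<bullet> b))"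
      unfolding norm2 euclidean_inner[of \<xi> x] by (simp add: sum.distrib sum_subtractf sum_negf sum_divide_distrib)
    then show ?thesis by (simp add: exp_sum)
  qed
  then have "(\<integral>\<^sup>+\<xi>. ennreal (exp (- (norm \<xi>)\<^sup>2 / (4 * k) + \<xi> \<bullet> x)) \<partial>lborel)
     = (\<integral>\<^sup>+\<xi>. (\<Prod>b\<in>Basis. ennreal (?f b (\<xi> \<bullet> b))) \<partial>lborel)"
    by (simp add: prod_ennreal)
  also have "\<dots> = (\<Prod>b\<in>Basis. (\<integral>\<^sup>+y. ennreal (?f b y) \<partial>lborel))"
    by (intro nn_integral_lborel_prod) auto
  also have "\<dots> = ennreal (\<Prod>b\<in>Basis. sqrt (4 * pi * k) * exp (k * (x \<bullet> b)\<^sup>2))"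
    unfolding one using k by (intro prod_ennreal) auto
  also have "(\<Prod>b\<in>Basis. sqrt (4 * pi * k) * exp (k * (x \<bullet> b)\<^sup>2)) = sqrt (4 * pi * k) ^ DIM('a) * exp (k * (norm x)\<^sup>2)"
    unfolding norm2 by (simp add: prod.distrib exp_sum sum_distrib_left)
  also have "sqrt (4 * pi * k) ^ DIM('a) = (4 * pi * k) powr (real DIM('a) / 2)"
    using k by (simp add: powr_half_sqrt[symmetric] powr_realpow[symmetric] powr_powr)
  finally show ?thesis .
qed

lemma nn_integral_Gamma_scaled:
  assumes "0 < \<gamma>" "0 < D"
  shows "(\<integral>\<^sup>+k. ennreal (indicator {0<..} k * k powr (\<gamma> - 1) * exp (- D * k)) \<partial>lborel) = ennreal (Gamma \<gamma> * D powr - \<gamma>)"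
proof -
  have "ennreal (Gamma \<gamma>) = (\<integral>\<^sup>+t. ennreal (indicator {0..} t * t powr (\<gamma> - 1) / exp t) \<partial>lborel)"
    by (rule Gamma_conv_nn_integral_real[OF assms(1)])
  also have "\<dots> = ennreal D * (\<integral>\<^sup>+k. ennreal (indicator {0..} (0 + D * k) * (0 + D * k) powr (\<gamma> - 1) / exp (0 + D * k)) \<partial>lborel)"
    using assms by (subst nn_integral_real_affine[where c=D and t=0]) auto
  also have "(\<integral>\<^sup>+k. ennreal (indicator {0..} (0 + D * k) * (0 + D * k) powr (\<gamma> - 1) / exp (0 + D * k)) \<partial>lborel)
    = (\<integral>\<^sup>+k. ennreal (D powr (\<gamma> - 1)) * ennreal (indicator {0<..} k * k powr (\<gamma> - 1) * exp (- D * k)) \<partial>lborel)"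
    using assms AE_lborel_singleton[of 0]
    by (intro nn_integral_cong_AE)
       (auto simp: indicator_def zero_le_mult_iff powr_mult exp_minus divide_inverse ennreal_mult'[symmetric] mult_ac)
  also have "\<dots> = ennreal (D powr (\<gamma> - 1)) * (\<integral>\<^sup>+k. ennreal (indicator {0<..} k * k powr (\<gamma> - 1) * exp (- D * k)) \<partial>lborel)"
    by (intro nn_integral_cmult) auto
  finally have "ennreal (Gamma \<gamma>) = ennreal (D powr \<gamma>) * (\<integral>\<^sup>+k. ennreal (indicator {0<..} k * k powr (\<gamma> - 1) * exp (- D * k)) \<partial>lborel)"
    using assms by (simp add: mult.assoc[symmetric] ennreal_mult'[symmetric] powr_diff)
  then have "ennreal (D powr - \<gamma>) * ennreal (Gamma \<gamma>) =
     ennreal (D powr - \<gamma>) * ennreal (D powr \<gamma>) * (\<integral>\<^sup>+k. ennreal (indicator {0<..} k * k powr (\<gamma> - 1) * exp (- D * k)) \<partial>lborel)"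
    by (simp add: mult.assoc)
  then show ?thesis
    using assms by (simp add: ennreal_mult'[symmetric] powr_add[symmetric] mult.commute)
qed

text \<open>
  The density with which the exponentials \<open>exp (\<xi> \<bullet> x)\<close> have to be superposed to give \<open>(\<tau>\<^sup>2 - \<bar>x\<bar>\<^sup>2) powr -\<gamma>\<close>:
  write this power as the Laplace transform \<open>1/\<Gamma>(\<gamma>) \<integral> k powr (\<gamma>-1) exp (-k (\<tau>\<^sup>2 - \<bar>x\<bar>\<^sup>2)) dk\<close> and
  \<open>exp (k \<bar>x\<bar>\<^sup>2)\<close> as a Gaussian average of \<open>exp (\<xi> \<bullet> x)\<close>.
\<close>

definition wave_density :: "real \<Rightarrow> real \<Rightarrow> 'a::euclidean_space \<Rightarrow> ennreal" where
  "wave_density \<gamma> \<tau> \<xi> = (\<integral>\<^sup>+k. ennreal (1 / (Gamma \<gamma> * (4 * pi) powr (real DIM('a) / 2)) *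
     (indicator {0<..} k * k powr (\<gamma> - 1 - real DIM('a) / 2) * exp (- k * \<tau>\<^sup>2 - (norm \<xi>)\<^sup>2 / (4 * k)))) \<partial>lborel)"

lemma wave_density_measurable [measurable]: "wave_density \<gamma> \<tau> \<in> borel_measurable borel"
  unfolding wave_density_def by measurable

text \<open>By Tonelli's theorem the Gaussian integral in \<xi> can be done first. Its power
  \<open>k powr (n/2)\<close> cancels the one built into the density, and what is left is a Gamma
  integral whose rate \<open>\<tau>^2 - (norm x)^2\<close> is positive inside the cone.\<close>

lemma nn_integral_wave_density:
  fixes x :: "'a::euclidean_space"
  assumes g: "0 < \<gamma>" and x: "norm x < \<tau>"
  shows "(\<integral>\<^sup>+\<xi>. wave_density \<gamma> \<tau> \<xi> * ennreal (exp (\<xi> \<bullet> x)) \<partial>lborel) = ennreal ((\<tau>\<^sup>2 - (norm x)\<^sup>2) powr - \<gamma>)"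
proof -
  let ?n = "real DIM('a)"
  define c where "c = 1 / (Gamma \<gamma> * (4 * pi) powr (?n / 2))"
  have c: "c > 0" using g by (auto simp: c_def intro!: mult_pos_pos Gamma_real_pos)
  define h where "h k = c * (indicator {0<..} k * k powr (\<gamma> - 1 - ?n / 2) * exp (- k * \<tau>\<^sup>2))" for k
  have h0: "0 \<le> h k" for k using c by (auto simp: h_def)
  have hm[measurable]: "h \<in> borel_measurable borel" unfolding h_def by measurable
  have wd: "wave_density \<gamma> \<tau> \<xi> = (\<integral>\<^sup>+k. ennreal (h k * exp (- (norm \<xi>)\<^sup>2 / (4 * k))) \<partial>lborel)" for \<xi> :: 'a
    unfolding wave_density_def c_def[symmetric] h_def
  proof (intro nn_integral_cong)
    fix k
    have "exp (- k * \<tau>\<^sup>2 - (norm \<xi>)\<^sup>2 / (4 * k)) = exp (- k * \<tau>\<^sup>2) * exp (- (norm \<xi>)\<^sup>2 / (4 * k))"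
      by (simp add: exp_add[symmetric])
    then show "ennreal (c * (indicator {0<..} k * k powr (\<gamma> - 1 - ?n / 2) * exp (- k * \<tau>\<^sup>2 - (norm \<xi>)\<^sup>2 / (4 * k))))
       = ennreal (c * (indicator {0<..} k * k powr (\<gamma> - 1 - ?n / 2) * exp (- k * \<tau>\<^sup>2)) * exp (- (norm \<xi>)\<^sup>2 / (4 * k)))"
      by (simp only: mult_ac)
  qed
  have "(\<integral>\<^sup>+\<xi>. wave_density \<gamma> \<tau> \<xi> * ennreal (exp (\<xi> \<bullet> x)) \<partial>lborel)
     = (\<integral>\<^sup>+\<xi>. (\<integral>\<^sup>+k. ennreal (h k) * ennreal (exp (- (norm \<xi>)\<^sup>2 / (4 * k) + \<xi> \<bullet> x)) \<partial>lborel) \<partial>(lborel::'a measure))"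
    unfolding wd
    by (intro nn_integral_cong, subst nn_integral_multc[symmetric])
       (auto intro!: nn_integral_cong simp: ennreal_mult'[symmetric] ennreal_mult''[symmetric] h0 exp_add[symmetric] mult.assoc)
  also have "\<dots> = (\<integral>\<^sup>+k. (\<integral>\<^sup>+\<xi>. ennreal (h k) * ennreal (exp (- (norm \<xi>)\<^sup>2 / (4 * k) + \<xi> \<bullet> x)) \<partial>(lborel::'a measure)) \<partial>lborel)"
    by (intro lborel_pair.Fubini') measurable
  also have "\<dots> = (\<integral>\<^sup>+k. ennreal (c * (4 * pi) powr (?n / 2)) * ennreal (indicator {0<..} k * k powr (\<gamma> - 1) * exp (- (\<tau>\<^sup>2 - (norm x)\<^sup>2) * k)) \<partial>lborel)"
  proof (intro nn_integral_cong)
    fix k :: real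
    show "(\<integral>\<^sup>+\<xi>. ennreal (h k) * ennreal (exp (- (norm \<xi>)\<^sup>2 / (4 * k) + \<xi> \<bullet> x)) \<partial>(lborel::'a measure))
      = ennreal (c * (4 * pi) powr (?n / 2)) * ennreal (indicator {0<..} k * k powr (\<gamma> - 1) * exp (- (\<tau>\<^sup>2 - (norm x)\<^sup>2) * k))"
    proof (cases "0 < k")
      case True
      have "(\<integral>\<^sup>+\<xi>. ennreal (h k) * ennreal (exp (- (norm \<xi>)\<^sup>2 / (4 * k) + \<xi> \<bullet> x)) \<partial>(lborel::'a measure))
         = ennreal (h k) * ennreal ((4 * pi * k) powr (?n / 2) * exp (k * (norm x)\<^sup>2))"
        by (subst nn_integral_cmult) (simp_all only: nn_integral_gaussian_exp[OF True], measurable)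
      also have "\<dots> = ennreal (h k * ((4 * pi * k) powr (?n / 2) * exp (k * (norm x)\<^sup>2)))"
        by (simp add: ennreal_mult' h0)
      also have "h k * ((4 * pi * k) powr (?n / 2) * exp (k * (norm x)\<^sup>2)) =
         c * (4 * pi) powr (?n / 2) * ((k powr (\<gamma> - 1 - ?n / 2) * k powr (?n / 2)) * (exp (- k * \<tau>\<^sup>2) * exp (k * (norm x)\<^sup>2)))"
        using True by (simp add: h_def powr_mult)
      also have "\<dots> = c * (4 * pi) powr (?n / 2) * (k powr (\<gamma> - 1) * exp (- (\<tau>\<^sup>2 - (norm x)\<^sup>2) * k))"
        unfolding powr_add[symmetric] exp_add[symmetric] by (simp add: algebra_simps)
      finally show ?thesis using True c by (simp add: ennreal_mult')
    qed (auto simp: h_def)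
  qed
  also have "\<dots> = ennreal (c * (4 * pi) powr (?n / 2)) * (\<integral>\<^sup>+k. ennreal (indicator {0<..} k * k powr (\<gamma> - 1) * exp (- (\<tau>\<^sup>2 - (norm x)\<^sup>2) * k)) \<partial>lborel)"
    by (intro nn_integral_cmult) auto
  also have "\<dots> = ennreal (c * (4 * pi) powr (?n / 2)) * ennreal (Gamma \<gamma> * (\<tau>\<^sup>2 - (norm x)\<^sup>2) powr - \<gamma>)"
    using x g by (subst nn_integral_Gamma_scaled) (auto intro!: power_strict_mono)
  also have "\<dots> = ennreal (c * (4 * pi) powr (?n / 2) * (Gamma \<gamma> * (\<tau>\<^sup>2 - (norm x)\<^sup>2) powr - \<gamma>))"
    using c by (simp add: ennreal_mult')
  also have "c * (4 * pi) powr (?n / 2) * (Gamma \<gamma> * (\<tau>\<^sup>2 - (norm x)\<^sup>2) powr - \<gamma>) = (\<tau>\<^sup>2 - (norm x)\<^sup>2) powr - \<gamma>"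
    using Gamma_real_pos[OF g] by (simp add: c_def)
  finally show ?thesis .
qed

text \<open>Over a bounded ratio a power of either sign changes by a bounded factor;
  \<open>\<bar>e\<bar>\<close> treats both signs of the exponent together.\<close>

lemma powr_ge_bounded_ratio:
  assumes "0 < k0" "k0 \<le> k" "k \<le> 3 * (k0::real)"
  shows "k powr e \<ge> 3 powr - \<bar>e\<bar> * k0 powr e"
proof -
  have "(k / k0) powr e \<ge> 3 powr - \<bar>e\<bar>"
  proof (cases "e \<ge> 0")
    case True
    have "3 powr - \<bar>e\<bar> \<le> (3::real) powr 0" by (intro powr_mono) auto
    then have "3 powr - \<bar>e\<bar> \<le> (1::real)" by simp
    also have "1 \<le> (k / k0) powr e" using True assms by (intro ge_one_powr_ge_zero) auto
    finally show ?thesis .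
  next
    case False
    then have "3 powr - \<bar>e\<bar> = (3::real) powr e" by simp
    also have "\<dots> \<le> (k / k0) powr e" using False assms by (intro powr_mono2') (auto simp: divide_simps)
    finally show ?thesis .
  qed
  then have "3 powr - \<bar>e\<bar> * k0 powr e \<le> (k / k0) powr e * k0 powr e" by (intro mult_right_mono) auto
  also have "\<dots> = k powr e" using assms by (simp add: powr_divide)
  finally show ?thesis .
qed

text \<open>
  The exponent equals \<open>-\<bar>\<xi>\<bar>\<tau> - \<tau>\<^sup>2 (k - k\<^sub>0)\<^sup>2 / k\<close> with \<open>k\<^sub>0 = \<bar>\<xi>\<bar>/(2\<tau>)\<close>, so an interval of length
  \<open>d = sqrt (\<bar>\<xi>\<bar>/(2\<tau>\<^sup>3))\<close> to the right of \<open>k\<^sub>0\<close> carries enough mass; \<open>\<bar>\<xi>\<bar>\<tau> \<ge> 1\<close> makes \<open>d\<close> at most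
  comparable with \<open>k\<^sub>0\<close>.
\<close>

lemma wave_density_lower_bound:
  assumes g: "0 < \<gamma>"
  shows "\<exists>c>0. \<forall>\<tau> (\<xi>::'a::euclidean_space). 0 < \<tau> \<longrightarrow> 1 \<le> norm \<xi> * \<tau> \<longrightarrow>
     ennreal (c * norm \<xi> powr (\<gamma> - 1 - (real DIM('a) - 1) / 2) * \<tau> powr ((real DIM('a) - 1) / 2 - \<gamma>) * exp (- norm \<xi> * \<tau>))
       \<le> wave_density \<gamma> \<tau> \<xi>"
proof -
  let ?n = "real DIM('a)"
  define c where "c = 1 / (Gamma \<gamma> * (4 * pi) powr (?n / 2))"
  define e where "e = \<gamma> - 1 - ?n / 2"
  define C where "C = c * 3 powr - \<bar>e\<bar> * exp (- 1) * 2 powr (- 1/2 - e)"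
  have c: "c > 0" using g by (auto simp: c_def intro!: mult_pos_pos Gamma_real_pos)
  then have C: "C > 0" by (simp add: C_def)
  have "ennreal (C * norm \<xi> powr (\<gamma> - 1 - (?n - 1) / 2) * \<tau> powr ((?n - 1) / 2 - \<gamma>) * exp (- norm \<xi> * \<tau>)) \<le> wave_density \<gamma> \<tau> \<xi>"
    if t: "0 < \<tau>" and l: "1 \<le> norm \<xi> * \<tau>" for \<tau> and \<xi> :: 'a
  proof -
    define l where "l = norm \<xi>"
    have l1: "1 \<le> l * \<tau>" using l by (simp add: l_def)
    have l0: "0 < l" using l1 t by (metis mult_nonpos_nonneg not_le not_one_le_zero order.strict_implies_order order_trans)
    define k0 where "k0 = l / (2 * \<tau>)"
    define d where "d = sqrt (l / (2 * \<tau> ^ 3))"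
    have k0: "0 < k0" using l0 t by (simp add: k0_def)
    have d0: "0 < d" using l0 t by (simp add: d_def)
    \<comment> \<open>This is the property that dictates \<open>d\<close>: on
      \<open>{k0..k0 + d}\<close> the term \<open>\<tau>^2 (k - k0)^2 / k\<close> is at most 1, so
      that only a factor \<open>exp (- 1)\<close> is lost.\<close>
    have d2: "\<tau>\<^sup>2 * d\<^sup>2 = k0" using l0 t by (simp add: d_def k0_def power2_eq_square power3_eq_cube)
    have dk: "d \<le> 2 * k0"
    proof (rule power2_le_imp_le)
      have "k0 * 1 \<le> k0 * (4 * (\<tau>\<^sup>2 * k0))"
      proof (intro mult_left_mono)
        have "4 * (\<tau>\<^sup>2 * k0) = 2 * (l * \<tau>)" using t by (simp add: k0_def power2_eq_square)
        then show "1 \<le> 4 * (\<tau>\<^sup>2 * k0)" using l1 by linarith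
      qed (use k0 in auto)
      then have "\<tau>\<^sup>2 * d\<^sup>2 \<le> \<tau>\<^sup>2 * (2 * k0)\<^sup>2" unfolding d2 by (simp add: power2_eq_square mult_ac)
      then show "d\<^sup>2 \<le> (2 * k0)\<^sup>2" using t by simp
    qed (use k0 in auto)
    have low: "c * (3 powr - \<bar>e\<bar> * k0 powr e * (exp (- 1) * exp (- l * \<tau>))) \<le> c * (indicator {0<..} k * k powr e * exp (- k * \<tau>\<^sup>2 - l\<^sup>2 / (4 * k)))"
      if k: "k \<in> {k0..k0 + d}" for k
    proof -
      have kp: "0 < k" using k k0 by auto
      have "(k - k0)\<^sup>2 \<le> d\<^sup>2" using k by (intro power_mono) auto
      then have "\<tau>\<^sup>2 * (k - k0)\<^sup>2 \<le> k" using d2 k mult_left_mono[of "(k - k0)\<^sup>2" "d\<^sup>2" "\<tau>\<^sup>2"] by auto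
      moreover have "- k * \<tau>\<^sup>2 - l\<^sup>2 / (4 * k) = - l * \<tau> - (\<tau>\<^sup>2 * (k - k0)\<^sup>2) / k"
        using kp t by (simp add: k0_def field_simps power2_eq_square)
      moreover have "(\<tau>\<^sup>2 * (k - k0)\<^sup>2) / k \<le> 1" using calculation(1) kp by simp
      ultimately have "exp (- 1 + - l * \<tau>) \<le> exp (- k * \<tau>\<^sup>2 - l\<^sup>2 / (4 * k))" by simp
      then have "exp (- 1) * exp (- l * \<tau>) \<le> exp (- k * \<tau>\<^sup>2 - l\<^sup>2 / (4 * k))" by (simp only: exp_add)
      moreover have "3 powr - \<bar>e\<bar> * k0 powr e \<le> k powr e"
        using powr_ge_bounded_ratio[of k0 k e] k k0 dk by auto
      ultimately have "(3 powr - \<bar>e\<bar> * k0 powr e) * (exp (- 1) * exp (- l * \<tau>)) \<le> k powr e * exp (- k * \<tau>\<^sup>2 - l\<^sup>2 / (4 * k))"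
        by (intro mult_mono) auto
      then show ?thesis using kp c by (simp add: mult.assoc)
    qed
    have "ennreal (c * (3 powr - \<bar>e\<bar> * k0 powr e * (exp (- 1) * exp (- l * \<tau>)))) * ennreal d
      = (\<integral>\<^sup>+k. ennreal (c * (3 powr - \<bar>e\<bar> * k0 powr e * (exp (- 1) * exp (- l * \<tau>)))) * indicator {k0..k0 + d} k \<partial>lborel)"
      using d0 by (subst nn_integral_cmult_indicator) auto
    also have "\<dots> \<le> wave_density \<gamma> \<tau> \<xi>"
      unfolding wave_density_def c_def[symmetric] e_def[symmetric] l_def[symmetric]
    proof (intro nn_integral_mono)
      fix k
      show "ennreal (c * (3 powr - \<bar>e\<bar> * k0 powr e * (exp (- 1) * exp (- l * \<tau>)))) * indicator {k0..k0 + d} k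
         \<le> ennreal (c * (indicator {0<..} k * k powr e * exp (- k * \<tau>\<^sup>2 - l\<^sup>2 / (4 * k))))"
        using ennreal_leI[OF low, of k] by (cases "k \<in> {k0..k0 + d}") simp_all
    qed
    also have "ennreal (c * (3 powr - \<bar>e\<bar> * k0 powr e * (exp (- 1) * exp (- l * \<tau>)))) * ennreal d
      = ennreal (c * (3 powr - \<bar>e\<bar> * k0 powr e * (exp (- 1) * exp (- l * \<tau>))) * d)"
      using d0 c by (simp add: ennreal_mult')
    also have "c * (3 powr - \<bar>e\<bar> * k0 powr e * (exp (- 1) * exp (- l * \<tau>))) * d = c * 3 powr - \<bar>e\<bar> * exp (- 1) * (k0 powr e * d) * exp (- l * \<tau>)"
      by simp
    also have "k0 powr e * d = 2 powr (- 1/2 - e) * l powr (e + 1/2) * \<tau> powr (- e - 3/2)"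
    proof -
      have "d = (l / (2 * \<tau> powr 3)) powr (1/2)" using t l0 by (simp add: d_def powr_half_sqrt)
      also have "\<dots> = l powr (1/2) * 2 powr - (1/2) * \<tau> powr - (3/2)"
        using t l0 powr_powr[of \<tau> 3 "1/2"] by (simp add: powr_divide powr_mult powr_minus_divide)
      finally have d: "d = l powr (1/2) * 2 powr - (1/2) * \<tau> powr - (3/2)" .
      have k: "k0 powr e = l powr e * 2 powr - e * \<tau> powr - e"
        using t l0 by (simp add: k0_def powr_divide powr_mult powr_minus_divide)
      have "k0 powr e * d = (2 powr - (1/2) * 2 powr - e) * (l powr e * l powr (1/2)) * (\<tau> powr - e * \<tau> powr - (3/2))"
        unfolding d k by (simp only: mult_ac)
      moreover have "- (1/2) + - e = - 1/2 - e" "- e + - (3/2) = - e - 3/2" for e :: real by auto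
      ultimately show ?thesis by (simp only: powr_add[symmetric])
    qed
    also have "e + 1/2 = \<gamma> - 1 - (?n - 1) / 2" by (simp add: e_def field_simps)
    also have "- e - 3/2 = (?n - 1) / 2 - \<gamma>" by (simp add: e_def field_simps)
    finally show ?thesis by (simp add: C_def l_def mult_ac)
  qed
  with C show ?thesis by blast
qed

text \<open>
  Only frequencies \<open>\<bar>\<xi>\<bar> \<sim> 1/s'\<close> with \<open>\<xi> \<bullet> x \<ge> 0\<close> matter; they contain a ball of radius \<open>1/(2s')\<close> centred on the
  ray through \<open>x\<close>.
\<close>

lemma wave_kernel_lower_bound:
  assumes g: "0 < \<gamma>"
  defines "N \<equiv> (real DIM('a::euclidean_space) - 1) / 2"
  shows "\<exists>C>0. \<forall>\<tau> s' (x::'a). 0 < s' \<longrightarrow> s' \<le> \<tau> \<longrightarrow>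
    ennreal (C * (\<tau> powr (N - 1 - \<gamma>) * (\<tau> - s') * s' powr (1 - N - \<gamma>)))
     \<le> (\<integral>\<^sup>+\<xi>. wave_density \<gamma> \<tau> \<xi> * ennreal (sinh (norm \<xi> * (\<tau> - s')) / norm \<xi> * exp (\<xi> \<bullet> x)) \<partial>lborel)"
proof -
  let ?n = "DIM('a)"
  obtain c where c: "c > 0" and wd: "\<And>\<tau> (\<xi>::'a). 0 < \<tau> \<Longrightarrow> 1 \<le> norm \<xi> * \<tau> \<Longrightarrow>
     ennreal (c * norm \<xi> powr (\<gamma> - 1 - N) * \<tau> powr (N - \<gamma>) * exp (- norm \<xi> * \<tau>)) \<le> wave_density \<gamma> \<tau> \<xi>"
    using wave_density_lower_bound[OF g, where 'a='a] unfolding N_def by blast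
  define e where "e = \<gamma> - 1 - N"
  define C where "C = c * 3 powr - \<bar>e\<bar> * exp (- 2) / 4 * (unit_ball_vol ?n * (1/2) ^ ?n)"
  have C: "C > 0" using c by (simp add: C_def)
  have "ennreal (C * (\<tau> powr (N - 1 - \<gamma>) * (\<tau> - s') * s' powr (1 - N - \<gamma>)))
     \<le> (\<integral>\<^sup>+\<xi>. wave_density \<gamma> \<tau> \<xi> * ennreal (sinh (norm \<xi> * (\<tau> - s')) / norm \<xi> * exp (\<xi> \<bullet> x)) \<partial>lborel)"
    if s: "0 < s'" and st: "s' \<le> \<tau>" for \<tau> s' and x :: 'a
  proof -
    obtain b0 :: 'a where b0: "b0 \<in> Basis" using nonempty_Basis by blast
    \<comment> \<open>Direction of \<open>x\<close>; for \<open>x = 0\<close> any unit vector will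
      do.\<close>
    define w :: 'a where "w = (if x = 0 then b0 else x /\<^sub>R norm x)"
    have w: "norm w = 1" "w \<bullet> x = norm x"
      using b0 by (auto simp: w_def power2_norm_eq_inner[symmetric] power2_eq_square)
    define p where "p = (3 / (2 * s')) *\<^sub>R w"
    define r where "r = 1 / (2 * s')"
    have r: "0 < r" using s by (simp add: r_def)
    define m where "m = c * (3 powr - \<bar>e\<bar> * s' powr - e) * \<tau> powr (N - \<gamma>) * (exp (- 2) / 4 * ((\<tau> - s') * s' / \<tau>))"
    have m0: "0 \<le> m" using c s st by (simp add: m_def)
    have low: "ennreal m \<le> wave_density \<gamma> \<tau> \<xi> * ennreal (sinh (norm \<xi> * (\<tau> - s')) / norm \<xi> * exp (\<xi> \<bullet> x))"
      if xi: "\<xi> \<in> cball p r" for \<xi>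
    proof -
      define l where "l = norm \<xi>"
      have np: "norm p = 3 / (2 * s')" using s w by (simp add: p_def)
      have d: "norm (\<xi> - p) \<le> r" using xi by (simp add: dist_norm norm_minus_commute)
      have l1: "1 / s' \<le> l"
        using norm_triangle_ineq2[of p "p - \<xi>"] d np by (simp add: l_def r_def norm_minus_commute field_simps)
      have l2: "l \<le> 2 / s'"
        using norm_triangle_ineq[of p "\<xi> - p"] d np by (simp add: l_def r_def field_simps)
      have l0: "0 < l" using l1 s by (meson divide_pos_pos less_le_trans zero_less_one)
      have "\<xi> \<bullet> x = p \<bullet> x + (\<xi> - p) \<bullet> x" by (simp add: inner_diff_left)
      moreover have "p \<bullet> x = 3 / (2 * s') * norm x" using w by (simp add: p_def)
      moreover have "(\<xi> - p) \<bullet> x \<ge> - (r * norm x)"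
      proof -
        have "\<bar>(\<xi> - p) \<bullet> x\<bar> \<le> norm (\<xi> - p) * norm x" by (rule Cauchy_Schwarz_ineq2)
        also have "\<dots> \<le> r * norm x" using d by (intro mult_right_mono) auto
        finally show ?thesis by linarith
      qed
      ultimately have "\<xi> \<bullet> x \<ge> (3 / (2 * s') - r) * norm x" by (simp add: left_diff_distrib)
      moreover have "0 \<le> (3 / (2 * s') - r) * norm x" using s by (simp add: r_def field_simps)
      ultimately have ex: "1 \<le> exp (\<xi> \<bullet> x)" by simp
      define \<sigma> where "\<sigma> = \<tau> - s'"
      have \<sigma>: "0 \<le> \<sigma>" using st by (simp add: \<sigma>_def)
      have tau: "0 < \<tau>" using s st by simp
      have lt: "1 \<le> l * \<tau>"
      proof -
        have "1 = 1 / s' * s'" using s by simp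
        also have "\<dots> \<le> l * \<tau>" using l1 st s l0 by (intro mult_mono) auto
        finally show ?thesis .
      qed
      have le: "3 powr - \<bar>e\<bar> * s' powr - e \<le> l powr e"
      proof -
        have "3 powr - \<bar>e\<bar> * (1 / s') powr e \<le> l powr e"
        proof (rule powr_ge_bounded_ratio)
          have "2 / s' \<le> 3 * (1 / s')" using s by (simp add: field_simps)
          then show "l \<le> 3 * (1 / s')" using l2 by linarith
        qed (use s l1 in auto)
        moreover have "(1 / s') powr e = s' powr - e" using s by (simp add: powr_divide powr_minus_divide)
        ultimately show ?thesis by simp
      qed
      \<comment> \<open>After extracting \<open>exp (- l * s')\<close> the factor
        \<open>(1 - exp (- 2 l \<sigma>)) / (2 l)\<close> remains. The bound
        \<open>1 - exp (- y) \<ge> y / (1 + y)\<close> covers small and large \<open>y\<close> at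
        once, and \<open>l * s' \<le> 2\<close> turns it into
        \<open>\<sigma> * s' / (4 * \<tau>)\<close> and the extracted factor into
        \<open>exp (- 2)\<close>.\<close>
      have sh: "exp (- 2) / 4 * (\<sigma> * s' / \<tau>) \<le> exp (- l * \<tau>) * (sinh (l * \<sigma>) / l)"
      proof -
        have y: "2 * l * \<sigma> / (1 + 2 * l * \<sigma>) \<le> 1 - exp (- (2 * l * \<sigma>))"
        proof -
          define y where "y = 2 * l * \<sigma>"
          have "0 \<le> y" using l0 \<sigma> by (simp add: y_def)
          moreover have "1 + y \<le> exp y" by (rule exp_ge_add_one_self)
          ultimately have "exp (- y) \<le> 1 / (1 + y)" by (simp add: exp_minus field_simps)
          moreover have "1 - 1 / (1 + y) = y / (1 + y)" using \<open>0 \<le> y\<close> by (simp add: field_simps)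
          ultimately show ?thesis unfolding y_def by linarith
        qed
        have "\<sigma> * s' / (4 * \<tau>) \<le> \<sigma> / (1 + 2 * l * \<sigma>)"
        proof -
          have "l * s' \<le> 2" using l2 s by (simp add: field_simps)
          then have "2 * (l * s') * \<sigma> \<le> 2 * 2 * \<sigma>" using \<sigma> by (intro mult_right_mono mult_left_mono) auto
          then have "s' * (1 + 2 * l * \<sigma>) \<le> 4 * \<tau>" using st s by (simp add: \<sigma>_def algebra_simps)
          then have "\<sigma> * (s' * (1 + 2 * l * \<sigma>)) \<le> \<sigma> * (4 * \<tau>)" using \<sigma> by (intro mult_left_mono)
          moreover have "0 < 1 + 2 * l * \<sigma>" using l0 \<sigma> by (intro add_pos_nonneg) auto
          ultimately show ?thesis using tau by (simp add: divide_simps mult_ac)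
        qed
        also have "\<dots> = (2 * l * \<sigma> / (1 + 2 * l * \<sigma>)) / (2 * l)" using l0 by simp
        also have "\<dots> \<le> (1 - exp (- (2 * l * \<sigma>))) / (2 * l)" using y l0 by (intro divide_right_mono) auto
        finally have 1: "\<sigma> * s' / (4 * \<tau>) \<le> (1 - exp (- (2 * l * \<sigma>))) / (2 * l)" .
        have 2: "exp (- 2) \<le> exp (- l * s')" using l2 s by (simp add: field_simps)
        have "exp (- 2) * (\<sigma> * s' / (4 * \<tau>)) \<le> exp (- l * s') * ((1 - exp (- (2 * l * \<sigma>))) / (2 * l))"
          using 1 2 \<sigma> s tau by (intro mult_mono) auto
        also have "\<dots> = exp (- l * \<tau>) * (sinh (l * \<sigma>) / l)"
        proof -
          have "exp (- l * \<tau>) * exp (l * \<sigma>) = exp (- l * s')" "exp (- l * \<tau>) * exp (- (l * \<sigma>)) = exp (- l * s') * exp (- (2 * l * \<sigma>))"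
            unfolding exp_add[symmetric] by (simp_all add: \<sigma>_def algebra_simps)
          moreover have "sinh (l * \<sigma>) / l = (exp (l * \<sigma>) - exp (- (l * \<sigma>))) / (2 * l)"
            by (simp add: sinh_field_def)
          ultimately show ?thesis by (simp add: right_diff_distrib)
        qed
        finally show ?thesis by (simp add: mult_ac)
      qed
      have sh0: "0 \<le> sinh (l * \<sigma>) / l" using l0 \<sigma> by simp
      have "m \<le> c * l powr e * \<tau> powr (N - \<gamma>) * (exp (- l * \<tau>) * (sinh (l * \<sigma>) / l))"
      proof -
        have "c * (3 powr - \<bar>e\<bar> * s' powr - e) * \<tau> powr (N - \<gamma>) \<le> c * l powr e * \<tau> powr (N - \<gamma>)"
          using c le by (intro mult_right_mono mult_left_mono) auto
        from mult_mono[OF this sh] show ?thesis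
          unfolding m_def \<sigma>_def[symmetric] using c \<sigma> s tau by simp
      qed
      also have "\<dots> = (c * l powr e * \<tau> powr (N - \<gamma>) * exp (- l * \<tau>)) * (sinh (l * \<sigma>) / l * 1)" by simp
      also have "\<dots> \<le> (c * l powr e * \<tau> powr (N - \<gamma>) * exp (- l * \<tau>)) * (sinh (l * \<sigma>) / l * exp (\<xi> \<bullet> x))"
        using ex sh0 c by (intro mult_left_mono) auto
      finally have "ennreal m \<le> ennreal ((c * l powr e * \<tau> powr (N - \<gamma>) * exp (- l * \<tau>)) * (sinh (l * \<sigma>) / l * exp (\<xi> \<bullet> x)))"
        by (rule ennreal_leI)
      also have "\<dots> = ennreal (c * l powr e * \<tau> powr (N - \<gamma>) * exp (- l * \<tau>)) * ennreal (sinh (l * \<sigma>) / l * exp (\<xi> \<bullet> x))"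
        using c by (intro ennreal_mult') auto
      also have "\<dots> \<le> wave_density \<gamma> \<tau> \<xi> * ennreal (sinh (l * \<sigma>) / l * exp (\<xi> \<bullet> x))"
        using wd[OF tau, of \<xi>] lt by (intro mult_right_mono) (auto simp: l_def e_def)
      finally show ?thesis by (simp add: l_def \<sigma>_def)
    qed
    have "ennreal (m * (unit_ball_vol ?n * r ^ ?n)) = (\<integral>\<^sup>+\<xi>. ennreal m * indicator (cball p r) \<xi> \<partial>lborel)"
      using m0 r by (subst nn_integral_cmult_indicator) (auto simp: emeasure_cball ennreal_mult')
    also have "\<dots> \<le> (\<integral>\<^sup>+\<xi>. wave_density \<gamma> \<tau> \<xi> * ennreal (sinh (norm \<xi> * (\<tau> - s')) / norm \<xi> * exp (\<xi> \<bullet> x)) \<partial>lborel)"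
      using low by (intro nn_integral_mono) (auto simp: indicator_def)
    also have "m * (unit_ball_vol ?n * r ^ ?n) = C * (\<tau> powr (N - 1 - \<gamma>) * (\<tau> - s') * s' powr (1 - N - \<gamma>))"
    proof -
      have e1: "r ^ ?n = (1/2) ^ ?n * s' powr - real ?n"
        using s by (simp add: r_def power_divide power_mult_distrib powr_minus powr_realpow field_simps)
      have e2: "\<tau> powr (N - \<gamma>) / \<tau> = \<tau> powr (N - 1 - \<gamma>)"
        using s st powr_diff[of \<tau> "N - \<gamma>" 1] by (simp add: algebra_simps)
      have e3: "s' powr - e * s' * s' powr - real ?n = s' powr (1 - N - \<gamma>)"
      proof -
        have "s' powr - e * s' powr 1 * s' powr - real ?n = s' powr (- e + 1 + - real ?n)" by (simp only: powr_add)
        also have "- e + 1 + - real ?n = 1 - N - \<gamma>" by (simp add: e_def N_def field_simps)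
        finally show ?thesis using s by simp
      qed
      have "m * (unit_ball_vol ?n * ((1/2) ^ ?n * A)) = c * 3 powr - \<bar>e\<bar> * exp (- 2) / 4 * (unit_ball_vol ?n * (1/2) ^ ?n) * (\<tau> - s') *
         (\<tau> powr (N - \<gamma>) / \<tau>) * (s' powr - e * s' * A)" for A by (simp add: m_def)
      from this[of "s' powr - real ?n"] show ?thesis unfolding e1 e2 e3 C_def by (simp only: mult_ac)
    qed
    finally show ?thesis .
  qed
  with C show ?thesis by blast
qed

text \<open>For the data a fixed annulus of frequencies is enough: the growth
  \<open>exp (norm \<xi> * t)\<close> compensates the decay of the density at
  \<open>\<tau> = t + \<rho>\<close> up to \<open>exp (- 2 * \<rho>)\<close>, and the remaining
  power of \<tau> is that of the density.\<close>

lemma wave_data_lower_bound: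
  assumes g: "0 < \<gamma>"
  defines "N \<equiv> (real DIM('a::euclidean_space) - 1) / 2"
  shows "\<exists>C>0. \<forall>t \<rho> K f. 1 \<le> t + \<rho> \<longrightarrow> 0 \<le> \<rho> \<longrightarrow> 0 \<le> K \<longrightarrow>
     (\<forall>\<xi>::'a. 1 \<le> norm \<xi> \<longrightarrow> norm \<xi> \<le> 2 \<longrightarrow> K * exp (norm \<xi> * t) \<le> f \<xi>) \<longrightarrow>
    ennreal (C * (K * exp (- 2 * \<rho>) * (t + \<rho>) powr (N - \<gamma>))) \<le> (\<integral>\<^sup>+\<xi>. wave_density \<gamma> (t + \<rho>) \<xi> * ennreal (f \<xi>) \<partial>lborel)"
proof -
  let ?n = "DIM('a)"
  obtain c where c: "c > 0" and wd: "\<And>\<tau> (\<xi>::'a). 0 < \<tau> \<Longrightarrow> 1 \<le> norm \<xi> * \<tau> \<Longrightarrow>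
     ennreal (c * norm \<xi> powr (\<gamma> - 1 - N) * \<tau> powr (N - \<gamma>) * exp (- norm \<xi> * \<tau>)) \<le> wave_density \<gamma> \<tau> \<xi>"
    using wave_density_lower_bound[OF g, where 'a='a] unfolding N_def by blast
  define e where "e = \<gamma> - 1 - N"
  define C where "C = c * 3 powr - \<bar>e\<bar> * (unit_ball_vol ?n * (1/2) ^ ?n)"
  have C: "C > 0" using c by (simp add: C_def)
  have "ennreal (C * (K * exp (- 2 * \<rho>) * (t + \<rho>) powr (N - \<gamma>))) \<le> (\<integral>\<^sup>+\<xi>. wave_density \<gamma> (t + \<rho>) \<xi> * ennreal (f \<xi>) \<partial>lborel)"
    if t: "1 \<le> t + \<rho>" and \<rho>: "0 \<le> \<rho>" and K: "0 \<le> K"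
      and f: "\<And>\<xi>::'a. 1 \<le> norm \<xi> \<Longrightarrow> norm \<xi> \<le> 2 \<Longrightarrow> K * exp (norm \<xi> * t) \<le> f \<xi>" for t \<rho> K f
  proof -
    obtain b0 :: 'a where b0: "b0 \<in> Basis" using nonempty_Basis by blast
    define p where "p = (3 / 2) *\<^sub>R b0"
    define \<tau> where "\<tau> = t + \<rho>"
    define m where "m = c * 3 powr - \<bar>e\<bar> * \<tau> powr (N - \<gamma>) * (K * exp (- 2 * \<rho>))"
    have m0: "0 \<le> m" using c K by (simp add: m_def)
    have low: "ennreal m \<le> wave_density \<gamma> \<tau> \<xi> * ennreal (f \<xi>)" if xi: "\<xi> \<in> cball p (1/2)" for \<xi>
    proof -
      define l where "l = norm \<xi>"
      have np: "norm p = 3 / 2" using b0 by (simp add: p_def)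
      have d: "norm (\<xi> - p) \<le> 1/2" using xi by (simp add: dist_norm norm_minus_commute)
      have l1: "1 \<le> l"
        using norm_triangle_ineq2[of p "p - \<xi>"] d np by (simp add: l_def norm_minus_commute)
      have l2: "l \<le> 2"
        using norm_triangle_ineq[of p "\<xi> - p"] d np by (simp add: l_def)
      have lt: "1 \<le> l * \<tau>" using mult_mono[of 1 l 1 \<tau>] l1 t by (simp add: \<tau>_def)
      have le: "3 powr - \<bar>e\<bar> \<le> l powr e" using powr_ge_bounded_ratio[of 1 l e] l1 l2 by simp
      have "l * \<rho> \<le> 2 * \<rho>" using l2 \<rho> by (intro mult_right_mono)
      then have "exp (- 2 * \<rho>) \<le> exp (- l * \<tau>) * exp (l * t)"
        unfolding exp_add[symmetric] by (simp add: \<tau>_def algebra_simps)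
      then have "m \<le> c * l powr e * \<tau> powr (N - \<gamma>) * (K * (exp (- l * \<tau>) * exp (l * t)))"
        unfolding m_def using c le K by (intro mult_mono mult_left_mono mult_nonneg_nonneg) auto
      also have "\<dots> = (c * l powr e * \<tau> powr (N - \<gamma>) * exp (- l * \<tau>)) * (K * exp (l * t))" by simp
      also have "\<dots> \<le> (c * l powr e * \<tau> powr (N - \<gamma>) * exp (- l * \<tau>)) * f \<xi>"
        using f[of \<xi>] l1 l2 c by (intro mult_left_mono) (auto simp: l_def)
      finally have "ennreal m \<le> ennreal ((c * l powr e * \<tau> powr (N - \<gamma>) * exp (- l * \<tau>)) * f \<xi>)"
        by (rule ennreal_leI)
      also have "\<dots> = ennreal (c * l powr e * \<tau> powr (N - \<gamma>) * exp (- l * \<tau>)) * ennreal (f \<xi>)"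
        using c by (intro ennreal_mult') auto
      also have "\<dots> \<le> wave_density \<gamma> \<tau> \<xi> * ennreal (f \<xi>)"
        using wd[of \<tau> \<xi>] lt t by (intro mult_right_mono) (auto simp: l_def e_def \<tau>_def)
      finally show ?thesis .
    qed
    have "ennreal (m * (unit_ball_vol ?n * (1/2) ^ ?n)) = (\<integral>\<^sup>+\<xi>. ennreal m * indicator (cball p (1/2)) \<xi> \<partial>lborel)"
      using m0 by (subst nn_integral_cmult_indicator) (auto simp: emeasure_cball ennreal_mult')
    also have "\<dots> \<le> (\<integral>\<^sup>+\<xi>. wave_density \<gamma> \<tau> \<xi> * ennreal (f \<xi>) \<partial>lborel)"
      using low by (intro nn_integral_mono) (auto simp: indicator_def)
    finally show ?thesis by (simp add: C_def m_def \<tau>_def mult_ac)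
  qed
  with C show ?thesis by blast
qed

section \<open>Weighted means over the light cone\<close>

text \<open>
  The shift \<open>R + 2\<close> keeps the weight bounded on the enlarged cone \<open>\<bar>x\<bar> \<le> t + R + 1\<close>.
\<close>

definition cone_mean :: "real \<Rightarrow> real \<Rightarrow> (real \<Rightarrow> real ^ 'n \<Rightarrow> real) \<Rightarrow> real \<Rightarrow> real" where
  "cone_mean R \<gamma> u t = (LINT x|lebesgue. u t x * ((t + R + 2)\<^sup>2 - (norm x)\<^sup>2) powr - \<gamma>)"

context damped_wave
begin

lemma exp_moment_nonneg:
  assumes "t \<in> I" "\<xi> \<noteq> 0"
  shows "0 \<le> exp_moment \<xi> t"
proof -
  have "0 \<le> exp (- norm \<xi> * t) * (\<epsilon> * D0 \<xi>) + exp (- B) * (\<epsilon> * (D1 \<xi> + norm \<xi> * D0 \<xi>) * (sinh (norm \<xi> * t) / norm \<xi>))"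
    using D_nonneg[of \<xi>] eps_pos I_nonneg[OF assms(1)]
    by (intro add_nonneg_nonneg mult_nonneg_nonneg divide_nonneg_nonneg) auto
  then show ?thesis using exp_moment_data[OF assms] by linarith
qed

text \<open>Since \<open>u\<close> has no sign, exchanging the integrals over \<open>x\<close> and
  \<xi> requires absolute integrability. It holds because the weight is at most 1 on the support:
  the shift leaves \<open>norm x + 1 \<le> \<tau>\<close> there. Only afterwards does nonnegativity
  of the moments allow the passage to \<open>ennreal\<close>.\<close>

lemma cone_mean_eq:
  assumes t: "t \<in> I" and \<gamma>: "0 < \<gamma>"
  shows "ennreal (cone_mean R \<gamma> u t) = (\<integral>\<^sup>+\<xi>. wave_density \<gamma> (t + R + 2) \<xi> * ennreal (exp_moment \<xi> t) \<partial>lborel)"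
    and cone_mean_nonneg: "0 \<le> cone_mean R \<gamma> u t"
proof -
  define \<tau> where "\<tau> = t + R + 2"
  define A where "A = cball (0 :: real ^ 'n) (t + R + 1)"
  have t0: "0 \<le> t" by (rule I_nonneg[OF t])
  have A[measurable]: "A \<in> sets borel" by (simp add: A_def)
  define D where "D x = (\<tau>\<^sup>2 - (norm (x :: real ^ 'n))\<^sup>2) powr - \<gamma>" for x
  have D[measurable]: "D \<in> borel_measurable borel" unfolding D_def by measurable
  obtain u' where u': "u' \<in> borel_measurable lborel" "AE x in lborel. u t x = u' x"
    using completion_ex_borel_measurable_real[OF L2_measurable[OF u_L2[OF t]]] by auto
  have [measurable]: "u' \<in> borel_measurable borel" using u' by simp
  define v where "v x = indicator A x * u' x" for x
  have v[measurable]: "v \<in> borel_measurable borel" unfolding v_def by measurable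
  have ae: "AE x in lebesgue. u t x = v x"
    using AE_completion[OF u'(2)] u_cone[OF t]
    by eventually_elim (auto simp: v_def A_def indicator_def)
  have m_to: "(\<lambda>x. f x) \<in> borel_measurable lebesgue" if "f \<in> borel_measurable borel" for f :: "real ^ 'n \<Rightarrow> real"
    using that by (intro measurable_completion) auto
  have swap: "(LINT x|lebesgue. u t x * f x) = (LINT x|lborel. v x * f x)" if f: "f \<in> borel_measurable borel" for f
  proof -
    have m: "(\<lambda>x. v x * f x) \<in> borel_measurable lebesgue" using f by (intro m_to) measurable
    have ae': "AE x in lebesgue. v x * f x = u t x * f x" using ae by eventually_elim simp
    have "(LINT x|lebesgue. u t x * f x) = (LINT x|lebesgue. v x * f x)"
      by (rule integral_cong_AE[OF m borel_measurable_AE[OF m ae'] ae', symmetric])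
    also have "\<dots> = (LINT x|lborel. v x * f x)" using f by (subst integral_completion) auto
    finally show ?thesis .
  qed
  \<comment> \<open>A square integrable function supported in a ball is integrable.\<close>
  have v_int: "integrable lborel v"
  proof (rule Bochner_Integration.integrable_bound)
    have "integrable lebesgue (\<lambda>x. (u t x)\<^sup>2)" using u_L2[OF t] by (simp add: L2_real_iff)
    then have "integrable lebesgue (\<lambda>x. (v x)\<^sup>2)"
      using ae by (rule_tac integrable_cong_AE_imp) (auto intro!: m_to elim: eventually_mono)
    then have "integrable lborel (\<lambda>x. (v x)\<^sup>2)" by (subst (asm) integrable_completion) auto
    moreover have "integrable lborel (indicator A :: _ \<Rightarrow> real)"
      unfolding A_def using emeasure_lborel_cball_finite[of "0 :: real ^ 'n" "t + R + 1"]
      by (intro integrable_real_indicator) (simp_all add: infinity_ennreal_def)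
    ultimately show "integrable lborel (\<lambda>x. (v x)\<^sup>2 + indicator A x)" by auto
    have "\<bar>v x\<bar> \<le> (v x)\<^sup>2 + indicator A x" for x
    proof (cases "x \<in> A")
      case True
      have "0 \<le> (\<bar>v x\<bar> - 1)\<^sup>2" by simp
      then have "2 * \<bar>v x\<bar> \<le> (v x)\<^sup>2 + 1" by (simp add: power2_diff)
      then show ?thesis using True abs_ge_zero[of "v x"] by (simp del: abs_ge_zero)
    qed (simp add: v_def)
    then show "AE x in lborel. norm (v x) \<le> norm ((v x)\<^sup>2 + indicator A x)" by (auto simp: abs_le_iff)
  qed simp
  \<comment> \<open>A real-valued version of the density for Bochner integrals. Taking
    \<open>x = 0\<close> in the transform shows that the density has finite total mass, hence is
    finite almost everywhere and agrees with \<open>w\<close> there.\<close>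
  define w where "w \<xi> = enn2real (wave_density \<gamma> \<tau> \<xi>)" for \<xi> :: "real ^ 'n"
  have w[measurable]: "w \<in> borel_measurable borel" unfolding w_def by measurable
  have w0: "0 \<le> w \<xi>" for \<xi> by (simp add: w_def)
  have \<tau>: "0 < \<tau>" using t0 R_pos by (simp add: \<tau>_def)
  have "(\<integral>\<^sup>+\<xi>. wave_density \<gamma> \<tau> (\<xi> :: real ^ 'n) * ennreal (exp (\<xi> \<bullet> 0)) \<partial>lborel) = ennreal ((\<tau>\<^sup>2 - (norm (0 :: real ^ 'n))\<^sup>2) powr - \<gamma>)"
    using \<tau> by (intro nn_integral_wave_density \<gamma>) auto
  then have "(\<integral>\<^sup>+\<xi>. wave_density \<gamma> \<tau> (\<xi> :: real ^ 'n) \<partial>lborel) \<noteq> \<infinity>" by simp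
  then have "AE \<xi> :: real ^ 'n in lborel. wave_density \<gamma> \<tau> \<xi> \<noteq> \<infinity>"
    by (intro nn_integral_noteq_infinite) auto
  then have we: "AE \<xi> in lborel. ennreal (w \<xi>) = wave_density \<gamma> \<tau> \<xi>"
    by eventually_elim (simp add: w_def ennreal_enn2real less_top)
  have kn: "(\<integral>\<^sup>+\<xi>. ennreal (w \<xi> * exp (\<xi> \<bullet> x)) \<partial>lborel) = ennreal (D x)" if "x \<in> A" for x
  proof -
    have "(\<integral>\<^sup>+\<xi>. ennreal (w \<xi> * exp (\<xi> \<bullet> x)) \<partial>lborel) = (\<integral>\<^sup>+\<xi>. wave_density \<gamma> \<tau> \<xi> * ennreal (exp (\<xi> \<bullet> x)) \<partial>lborel)"
      using we by (intro nn_integral_cong_AE) (auto elim!: eventually_mono simp: ennreal_mult' w0)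
    also have "\<dots> = ennreal (D x)"
      unfolding D_def using that by (intro nn_integral_wave_density \<gamma>) (simp add: A_def \<tau>_def)
    finally show ?thesis .
  qed
  have ki: "integrable lborel (\<lambda>\<xi>. w \<xi> * exp (\<xi> \<bullet> x))" if "x \<in> A" for x
    using kn[OF that] w0 by (intro integrableI_nonneg) auto
  have kl: "(LINT \<xi>|lborel. w \<xi> * exp (\<xi> \<bullet> x)) = D x" if "x \<in> A" for x
    using kn[OF that] w0 by (subst integral_eq_nn_integral) (auto simp: D_def)
  have D1: "D x \<le> 1" if "x \<in> A" for x
  proof -
    have "norm x + 1 \<le> \<tau>" using that by (simp add: A_def \<tau>_def)
    then have "1 * 1 \<le> (\<tau> - norm x) * (\<tau> + norm x)"
      using norm_ge_zero[of x] by (intro mult_mono) linarith+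
    then have "1 \<le> \<tau>\<^sup>2 - (norm x)\<^sup>2" by (simp add: power2_eq_square algebra_simps)
    then have "D x \<le> 1 powr - \<gamma>" unfolding D_def using \<gamma> by (intro powr_mono2') auto
    then show ?thesis by simp
  qed
  define f where "f x \<xi> = v x * (w \<xi> * exp (\<xi> \<bullet> x))" for x \<xi>
  have fm: "(\<lambda>(x, \<xi>). f x \<xi>) \<in> borel_measurable (lborel \<Otimes>\<^sub>M lborel)"
  proof -
    have 1: "(\<lambda>p :: (real ^ 'n) \<times> (real ^ 'n). v (fst p)) \<in> borel_measurable borel"
      by (rule measurable_compose[OF _ v]) (auto intro!: borel_measurable_continuous_onI continuous_intros)
    have 2: "(\<lambda>p :: (real ^ 'n) \<times> (real ^ 'n). w (snd p)) \<in> borel_measurable borel"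
      by (rule measurable_compose[OF _ w]) (auto intro!: borel_measurable_continuous_onI continuous_intros)
    have 3: "(\<lambda>p :: (real ^ 'n) \<times> (real ^ 'n). exp (snd p \<bullet> fst p)) \<in> borel_measurable borel"
      by (intro borel_measurable_continuous_onI continuous_intros)
    show ?thesis unfolding lborel_prod f_def case_prod_beta
      using borel_measurable_times[OF 1 borel_measurable_times[OF 2 3]] by simp
  qed
  have vA: "v x = 0" if "x \<notin> A" for x using that by (simp add: v_def)
  have fi: "integrable (lborel \<Otimes>\<^sub>M lborel) (\<lambda>(x, \<xi>). f x \<xi>)"
  proof (rule lborel_pair.Fubini_integrable[OF fm])
    have "(LINT \<xi>|lborel. norm (f x \<xi>)) = \<bar>v x\<bar> * D x" for x
    proof (cases "x \<in> A")
      case True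
      have "(LINT \<xi>|lborel. norm (f x \<xi>)) = (LINT \<xi>|lborel. \<bar>v x\<bar> * (w \<xi> * exp (\<xi> \<bullet> x)))"
        by (simp add: f_def abs_mult w0)
      then show ?thesis using kl[OF True] by simp
    qed (simp add: f_def vA)
    moreover have "integrable lborel (\<lambda>x. \<bar>v x\<bar> * D x)"
    proof (rule Bochner_Integration.integrable_bound[OF v_int])
      have "\<bar>v x\<bar> * D x \<le> \<bar>v x\<bar>" for x
        using mult_left_mono[OF D1, of x "\<bar>v x\<bar>"] vA[of x] by (cases "x \<in> A") auto
      then show "AE x in lborel. norm (\<bar>v x\<bar> * D x) \<le> norm (v x)" by (auto simp: abs_mult D_def)
    qed simp
    ultimately show "integrable lborel (\<lambda>x. LINT \<xi>|lborel. norm ((\<lambda>(x, \<xi>). f x \<xi>) (x, \<xi>)))" by simp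
    have "integrable lborel (f x)" for x
      using ki[of x] vA[of x] by (cases "x \<in> A") (auto simp: f_def[abs_def])
    then show "AE x in lborel. integrable lborel (\<lambda>\<xi>. (\<lambda>(x, \<xi>). f x \<xi>) (x, \<xi>))" by simp
  qed
  have sx: "(LINT \<xi>|lborel. f x \<xi>) = v x * D x" for x
    using kl[of x] vA[of x] by (cases "x \<in> A") (auto simp: f_def)
  have sxi: "(LINT x|lborel. f x \<xi>) = w \<xi> * exp_moment \<xi> t" for \<xi>
  proof -
    have "(LINT x|lborel. f x \<xi>) = (LINT x|lborel. w \<xi> * (v x * exp (\<xi> \<bullet> x)))"
      by (intro Bochner_Integration.integral_cong) (auto simp: f_def)
    also have "\<dots> = w \<xi> * (LINT x|lebesgue. u t x * exp (\<xi> \<bullet> x))"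
      by (subst swap) auto
    finally show ?thesis by (simp add: exp_moment_def)
  qed
  have wF: "integrable lborel (\<lambda>\<xi>. w \<xi> * exp_moment \<xi> t)"
    using lborel_pair.integrable_snd[OF fi] by (simp add: sxi)
  have U: "cone_mean R \<gamma> u t = (LINT \<xi>|lborel. w \<xi> * exp_moment \<xi> t)"
  proof -
    have "cone_mean R \<gamma> u t = (LINT x|lborel. v x * D x)"
      unfolding cone_mean_def \<tau>_def[symmetric] using swap[OF D] by (simp add: D_def)
    also have "\<dots> = (LINT x|lborel. (LINT \<xi>|lborel. f x \<xi>))" by (simp add: sx)
    also have "\<dots> = (LINT \<xi>|lborel. (LINT x|lborel. f x \<xi>))" by (rule lborel_pair.Fubini_integral[OF fi, symmetric])
    finally show ?thesis by (simp add: sxi)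
  qed
  have nn: "AE \<xi> in lborel. 0 \<le> w \<xi> * exp_moment \<xi> t"
    using AE_lborel_singleton[of "0 :: real ^ 'n"] by eventually_elim (use exp_moment_nonneg[OF t] w0 in auto)
  show "0 \<le> cone_mean R \<gamma> u t" unfolding U by (rule integral_nonneg_AE[OF nn])
  have "ennreal (cone_mean R \<gamma> u t) = (\<integral>\<^sup>+\<xi>. ennreal (w \<xi> * exp_moment \<xi> t) \<partial>lborel)"
    unfolding U by (rule nn_integral_eq_integral[OF wF nn, symmetric])
  also have "\<dots> = (\<integral>\<^sup>+\<xi>. wave_density \<gamma> \<tau> \<xi> * ennreal (exp_moment \<xi> t) \<partial>lborel)"
    using we by (intro nn_integral_cong_AE) (auto elim!: eventually_mono simp: ennreal_mult' w0)
  finally show "ennreal (cone_mean R \<gamma> u t) = (\<integral>\<^sup>+\<xi>. wave_density \<gamma> (t + R + 2) \<xi> * ennreal (exp_moment \<xi> t) \<partial>lborel)"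
    by (simp add: \<tau>_def)
qed

text \<open>For \<open>t \<ge> 1\<close> and frequencies in [1,2], \<open>sinh (l * t)\<close> is at
  least a quarter of the exponential, and division by \<open>l \<le> 2\<close> makes this an eighth.
  On the support of the data \<open>exp (\<xi> \<bullet> x) \<ge> exp (- 2 * R)\<close>, so that
  only the total masses of the data remain in the constant.\<close>

lemma exp_moment_exp_growth:
  assumes t: "t \<in> I" "1 \<le> t" and \<xi>: "1 \<le> norm \<xi>" "norm \<xi> \<le> 2"
  shows "\<epsilon> * (exp (- integral {0..} b) * exp (- 2 * R) * ((LINT x|lebesgue. w0 x) + (LINT x|lebesgue. w1 x)) / 8) * exp (norm \<xi> * t) \<le> exp_moment \<xi> t"
proof -
  define l where "l = norm \<xi>"
  have l: "1 \<le> l" "l \<le> 2" using \<xi> by (auto simp: l_def)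
  have low: "exp (- 2 * R) * (LINT x|lebesgue. w x) \<le> (LINT x|lebesgue. w x * exp (\<xi> \<bullet> x))"
    if "integrable lebesgue (\<lambda>x. w x * exp (\<xi> \<bullet> x))" "integrable lebesgue (\<lambda>x. w x)"
      "AE x in lebesgue. 0 \<le> w x" "AE x in lebesgue. R < norm x \<longrightarrow> w x = 0" for w
  proof -
    have "(LINT x|lebesgue. exp (- 2 * R) * w x) \<le> (LINT x|lebesgue. w x * exp (\<xi> \<bullet> x))"
    proof (rule integral_mono_AE)
      show "AE x in lebesgue. exp (- 2 * R) * w x \<le> w x * exp (\<xi> \<bullet> x)"
        using that(3,4)
      proof eventually_elim
        case (elim x)
        show ?case
        proof (cases "norm x \<le> R")
          case True
          have "\<bar>\<xi> \<bullet> x\<bar> \<le> norm \<xi> * norm x" by (rule Cauchy_Schwarz_ineq2)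
          also have "\<dots> \<le> 2 * R" using True \<xi> by (intro mult_mono) auto
          finally have "exp (- 2 * R) \<le> exp (\<xi> \<bullet> x)" by auto
          then show ?thesis using elim by (subst mult.commute) (intro mult_left_mono)
        qed (use elim in auto)
      qed
    qed (use that in auto)
    then show ?thesis by simp
  qed
  have w_int: "integrable lebesgue (\<lambda>x. w0 x)" "integrable lebesgue (\<lambda>x. w1 x)"
    using data_integrable[of 0] by auto
  have D: "exp (- 2 * R) * (LINT x|lebesgue. w0 x) \<le> D0 \<xi>" "exp (- 2 * R) * (LINT x|lebesgue. w1 x) \<le> D1 \<xi>"
    unfolding D0_def D1_def by (intro low data_integrable w_int w_nonneg w_supp)+
  have s: "exp (l * t) / 4 \<le> sinh (l * t)"
  proof -
    have lt: "1 \<le> l * t" using mult_mono[of 1 l 1 t] l t by simp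
    have "exp (- (l * t)) \<le> exp (l * t) / 2"
    proof -
      have "2 \<le> exp (1::real)" using exp_ge_add_one_self[of 1] by simp
      also have "\<dots> \<le> exp (l * t + l * t)" using lt by (subst exp_le_cancel_iff) linarith
      finally have "2 * exp (- (l * t)) \<le> exp (l * t + l * t) * exp (- (l * t))" by (intro mult_right_mono) auto
      also have "\<dots> = exp (l * t)" unfolding exp_add[symmetric] by simp
      finally show ?thesis by simp
    qed
    then show ?thesis by (simp add: sinh_field_def)
  qed
  have sl: "exp (l * t) / 8 \<le> sinh (l * t) / l"
  proof -
    have "exp (l * t) / 8 = (exp (l * t) / 4) / 2" by simp
    also have "\<dots> \<le> sinh (l * t) / l" using s l t by (intro frac_le) auto
    finally show ?thesis .
  qed
  have D0l: "D0 \<xi> \<le> l * D0 \<xi>" using mult_right_mono[of 1 l "D0 \<xi>"] l D_nonneg[of \<xi>] by simp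
  have "exp (- B) * (\<epsilon> * (exp (- 2 * R) * ((LINT x|lebesgue. w0 x) + (LINT x|lebesgue. w1 x))) * (exp (l * t) / 8))
     \<le> exp (- B) * (\<epsilon> * (D1 \<xi> + l * D0 \<xi>) * (sinh (l * t) / l))"
    using D D0l sl eps_pos D_nonneg[of \<xi>] l
    by (intro mult_left_mono mult_mono) (auto simp: distrib_left)
  moreover have "0 \<le> exp (- l * t) * (\<epsilon> * D0 \<xi>)" using D_nonneg[of \<xi>] eps_pos by simp
  moreover have "\<xi> \<noteq> 0" using \<xi> by auto
  ultimately have "exp (- B) * (\<epsilon> * (exp (- 2 * R) * ((LINT x|lebesgue. w0 x) + (LINT x|lebesgue. w1 x))) * (exp (l * t) / 8)) \<le> exp_moment \<xi> t"
    using exp_moment_data[OF t(1), of \<xi>] unfolding l_def[symmetric] by linarith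
  then show ?thesis unfolding B_def l_def[symmetric] by (simp add: mult_ac)
qed

lemma data_pos: "0 < (LINT x|lebesgue. w0 x) + (LINT x|lebesgue. w1 x)"
  using D_pos[of 0] by (simp add: D0_def D1_def)

text \<open>The kernel bound \<open>ker\<close> is uniform in \<open>x\<close>, so the source enters
  only through its spatial integral, bounded below by \<open>ell\<close>. The chain starts from the
  time integral, replaces the kernel by a superposition of exponentials, exchanges the integrals and
  recognises the source bound for each moment.\<close>

lemma cone_mean_source:
  fixes \<gamma> C :: real and ell :: "real \<Rightarrow> real"
  defines "N \<equiv> (real CARD('n) - 1) / 2"
  assumes \<gamma>: "0 < \<gamma>" and C: "0 \<le> C"
    and ker: "\<And>\<tau> s' (x::real ^ 'n). 0 < s' \<Longrightarrow> s' \<le> \<tau> \<Longrightarrow>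
      ennreal (C * (\<tau> powr (N - 1 - \<gamma>) * (\<tau> - s') * s' powr (1 - N - \<gamma>)))
      \<le> (\<integral>\<^sup>+\<xi>. wave_density \<gamma> \<tau> \<xi> * ennreal (sinh (norm \<xi> * (\<tau> - s')) / norm \<xi> * exp (\<xi> \<bullet> x)) \<partial>lborel)"
    and t: "t \<in> I"
    and ell: "AE s in lebesgue. s \<in> {0..t} \<longrightarrow> ennreal (ell s) \<le> (\<integral>\<^sup>+x. ennreal (g s x) \<partial>lebesgue)"
  shows "(\<integral>\<^sup>+s. ennreal (indicator {0..t} s * (exp (- integral {0..} b) * C * (t + R + 2) powr (N - 1 - \<gamma>)) * ((t - s) * (s + R + 2) powr (1 - N - \<gamma>)) * ell s) \<partial>lborel)
     \<le> ennreal (cone_mean R \<gamma> u t)"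
proof -
  define \<tau> where "\<tau> = t + R + 2"
  define k where "k s = indicator {0..t} s * (exp (- B) * C * \<tau> powr (N - 1 - \<gamma>)) * ((t - s) * (s + R + 2) powr (1 - N - \<gamma>))" for s
  have t0: "0 \<le> t" by (rule I_nonneg[OF t])
  have k0: "0 \<le> k s" for s using C t0 by (auto simp: k_def indicator_def)
  have km[measurable]: "k \<in> borel_measurable borel" unfolding k_def by measurable
  define h where "h \<xi> z = indicator {0..t} (fst z) * (sinh (norm \<xi> * (t - fst z)) / norm \<xi>) * source_rep z * exp (\<xi> \<bullet> snd z)"
    for \<xi> :: "real ^ 'n" and z :: "real \<times> (real ^ 'n)"
  have hm: "(\<lambda>p. ennreal (h (fst p) (snd p))) \<in> borel_measurable borel"
  proof -
    have 1: "(\<lambda>p :: (real ^ 'n) \<times> real \<times> (real ^ 'n). indicator {0..t} (fst (snd p)) :: real) \<in> borel_measurable borel"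
      by (rule measurable_compose[of "\<lambda>p. fst (snd p)" _ borel]) (auto intro!: borel_measurable_continuous_onI continuous_intros)
    have 2: "(\<lambda>p :: (real ^ 'n) \<times> real \<times> (real ^ 'n). sinh (norm (fst p) * (t - fst (snd p)))) \<in> borel_measurable borel"
      by (intro borel_measurable_continuous_onI continuous_intros)
    have 3: "(\<lambda>p :: (real ^ 'n) \<times> real \<times> (real ^ 'n). norm (fst p)) \<in> borel_measurable borel"
      by (intro borel_measurable_continuous_onI continuous_intros)
    have 4: "(\<lambda>p :: (real ^ 'n) \<times> real \<times> (real ^ 'n). source_rep (snd p)) \<in> borel_measurable borel"
      by (rule measurable_compose[OF _ source_rep_measurable]) (auto intro!: borel_measurable_continuous_onI continuous_intros)
    have 5: "(\<lambda>p :: (real ^ 'n) \<times> real \<times> (real ^ 'n). exp (fst p \<bullet> snd (snd p))) \<in> borel_measurable borel"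
      by (intro borel_measurable_continuous_onI continuous_intros)
    show ?thesis unfolding h_def
      by (intro measurable_compose[OF _ measurable_ennreal] borel_measurable_times borel_measurable_divide 1 2 3 4 5)
  qed
  have hm1: "(\<lambda>z. ennreal (h \<xi> z)) \<in> borel_measurable borel" for \<xi>
    by (rule measurable_compose[of "\<lambda>z. (\<xi>, z)" _ borel "\<lambda>p. ennreal (h (fst p) (snd p))", simplified, OF _ hm])
       (auto intro!: borel_measurable_continuous_onI continuous_intros)
  have hm2: "(\<lambda>\<xi>. ennreal (h \<xi> z)) \<in> borel_measurable borel" for z
    by (rule measurable_compose[of "\<lambda>\<xi>. (\<xi>, z)" _ borel "\<lambda>p. ennreal (h (fst p) (snd p))", simplified, OF _ hm])
       (auto intro!: borel_measurable_continuous_onI continuous_intros)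
  have ga: "AE s in lborel. AE x in lborel. s \<in> I \<longrightarrow> source_rep (s, x) = g s x"
    using AE_lebesgue_pair[OF source_rep_AE] by (simp add: AE_completion_iff)
  have gbs: "(\<lambda>x. source_rep (s, x)) \<in> borel_measurable borel" for s
    by (rule measurable_compose[OF _ source_rep_measurable]) (auto intro!: borel_measurable_continuous_onI continuous_intros)
  have gbn: "AE s in lborel. s \<in> {0..t} \<longrightarrow> ennreal (ell s) \<le> (\<integral>\<^sup>+x. ennreal (source_rep (s, x)) \<partial>lborel)"
    using ga AE_completion_iff[THEN iffD1, OF ell]
  proof eventually_elim
    case (elim s)
    show ?case
    proof
      assume s: "s \<in> {0..t}"
      then have sI: "s \<in> I" using Icc_I[OF t] by auto
      have "AE x in lebesgue. source_rep (s, x) = g s x" using elim(1) sI by (auto intro: AE_completion)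
      then have "(\<integral>\<^sup>+x. ennreal (g s x) \<partial>lebesgue) = (\<integral>\<^sup>+x. ennreal (source_rep (s, x)) \<partial>lebesgue)"
        by (intro nn_integral_cong_AE) (auto elim: eventually_mono)
      also have "\<dots> = (\<integral>\<^sup>+x. ennreal (source_rep (s, x)) \<partial>lborel)" by (rule nn_integral_completion)
      finally show "ennreal (ell s) \<le> (\<integral>\<^sup>+x. ennreal (source_rep (s, x)) \<partial>lborel)" using elim(2) s by simp
    qed
  qed
  have kgb: "(\<lambda>z. ennreal (k (fst z) * source_rep z)) \<in> borel_measurable (lborel \<Otimes>\<^sub>M lborel)"
  proof -
    have "(\<lambda>z :: real \<times> (real ^ 'n). k (fst z)) \<in> borel_measurable borel"
      by (rule measurable_compose[OF _ km]) (auto intro!: borel_measurable_continuous_onI continuous_intros)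
    from measurable_compose[OF borel_measurable_times[OF this source_rep_measurable] measurable_ennreal]
    show ?thesis unfolding lborel_prod by simp
  qed
  have "(\<integral>\<^sup>+s. ennreal (k s * ell s) \<partial>lborel) \<le> (\<integral>\<^sup>+s. ennreal (k s) * (\<integral>\<^sup>+x. ennreal (source_rep (s, x)) \<partial>lborel) \<partial>lborel)"
  proof (rule nn_integral_mono_AE)
    show "AE s in lborel. ennreal (k s * ell s) \<le> ennreal (k s) * (\<integral>\<^sup>+x. ennreal (source_rep (s, x)) \<partial>lborel)"
      using gbn
    proof eventually_elim
      case (elim s)
      show ?case
      proof (cases "s \<in> {0..t}")
        case True
        then show ?thesis using elim k0[of s] by (auto simp: ennreal_mult' intro: mult_left_mono)
      qed (simp add: k_def)
    qed
  qed
  also have "\<dots> = (\<integral>\<^sup>+s. (\<integral>\<^sup>+x. ennreal (k (fst (s, x)) * source_rep (s, x)) \<partial>lborel) \<partial>lborel)"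
    using gbs k0 by (intro nn_integral_cong) (simp add: ennreal_mult' nn_integral_cmult)
  also have "\<dots> = (\<integral>\<^sup>+z. ennreal (k (fst z) * source_rep z) \<partial>lborel)"
    using lborel.nn_integral_fst[OF kgb] unfolding lborel_prod .
  also have "\<dots> \<le> (\<integral>\<^sup>+z. (\<integral>\<^sup>+\<xi>. ennreal (exp (- B)) * (wave_density \<gamma> \<tau> \<xi> * ennreal (h \<xi> z)) \<partial>lborel) \<partial>lborel)"
  proof (rule nn_integral_mono)
    fix z :: "real \<times> (real ^ 'n)"
    obtain s x where z: "z = (s, x)" by (cases z)
    show "ennreal (k (fst z) * source_rep z) \<le> (\<integral>\<^sup>+\<xi>. ennreal (exp (- B)) * (wave_density \<gamma> \<tau> \<xi> * ennreal (h \<xi> z)) \<partial>lborel)"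
    proof (cases "s \<in> {0..t}")
      case True
      have s': "0 < s + R + 2" "s + R + 2 \<le> \<tau>" using True R_pos by (auto simp: \<tau>_def)
      have "ennreal (k (fst z) * source_rep z) = ennreal (exp (- B) * source_rep z) * ennreal (C * (\<tau> powr (N - 1 - \<gamma>) * (\<tau> - (s + R + 2)) * (s + R + 2) powr (1 - N - \<gamma>)))"
        using True source_rep_nonneg[of z] by (subst ennreal_mult'[symmetric]) (auto simp: k_def z \<tau>_def mult_ac)
      also have "\<dots> \<le> ennreal (exp (- B) * source_rep z) * (\<integral>\<^sup>+\<xi>. wave_density \<gamma> \<tau> \<xi> * ennreal (sinh (norm \<xi> * (\<tau> - (s + R + 2))) / norm \<xi> * exp (\<xi> \<bullet> x)) \<partial>lborel)"
        by (intro mult_left_mono ker s') auto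
      also have "\<dots> = (\<integral>\<^sup>+\<xi>. ennreal (exp (- B) * source_rep z) * (wave_density \<gamma> \<tau> \<xi> * ennreal (sinh (norm \<xi> * (\<tau> - (s + R + 2))) / norm \<xi> * exp (\<xi> \<bullet> x))) \<partial>lborel)"
      proof (rule nn_integral_cmult[symmetric])
        have "(\<lambda>\<xi> :: real ^ 'n. sinh (norm \<xi> * (\<tau> - (s + R + 2)))) \<in> borel_measurable borel"
          "(\<lambda>\<xi> :: real ^ 'n. norm \<xi>) \<in> borel_measurable borel" "(\<lambda>\<xi> :: real ^ 'n. exp (\<xi> \<bullet> x)) \<in> borel_measurable borel"
          by (intro borel_measurable_continuous_onI continuous_intros)+
        then have "(\<lambda>\<xi> :: real ^ 'n. wave_density \<gamma> \<tau> \<xi> * ennreal (sinh (norm \<xi> * (\<tau> - (s + R + 2))) / norm \<xi> * exp (\<xi> \<bullet> x))) \<in> borel_measurable borel"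
          by (intro borel_measurable_times_ennreal wave_density_measurable measurable_compose[OF _ measurable_ennreal]
              borel_measurable_times borel_measurable_divide)
        then show "(\<lambda>\<xi> :: real ^ 'n. wave_density \<gamma> \<tau> \<xi> * ennreal (sinh (norm \<xi> * (\<tau> - (s + R + 2))) / norm \<xi> * exp (\<xi> \<bullet> x))) \<in> borel_measurable lborel"
          by simp
      qed
      also have "\<dots> = (\<integral>\<^sup>+\<xi>. ennreal (exp (- B)) * (wave_density \<gamma> \<tau> \<xi> * ennreal (h \<xi> z)) \<partial>lborel)"
      proof (rule nn_integral_cong)
        fix \<xi> :: "real ^ 'n"
        have "h \<xi> z = source_rep z * (sinh (norm \<xi> * (\<tau> - (s + R + 2))) / norm \<xi> * exp (\<xi> \<bullet> x))"
          using True by (simp add: h_def z \<tau>_def)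
        then show "ennreal (exp (- B) * source_rep z) * (wave_density \<gamma> \<tau> \<xi> * ennreal (sinh (norm \<xi> * (\<tau> - (s + R + 2))) / norm \<xi> * exp (\<xi> \<bullet> x)))
          = ennreal (exp (- B)) * (wave_density \<gamma> \<tau> \<xi> * ennreal (h \<xi> z))"
          using source_rep_nonneg[of z] by (simp only: ennreal_mult' ennreal_mult'[OF source_rep_nonneg] ennreal_mult'[OF exp_ge_zero] mult_ac)
      qed
      finally show ?thesis .
    qed (simp add: k_def z)
  qed
  also have "\<dots> = (\<integral>\<^sup>+\<xi>. (\<integral>\<^sup>+z. ennreal (exp (- B)) * (wave_density \<gamma> \<tau> \<xi> * ennreal (h \<xi> z)) \<partial>lborel) \<partial>lborel)"
  proof (rule lborel_pair.Fubini')
    have "(\<lambda>p :: (real ^ 'n) \<times> real \<times> (real ^ 'n). wave_density \<gamma> \<tau> (fst p)) \<in> borel_measurable borel"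
      by (rule measurable_compose[OF _ wave_density_measurable]) (auto intro!: borel_measurable_continuous_onI continuous_intros)
    from borel_measurable_times_ennreal[OF borel_measurable_const borel_measurable_times_ennreal[OF this hm]]
    show "(\<lambda>(\<xi>, z). ennreal (exp (- B)) * (wave_density \<gamma> \<tau> \<xi> * ennreal (h \<xi> z))) \<in> borel_measurable (lborel \<Otimes>\<^sub>M lborel)"
      unfolding lborel_prod case_prod_beta by simp
  qed
  also have "\<dots> = (\<integral>\<^sup>+\<xi>. wave_density \<gamma> \<tau> \<xi> * (ennreal (exp (- B)) * (\<integral>\<^sup>+z. ennreal (h \<xi> z) \<partial>lborel)) \<partial>lborel)"
  proof (rule nn_integral_cong)
    fix \<xi> :: "real ^ 'n"
    have "(\<integral>\<^sup>+z. ennreal (exp (- B)) * (wave_density \<gamma> \<tau> \<xi> * ennreal (h \<xi> z)) \<partial>lborel) =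
       (\<integral>\<^sup>+z. (ennreal (exp (- B)) * wave_density \<gamma> \<tau> \<xi>) * ennreal (h \<xi> z) \<partial>lborel)" by (simp only: mult.assoc)
    also have "\<dots> = (ennreal (exp (- B)) * wave_density \<gamma> \<tau> \<xi>) * (\<integral>\<^sup>+z. ennreal (h \<xi> z) \<partial>lborel)"
      using hm1 by (intro nn_integral_cmult) simp
    finally show "(\<integral>\<^sup>+z. ennreal (exp (- B)) * (wave_density \<gamma> \<tau> \<xi> * ennreal (h \<xi> z)) \<partial>lborel) =
       wave_density \<gamma> \<tau> \<xi> * (ennreal (exp (- B)) * (\<integral>\<^sup>+z. ennreal (h \<xi> z) \<partial>lborel))" by (simp only: mult_ac)
  qed
  \<comment> \<open>The scalar estimate is applied at every frequency except
    \<open>\<xi> = 0\<close>, a null set.\<close>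
  also have "\<dots> \<le> (\<integral>\<^sup>+\<xi>. wave_density \<gamma> \<tau> \<xi> * ennreal (exp_moment \<xi> t) \<partial>lborel)"
  proof (rule nn_integral_mono_AE)
    show "AE \<xi> in lborel. wave_density \<gamma> \<tau> \<xi> * (ennreal (exp (- B)) * (\<integral>\<^sup>+z. ennreal (h \<xi> z) \<partial>lborel)) \<le> wave_density \<gamma> \<tau> \<xi> * ennreal (exp_moment \<xi> t)"
      using AE_lborel_singleton[of "0 :: real ^ 'n"]
      by eventually_elim (unfold h_def, intro mult_left_mono exp_moment_source[OF t], auto)
  qed
  also have "\<dots> = ennreal (cone_mean R \<gamma> u t)" using cone_mean_eq[OF t \<gamma>] by (simp add: \<tau>_def)
  finally show ?thesis by (simp add: k_def B_def \<tau>_def mult.assoc)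
qed

end

section \<open>Weights on balls\<close>

text \<open>Polar coordinates for radial integrands. The law of \<open>norm\<close> under Lebesgue
  measure on the ball is determined by the masses of the half-lines \<open>{y<..}\<close>, and these
  are differences of ball volumes; no surface measure is involved.\<close>

lemma nn_integral_norm_cball:
  fixes g :: "real \<Rightarrow> ennreal"
  assumes [measurable]: "g \<in> borel_measurable borel" and r: "0 \<le> r"
  defines "n \<equiv> DIM('a::euclidean_space)"
  shows "(\<integral>\<^sup>+x\<in>cball (0::'a) r. g (norm x) \<partial>lborel)
     = (\<integral>\<^sup>+y\<in>{0..r}. g y * ennreal (n * unit_ball_vol n * y ^ (n - 1)) \<partial>lborel)"
proof -
  have n: "n > 0" by (simp add: n_def)
  define M where "M = distr (density lborel (indicator (cball (0::'a) r))) borel (norm :: 'a \<Rightarrow> real)"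
  define N where "N = density lborel (\<lambda>y. ennreal (n * unit_ball_vol n * y ^ (n - 1)) * indicator {0..r} y)"
  have eM: "emeasure M {y<..} = ennreal (unit_ball_vol n * (r ^ n - (max 0 y) ^ n))" if "y \<le> r" for y
  proof -
    have "emeasure M {y<..} = emeasure lborel (cball (0::'a) r \<inter> (norm -` {y<..}))"
    proof -
      have m: "norm -` {y<..} \<in> sets (borel :: 'a measure)"
        by (intro borel_open open_vimage) (auto intro: continuous_intros)
      have "emeasure M {y<..} = emeasure (density lborel (indicator (cball (0::'a) r))) (norm -` {y<..})"
        unfolding M_def by (subst emeasure_distr) auto
      also have "\<dots> = (\<integral>\<^sup>+x. indicator (cball (0::'a) r \<inter> norm -` {y<..}) x \<partial>lborel)"
      proof (subst emeasure_density)
        show "indicator (cball (0::'a) r) \<in> borel_measurable (lborel :: 'a measure)"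
          by (intro borel_measurable_indicator) simp
        show "(\<integral>\<^sup>+x\<in>norm -` {y<..}. indicator (cball (0::'a) r) x \<partial>lborel)
            = (\<integral>\<^sup>+x. indicator (cball (0::'a) r \<inter> norm -` {y<..}) x \<partial>lborel)"
          by (intro nn_integral_cong) (simp add: indicator_inter_arith)
      qed (use m in auto)
      also have "\<dots> = emeasure lborel (cball (0::'a) r \<inter> norm -` {y<..})"
        using m by (intro nn_integral_indicator) auto
      finally show ?thesis .
    qed
    also have "cball (0::'a) r \<inter> (norm -` {y<..}) = cball 0 r - cball 0 y" by auto
    also have "emeasure lborel \<dots> = emeasure lborel (cball (0::'a) r) - emeasure lborel (cball (0::'a) y)"
    proof (rule emeasure_Diff)
      show "emeasure lborel (cball (0::'a) y) \<noteq> \<infinity>"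
        using emeasure_lborel_cball_finite[of "0::'a" y] by simp
      show "cball (0::'a) y \<subseteq> cball 0 r" using that by auto
    qed auto
    also have "emeasure lborel (cball (0::'a) y) = ennreal (unit_ball_vol n * (max 0 y) ^ n)"
      using n by (cases "y \<ge> 0") (auto simp: emeasure_cball n_def max_def)
    also have "emeasure lborel (cball (0::'a) r) = ennreal (unit_ball_vol n * r ^ n)"
      using r by (simp add: emeasure_cball n_def)
    finally show ?thesis using r by (simp add: ennreal_minus right_diff_distrib)
  qed
  have eN: "emeasure N {y<..} = ennreal (unit_ball_vol n * (r ^ n - (max 0 y) ^ n))" if "y \<le> r" for y
  proof -
    have "emeasure N {y<..} = (\<integral>\<^sup>+z. ennreal (n * unit_ball_vol n * z ^ (n - 1)) * indicator {max 0 y..r} z \<partial>lborel)"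
      unfolding N_def using AE_lborel_singleton[of y]
      by (subst emeasure_density) (auto intro!: nn_integral_cong_AE split: split_indicator)
    also have "\<dots> = ennreal (unit_ball_vol n * r ^ n - unit_ball_vol n * (max 0 y) ^ n)"
      using r that n by (intro nn_integral_FTC_Icc) (auto intro!: derivative_eq_intros)
    finally show ?thesis by (simp add: right_diff_distrib)
  qed
  have out: "emeasure M {y<..} = 0" "emeasure N {y<..} = 0" if "y > r" for y
  proof -
    have "emeasure M {y<..} \<le> emeasure M {r<..}" "emeasure N {y<..} \<le> emeasure N {r<..}"
      using that by (auto intro!: emeasure_mono simp: M_def N_def)
    then show "emeasure M {y<..} = 0" "emeasure N {y<..} = 0" using eM[of r] eN[of r] r by (auto simp: max_def)
  qed
  have "M = N"
  proof (rule measure_eqI_lessThan)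
    show "emeasure M {x<..} = emeasure N {x<..}" for x using eM eN out by (cases "x \<le> r") auto
    show "emeasure M {x<..} < \<infinity>" for x using eM out by (cases "x \<le> r") auto
  qed (auto simp: M_def N_def)
  have "(\<integral>\<^sup>+x\<in>cball (0::'a) r. g (norm x) \<partial>lborel) = (\<integral>\<^sup>+y. g y \<partial>M)"
    unfolding M_def
    by (subst nn_integral_distr, simp, simp, subst nn_integral_density) (auto intro!: nn_integral_cong borel_measurable_indicator simp: mult.commute)
  also have "\<dots> = (\<integral>\<^sup>+y\<in>{0..r}. g y * ennreal (n * unit_ball_vol n * y ^ (n - 1)) \<partial>lborel)"
    unfolding \<open>M = N\<close> N_def by (subst nn_integral_density) (auto intro!: nn_integral_cong simp: ac_simps)
  finally show ?thesis .
qed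

text \<open>Order of growth of the integral of \<open>(\<tau> - y) powr - \<theta>\<close> over
  \<open>0 \<le> y \<le> \<tau> - 1\<close>. The middle case is the source of the logarithm in the
  critical iteration.\<close>

definition radial_factor :: "real \<Rightarrow> real \<Rightarrow> real" where
  "radial_factor \<theta> \<tau> = (if \<theta> < 1 then \<tau> powr (1 - \<theta>) else if \<theta> = 1 then ln \<tau> else 1)"

lemma nn_integral_cone_distance:
  assumes r: "0 \<le> r" "r + 1 \<le> \<tau>"
  shows "(\<integral>\<^sup>+y\<in>{0..r}. ennreal ((\<tau> - y) powr - \<theta>) \<partial>lborel)
     \<le> ennreal ((if \<theta> = 1 then 1 else 1 / \<bar>1 - \<theta>\<bar>) * radial_factor \<theta> \<tau>)"
proof (cases "\<theta> = 1")
  case True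
  have "(\<integral>\<^sup>+y\<in>{0..r}. ennreal ((\<tau> - y) powr - \<theta>) \<partial>lborel) = ennreal (- ln (\<tau> - r) - - ln (\<tau> - 0))"
    using r True
    by (intro nn_integral_FTC_Icc) (auto intro!: derivative_eq_intros simp: powr_minus divide_simps)
  also have "\<dots> \<le> ennreal (ln \<tau>)" using r by (intro ennreal_leI) auto
  finally show ?thesis using True by (simp add: radial_factor_def)
next
  case False
  have "(\<integral>\<^sup>+y\<in>{0..r}. ennreal ((\<tau> - y) powr - \<theta>) \<partial>lborel)
     = ennreal (- ((\<tau> - r) powr (1 - \<theta>) / (1 - \<theta>)) - - ((\<tau> - 0) powr (1 - \<theta>) / (1 - \<theta>)))"
  proof (rule nn_integral_FTC_Icc)
    fix x assume that: "x \<in> {0..r}"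
    show "((\<lambda>y. - ((\<tau> - y) powr (1 - \<theta>) / (1 - \<theta>))) has_real_derivative (\<tau> - x) powr - \<theta>) (at x)"
    proof -
      have "((\<lambda>y. (\<tau> - y) powr (1 - \<theta>)) has_real_derivative ((1 - \<theta>) * (\<tau> - x) powr (1 - \<theta> - 1)) * (- 1)) (at x)"
        by (rule DERIV_chain2[OF has_real_derivative_powr]) (use r that in \<open>auto intro!: derivative_eq_intros\<close>)
      from DERIV_minus[OF DERIV_cdivide[OF this, of "1 - \<theta>"]] show ?thesis using False by simp
    qed
  qed (use r in auto)
  also have "\<dots> \<le> ennreal (1 / \<bar>1 - \<theta>\<bar> * radial_factor \<theta> \<tau>)"
  proof (intro ennreal_leI)
    show "- ((\<tau> - r) powr (1 - \<theta>) / (1 - \<theta>)) - - ((\<tau> - 0) powr (1 - \<theta>) / (1 - \<theta>)) \<le> 1 / \<bar>1 - \<theta>\<bar> * radial_factor \<theta> \<tau>"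
    proof (cases "\<theta> < 1")
      case True
      then show ?thesis by (simp add: radial_factor_def)
    next
      case F: False
      have "(\<tau> - r) powr (1 - \<theta>) \<le> 1 powr (1 - \<theta>)" using F r by (intro powr_mono2') auto
      moreover have "0 \<le> \<tau> powr (1 - \<theta>)" by simp
      moreover have "- (A / (1 - \<theta>)) - - (B / (1 - \<theta>)) = (A - B) / (\<theta> - 1)" for A B
        using False by (simp add: divide_simps) (simp add: algebra_simps)
      ultimately show ?thesis using F False
        by (simp add: radial_factor_def del: minus_divide_left) (intro divide_right_mono, use powr_ge_zero[of \<tau> "1 - \<theta>"] in linarith, simp)
    qed
  qed
  finally show ?thesis using False by simp
qed

text \<open>In \<open>\<tau>^2 - y^2 = (\<tau> - y) (\<tau> + y)\<close> only the first factor can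
  degenerate. The second is at least \<tau> and gives the power
  \<open>\<tau> powr - \<theta>\<close>, and the volume element contributes at most
  \<open>\<tau> ^ (n - 1)\<close>, leaving a one-dimensional integral.\<close>

lemma nn_integral_cone_weight:
  assumes th: "0 < \<theta>"
  shows "\<exists>C>0. \<forall>r \<tau>. 0 \<le> r \<longrightarrow> r + 1 \<le> \<tau> \<longrightarrow>
    (\<integral>\<^sup>+x\<in>cball (0::'a::euclidean_space) r. ennreal ((\<tau>\<^sup>2 - (norm x)\<^sup>2) powr - \<theta>) \<partial>lborel)
      \<le> ennreal (C * \<tau> powr (real DIM('a) - 1 - \<theta>) * radial_factor \<theta> \<tau>)"
proof -
  let ?n = "DIM('a)"
  define c where "c = (if \<theta> = 1 then 1 else 1 / \<bar>1 - \<theta>\<bar>)"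
  have c: "c > 0" by (auto simp: c_def)
  define C where "C = c * (?n * unit_ball_vol ?n)"
  have "C > 0" using c by (auto simp: C_def intro!: mult_pos_pos)
  moreover have "(\<integral>\<^sup>+x\<in>cball (0::'a) r. ennreal ((\<tau>\<^sup>2 - (norm x)\<^sup>2) powr - \<theta>) \<partial>lborel)
      \<le> ennreal (C * \<tau> powr (real ?n - 1 - \<theta>) * radial_factor \<theta> \<tau>)" if r: "0 \<le> r" "r + 1 \<le> \<tau>" for r \<tau>
  proof -
    have "(\<integral>\<^sup>+x\<in>cball (0::'a) r. ennreal ((\<tau>\<^sup>2 - (norm x)\<^sup>2) powr - \<theta>) \<partial>lborel)
      = (\<integral>\<^sup>+y\<in>{0..r}. ennreal ((\<tau>\<^sup>2 - y\<^sup>2) powr - \<theta>) * ennreal (?n * unit_ball_vol ?n * y ^ (?n - 1)) \<partial>lborel)"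
      using r by (intro nn_integral_norm_cball) auto
    also have "\<dots> \<le> (\<integral>\<^sup>+y. ennreal (\<tau> powr - \<theta> * (?n * unit_ball_vol ?n * \<tau> ^ (?n - 1))) * (ennreal ((\<tau> - y) powr - \<theta>) * indicator {0..r} y) \<partial>lborel)"
    proof (intro nn_integral_mono)
      fix y
      show "ennreal ((\<tau>\<^sup>2 - y\<^sup>2) powr - \<theta>) * ennreal (?n * unit_ball_vol ?n * y ^ (?n - 1)) * indicator {0..r} y
        \<le> ennreal (\<tau> powr - \<theta> * (?n * unit_ball_vol ?n * \<tau> ^ (?n - 1))) * (ennreal ((\<tau> - y) powr - \<theta>) * indicator {0..r} y)"
      proof (cases "y \<in> {0..r}")
        case True
        have "\<tau> * (\<tau> - y) \<le> \<tau>\<^sup>2 - y\<^sup>2"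
          using True r by (simp add: power2_eq_square algebra_simps mult_right_mono mult_left_mono)
        then have "(\<tau>\<^sup>2 - y\<^sup>2) powr - \<theta> \<le> (\<tau> * (\<tau> - y)) powr - \<theta>"
          using True r th by (intro powr_mono2') auto
        also have "\<dots> = \<tau> powr - \<theta> * (\<tau> - y) powr - \<theta>" using True r by (simp add: powr_mult)
        finally have "(\<tau>\<^sup>2 - y\<^sup>2) powr - \<theta> * (?n * unit_ball_vol ?n * y ^ (?n - 1))
          \<le> (\<tau> powr - \<theta> * (\<tau> - y) powr - \<theta>) * (?n * unit_ball_vol ?n * \<tau> ^ (?n - 1))"
          using True r by (intro mult_mono power_mono) auto
        then show ?thesis using True r
          by (simp add: ennreal_mult'[symmetric] ennreal_mult''[symmetric] mult_ac)
      qed auto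
    qed
    also have "\<dots> = ennreal (\<tau> powr - \<theta> * (?n * unit_ball_vol ?n * \<tau> ^ (?n - 1))) * (\<integral>\<^sup>+y\<in>{0..r}. ennreal ((\<tau> - y) powr - \<theta>) \<partial>lborel)"
      by (intro nn_integral_cmult) auto
    also have "\<dots> \<le> ennreal (\<tau> powr - \<theta> * (?n * unit_ball_vol ?n * \<tau> ^ (?n - 1))) * ennreal (c * radial_factor \<theta> \<tau>)"
      unfolding c_def by (intro mult_left_mono nn_integral_cone_distance r) auto
    also have "\<dots> = ennreal (C * (\<tau> powr - \<theta> * \<tau> ^ (?n - 1)) * radial_factor \<theta> \<tau>)"
      using r c by (subst ennreal_mult[symmetric]) (auto simp: C_def mult_ac radial_factor_def)
    also have "\<tau> ^ (?n - 1) = \<tau> powr (real ?n - 1)"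
      using r by (simp add: powr_realpow[symmetric] of_nat_diff Suc_le_eq)
    also have "\<tau> powr - \<theta> * \<tau> powr (real ?n - 1) = \<tau> powr (real ?n - 1 - \<theta>)"
      using r by (simp add: powr_add[symmetric])
    finally show ?thesis .
  qed
  ultimately show ?thesis by blast
qed

section \<open>Bounds for cone means with constants independent of the solution\<close>

lemma cone_mean_data_bound:
  fixes b :: "real \<Rightarrow> real" and w0 w1 :: "real ^ 'n \<Rightarrow> real" and \<gamma> R :: real
  defines "N \<equiv> (real CARD('n) - 1) / 2"
  assumes \<gamma>: "0 < \<gamma>"
  shows "\<exists>c>0. \<forall>\<epsilon> T u ut g t. damped_wave b R \<epsilon> w0 w1 T u ut g \<longrightarrow> t \<in> time_interval T \<longrightarrow> 1 \<le> t \<longrightarrow>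
     c * \<epsilon> * (t + R + 2) powr (N - \<gamma>) \<le> cone_mean R \<gamma> u t"
proof -
  obtain C where C: "C > 0" and wd: "\<And>t \<rho> K f. 1 \<le> t + \<rho> \<Longrightarrow> 0 \<le> \<rho> \<Longrightarrow> 0 \<le> K \<Longrightarrow>
     (\<And>\<xi>::real ^ 'n. 1 \<le> norm \<xi> \<Longrightarrow> norm \<xi> \<le> 2 \<Longrightarrow> K * exp (norm \<xi> * t) \<le> f \<xi>) \<Longrightarrow>
    ennreal (C * (K * exp (- 2 * \<rho>) * (t + \<rho>) powr (N - \<gamma>))) \<le> (\<integral>\<^sup>+\<xi>. wave_density \<gamma> (t + \<rho>) \<xi> * ennreal (f \<xi>) \<partial>lborel)"
    using wave_data_lower_bound[OF \<gamma>, where 'a="real ^ 'n"] unfolding N_def by auto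
  define K0 where "K0 = exp (- integral {0..} b) * exp (- 2 * R) * ((LINT x|lebesgue. w0 x) + (LINT x|lebesgue. w1 x)) / 8"
  \<comment> \<open>\<open>K0 > 0\<close> is known only once an instance of the locale is given. The
    default 1 keeps \<open>c\<close> positive before any solution has been fixed.\<close>
  define c where "c = (if K0 > 0 then C * (K0 * exp (- 2 * (R + 2))) else 1)"
  have "c > 0" using C by (simp add: c_def)
  moreover have "c * \<epsilon> * (t + R + 2) powr (N - \<gamma>) \<le> cone_mean R \<gamma> u t"
    if dw: "damped_wave b R \<epsilon> w0 w1 T u ut g" and t: "t \<in> time_interval T" "1 \<le> t" for \<epsilon> T u ut g t
  proof -
    interpret damped_wave b R \<epsilon> w0 w1 T u ut g by fact
    have K0: "K0 > 0" using data_pos by (simp add: K0_def)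
    have "ennreal (C * ((\<epsilon> * K0) * exp (- 2 * (R + 2)) * (t + (R + 2)) powr (N - \<gamma>)))
       \<le> (\<integral>\<^sup>+\<xi>. wave_density \<gamma> (t + (R + 2)) \<xi> * ennreal (exp_moment \<xi> t) \<partial>lborel)"
      using exp_moment_exp_growth[OF t] eps_pos K0 R_pos t unfolding K0_def[symmetric]
      by (intro wd) auto
    also have "\<dots> = ennreal (cone_mean R \<gamma> u t)" using cone_mean_eq[OF t(1) \<gamma>] by (simp add: add.assoc)
    finally have "C * ((\<epsilon> * K0) * exp (- 2 * (R + 2)) * (t + (R + 2)) powr (N - \<gamma>)) \<le> cone_mean R \<gamma> u t"
      using cone_mean_nonneg[OF t(1) \<gamma>] by (subst (asm) ennreal_le_iff)
    then show ?thesis using K0 by (simp add: c_def mult_ac add.assoc)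
  qed
  ultimately show ?thesis by blast
qed

lemma cone_mean_source_bound:
  fixes b :: "real \<Rightarrow> real" and \<gamma> R :: real
  defines "N \<equiv> (real CARD('n) - 1) / 2"
  assumes \<gamma>: "0 < \<gamma>"
  shows "\<exists>c>0. \<forall>\<epsilon> (w0 :: real ^ 'n \<Rightarrow> real) w1 T u ut g t ell. damped_wave b R \<epsilon> w0 w1 T u ut g \<longrightarrow> t \<in> time_interval T \<longrightarrow>
     (AE s in lebesgue. s \<in> {0..t} \<longrightarrow> ennreal (ell s) \<le> (\<integral>\<^sup>+x. ennreal (g s x) \<partial>lebesgue)) \<longrightarrow>
     (\<integral>\<^sup>+s. ennreal (indicator {0..t} s * (c * (t + R + 2) powr (N - 1 - \<gamma>)) * ((t - s) * (s + R + 2) powr (1 - N - \<gamma>)) * ell s) \<partial>lborel)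
       \<le> ennreal (cone_mean R \<gamma> u t)"
proof -
  obtain C where C: "C > 0" and ker: "\<And>\<tau> s' (x::real ^ 'n). 0 < s' \<Longrightarrow> s' \<le> \<tau> \<Longrightarrow>
    ennreal (C * (\<tau> powr (N - 1 - \<gamma>) * (\<tau> - s') * s' powr (1 - N - \<gamma>)))
     \<le> (\<integral>\<^sup>+\<xi>. wave_density \<gamma> \<tau> \<xi> * ennreal (sinh (norm \<xi> * (\<tau> - s')) / norm \<xi> * exp (\<xi> \<bullet> x)) \<partial>lborel)"
    using wave_kernel_lower_bound[OF \<gamma>, where 'a="real ^ 'n"] unfolding N_def by auto
  have "(\<integral>\<^sup>+s. ennreal (indicator {0..t} s * (exp (- integral {0..} b) * C * (t + R + 2) powr (N - 1 - \<gamma>)) * ((t - s) * (s + R + 2) powr (1 - N - \<gamma>)) * ell s) \<partial>lborel)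
     \<le> ennreal (cone_mean R \<gamma> u t)"
    if "damped_wave b R \<epsilon> w0 w1 T u ut g" "t \<in> time_interval T"
       "AE s in lebesgue. s \<in> {0..t} \<longrightarrow> ennreal (ell s) \<le> (\<integral>\<^sup>+x. ennreal (g s x) \<partial>lebesgue)"
    for \<epsilon> T u ut g t ell and w0 w1 :: "real ^ 'n \<Rightarrow> real"
    using damped_wave.cone_mean_source[OF that(1) \<gamma> _ _ that(2,3), of C] C ker unfolding N_def by auto
  moreover have "0 < exp (- integral {0..} b) * C" using C by simp
  ultimately show ?thesis by blast
qed

text \<open>Sharp constants are irrelevant here, so it is enough to compare \<open>b\<close> with
  \<open>a powr (q - 1)\<close>: one of the two terms on the right then dominates the
  product.\<close>

lemma Young_crude:
  fixes a b q :: real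
  assumes "0 \<le> a" "0 \<le> b" "1 < q"
  shows "a * b \<le> a powr q + b powr (q / (q - 1))"
proof (cases "b \<le> a powr (q - 1)")
  case True
  then have "a * b \<le> a * a powr (q - 1)" using assms by (intro mult_left_mono)
  also have "\<dots> = a powr q" using assms by (cases "a = 0") (auto simp: powr_mult_base)
  finally show ?thesis using powr_ge_zero[of b "q / (q - 1)"] by linarith
next
  case False
  then have b: "a powr (q - 1) < b" "0 < b" using powr_ge_zero[of a "q - 1"] by linarith+
  have "a \<le> b powr (1 / (q - 1))"
  proof (rule ccontr)
    assume "\<not> ?thesis"
    then have "(b powr (1 / (q - 1))) powr (q - 1) \<le> a powr (q - 1)" using assms by (intro powr_mono2) auto
    then show False using b assms by (simp add: powr_powr)
  qed
  then have "a * b \<le> b powr (1 / (q - 1)) * b" using b by (intro mult_right_mono) auto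
  also have "\<dots> = b powr (1 / (q - 1) + 1)" using b by (simp add: powr_add)
  also have "1 / (q - 1) + 1 = q / (q - 1)" using assms by (simp add: field_simps)
  finally show ?thesis using powr_ge_zero[of a q] by linarith
qed

text \<open>A Young inequality with a free scale \<mu> takes the place of Hoelder's inequality. It
  works under the extended integral directly, and the cases of a vanishing mean or an infinite
  integral are trivial.\<close>

lemma cone_mean_Holder:
  fixes \<gamma> q :: real
  defines "\<theta> \<equiv> \<gamma> * (q / (q - 1))" and "N \<equiv> (real CARD('n::finite) - 1) / 2"
  assumes \<gamma>: "0 < \<gamma>" and q: "1 < q"
  shows "\<exists>c>0. \<forall>b R \<epsilon> (w0 :: real ^ 'n \<Rightarrow> real) w1 T u ut g t. damped_wave b R \<epsilon> w0 w1 T u ut g \<longrightarrow> t \<in> time_interval T \<longrightarrow>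
     ennreal (c * cone_mean R \<gamma> u t powr q * ((t + R + 2) powr (2 * N - \<theta>) * radial_factor \<theta> (t + R + 2)) powr - (q - 1))
       \<le> (\<integral>\<^sup>+x. ennreal (\<bar>u t x\<bar> powr q) \<partial>lebesgue)"
proof -
  have \<theta>: "0 < \<theta>" using \<gamma> q by (simp add: \<theta>_def)
  have N2: "2 * N = real CARD('n) - 1" by (simp add: N_def)
  obtain C where C: "C > 0" and cone: "\<And>r \<tau>. 0 \<le> r \<Longrightarrow> r + 1 \<le> \<tau> \<Longrightarrow>
    (\<integral>\<^sup>+x\<in>cball (0::real ^ 'n) r. ennreal ((\<tau>\<^sup>2 - (norm x)\<^sup>2) powr - \<theta>) \<partial>lborel) \<le> ennreal (C * \<tau> powr (2 * N - \<theta>) * radial_factor \<theta> \<tau>)"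
    using nn_integral_cone_weight[OF \<theta>, where 'a="real ^ 'n"] unfolding N2 by auto
  define c where "c = 2 powr - q * C powr - (q - 1)"
  have "c > 0" using C by (simp add: c_def)
  moreover have "ennreal (c * cone_mean R \<gamma> u t powr q * ((t + R + 2) powr (2 * N - \<theta>) * radial_factor \<theta> (t + R + 2)) powr - (q - 1))
       \<le> (\<integral>\<^sup>+x. ennreal (\<bar>u t x\<bar> powr q) \<partial>lebesgue)"
    if dw: "damped_wave b R \<epsilon> w0 w1 T u ut g" and t: "t \<in> time_interval T"
    for b R \<epsilon> T u ut g t and w0 w1 :: "real ^ 'n \<Rightarrow> real"
  proof -
    interpret damped_wave b R \<epsilon> w0 w1 T u ut g by fact
    define \<tau> where "\<tau> = t + R + 2"
    define U where "U = cone_mean R \<gamma> u t"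
    define E where "E = \<tau> powr (2 * N - \<theta>) * radial_factor \<theta> \<tau>"
    define A where "A = (\<integral>\<^sup>+x. ennreal (\<bar>u t x\<bar> powr q) \<partial>lebesgue)"
    define D where "D x = (\<tau>\<^sup>2 - (norm (x :: real ^ 'n))\<^sup>2) powr - \<gamma>" for x
    have t0: "0 \<le> t" by (rule I_nonneg[OF t])
    have \<tau>2: "2 < \<tau>" using t0 R_pos by (simp add: \<tau>_def)
    have E: "0 < E" using \<tau>2 by (simp add: E_def radial_factor_def)
    have U0: "0 \<le> U" unfolding U_def by (rule cone_mean_nonneg[OF t \<gamma>])
    have um[measurable]: "u t \<in> borel_measurable lebesgue" using u_L2[OF t] by (simp add: L2_def)
    have Dm: "D \<in> borel_measurable lebesgue" unfolding D_def by (intro measurable_completion) measurable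
    show ?thesis
    proof (cases "U = 0 \<or> A = \<infinity>")
      case True
      then show ?thesis using q by (auto simp: U_def A_def)
    next
      case False
      then have Up: "0 < U" and Af: "A < \<infinity>" using U0 by (auto simp: less_top)
      define a where "a = enn2real A"
      have a: "A = ennreal a" using Af by (simp add: a_def ennreal_enn2real less_top)
      have a0: "0 \<le> a" by (simp add: a_def)
      define W where "W = C * E"
      have W: "0 < W" using C E by (simp add: W_def)
      \<comment> \<open>The value for which the weight contributes exactly \<open>U / 2\<close>, a
        term that can be absorbed on the left.\<close>
      define \<mu> where "\<mu> = (2 * W / U) powr ((q - 1) / q)"
      have \<mu>: "0 < \<mu>" using W Up by (simp add: \<mu>_def)
      \<comment> \<open>The Bochner integral of a nonintegrable function is 0, so
        \<open>U > 0\<close> already implies integrability.\<close>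
      have int: "integrable lebesgue (\<lambda>x. u t x * D x)"
      proof (rule ccontr)
        assume "\<not> ?thesis"
        then have "U = 0" unfolding U_def cone_mean_def D_def \<tau>_def by (rule not_integrable_integral_eq)
        then show False using Up by simp
      qed
      define S where "S = cball (0 :: real ^ 'n) (t + R + 1)"
      have Sm: "indicator S \<in> borel_measurable lebesgue"
        unfolding S_def by (intro borel_measurable_indicator) simp
      have "ennreal U \<le> ennreal (norm (LINT x|lebesgue. u t x * D x))"
        unfolding U_def cone_mean_def D_def \<tau>_def by (intro ennreal_leI) simp
      also have "\<dots> \<le> (\<integral>\<^sup>+x. ennreal (norm (u t x * D x)) \<partial>lebesgue)"
        by (rule integral_norm_bound_ennreal[OF int])
      also have "\<dots> \<le> (\<integral>\<^sup>+x. ennreal (\<mu> powr q) * ennreal (\<bar>u t x\<bar> powr q) +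
           ennreal (\<mu> powr - (q / (q - 1))) * (ennreal ((\<tau>\<^sup>2 - (norm x)\<^sup>2) powr - \<theta>) * indicator S x) \<partial>lebesgue)"
      proof (rule nn_integral_mono_AE)
        show "AE x in lebesgue. ennreal (norm (u t x * D x)) \<le> ennreal (\<mu> powr q) * ennreal (\<bar>u t x\<bar> powr q) +
           ennreal (\<mu> powr - (q / (q - 1))) * (ennreal ((\<tau>\<^sup>2 - (norm x)\<^sup>2) powr - \<theta>) * indicator S x)"
          using u_cone[OF t]
        proof eventually_elim
          case (elim x)
          show ?case
          proof (cases "x \<in> S")
            case True
            have D0: "0 \<le> D x" by (simp add: D_def)
            have "\<bar>u t x\<bar> * D x = (\<mu> * \<bar>u t x\<bar>) * (D x / \<mu>)" using \<mu> by simp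
            also have "\<dots> \<le> (\<mu> * \<bar>u t x\<bar>) powr q + (D x / \<mu>) powr (q / (q - 1))"
              using \<mu> D0 q by (intro Young_crude) auto
            also have "(\<mu> * \<bar>u t x\<bar>) powr q = \<mu> powr q * \<bar>u t x\<bar> powr q" using \<mu> by (simp add: powr_mult)
            also have "(D x / \<mu>) powr (q / (q - 1)) = \<mu> powr - (q / (q - 1)) * (\<tau>\<^sup>2 - (norm x)\<^sup>2) powr - \<theta>"
            proof -
              have "D x powr (q / (q - 1)) = (\<tau>\<^sup>2 - (norm x)\<^sup>2) powr - \<theta>"
                unfolding D_def \<theta>_def powr_powr by simp
              then show ?thesis using \<mu> D0 by (simp add: powr_divide powr_minus_divide)
            qed
            finally have "ennreal (norm (u t x * D x)) \<le> ennreal (\<mu> powr q * \<bar>u t x\<bar> powr q + \<mu> powr - (q / (q - 1)) * (\<tau>\<^sup>2 - (norm x)\<^sup>2) powr - \<theta>)"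
              using D0 by (intro ennreal_leI) (simp add: abs_mult)
            then show ?thesis using True by (simp add: ennreal_plus ennreal_mult')
          next
            case False
            then have "u t x = 0" using elim by (simp add: S_def)
            then show ?thesis by simp
          qed
        qed
      qed
      also have "\<dots> = ennreal (\<mu> powr q) * A + ennreal (\<mu> powr - (q / (q - 1))) * (\<integral>\<^sup>+x. ennreal ((\<tau>\<^sup>2 - (norm x)\<^sup>2) powr - \<theta>) * indicator S x \<partial>lebesgue)"
      proof -
        have m1: "(\<lambda>x. ennreal (\<bar>u t x\<bar> powr q)) \<in> borel_measurable lebesgue" by measurable
        have m2: "(\<lambda>x. ennreal ((\<tau>\<^sup>2 - (norm x)\<^sup>2) powr - \<theta>) * indicator S x) \<in> borel_measurable lebesgue"
        proof -
          have 1: "(\<lambda>x :: real ^ 'n. ennreal ((\<tau>\<^sup>2 - (norm x)\<^sup>2) powr - \<theta>)) \<in> borel_measurable borel" by measurable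
          have 2: "(indicator S :: real ^ 'n \<Rightarrow> ennreal) \<in> borel_measurable borel"
            unfolding S_def by (intro borel_measurable_indicator) simp
          show ?thesis using borel_measurable_times_ennreal[OF 1 2] by (intro measurable_completion) simp
        qed
        show ?thesis unfolding A_def
          by (subst nn_integral_add) (use m1 m2 in \<open>auto simp: nn_integral_cmult\<close>)
      qed
      also have "\<dots> \<le> ennreal (\<mu> powr q) * ennreal a + ennreal (\<mu> powr - (q / (q - 1))) * ennreal W"
      proof -
        have "(\<integral>\<^sup>+x. ennreal ((\<tau>\<^sup>2 - (norm x)\<^sup>2) powr - \<theta>) * indicator S x \<partial>lebesgue) \<le> ennreal W"
          unfolding nn_integral_completion S_def W_def E_def
          using cone[of "t + R + 1" \<tau>] t0 R_pos by (simp add: \<tau>_def mult.assoc)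
        then show ?thesis unfolding a by (intro add_left_mono mult_left_mono) auto
      qed
      also have "\<dots> = ennreal (\<mu> powr q * a + \<mu> powr - (q / (q - 1)) * W)"
        using a0 W by (simp add: ennreal_plus ennreal_mult')
      finally have "U \<le> \<mu> powr q * a + \<mu> powr - (q / (q - 1)) * W"
        using a0 W by (subst (asm) ennreal_le_iff) auto
      moreover have "\<mu> powr - (q / (q - 1)) * W = U / 2"
      proof -
        have "\<mu> powr - (q / (q - 1)) = (2 * W / U) powr - 1" using q by (simp add: \<mu>_def powr_powr)
        then show ?thesis using W Up by (simp add: powr_minus field_simps)
      qed
      ultimately have "U / 2 \<le> \<mu> powr q * a" by linarith
      then have "\<mu> powr - q * (U / 2) \<le> \<mu> powr - q * (\<mu> powr q * a)" by (intro mult_left_mono) auto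
      also have "\<dots> = a" using \<mu> by (simp add: mult.assoc[symmetric] powr_add[symmetric])
      finally have "\<mu> powr - q * (U / 2) \<le> a" .
      moreover have "\<mu> powr - q * (U / 2) = c * U powr q * E powr - (q - 1)"
      proof -
        have "\<mu> powr - q = (2 * W / U) powr - (q - 1)" using q by (simp add: \<mu>_def powr_powr)
        also have "\<dots> = 2 powr - (q - 1) * (C powr - (q - 1) * E powr - (q - 1)) * U powr (q - 1)"
        proof -
          have "U powr (q - 1) = 1 / U powr (1 - q)" using powr_minus_divide[of U "1 - q"] by simp
          then show ?thesis using W C E Up by (simp add: W_def powr_divide powr_mult)
        qed
        finally have "\<mu> powr - q * (U / 2) = (2 powr - (q - 1) * 2 powr - 1) * C powr - (q - 1) * E powr - (q - 1) * (U powr (q - 1) * U powr 1)"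
          using Up by (simp add: powr_minus_divide)
        then show ?thesis unfolding powr_add[symmetric] by (simp add: c_def)
      qed
      ultimately have "c * U powr q * E powr - (q - 1) \<le> a" by simp
      then have "ennreal (c * U powr q * E powr - (q - 1)) \<le> A" unfolding a by (rule ennreal_leI)
      then show ?thesis by (simp add: U_def E_def \<tau>_def A_def)
    qed
  qed
  ultimately show ?thesis by blast
qed

section \<open>The slicing iteration\<close>

text \<open>The exponent \<open>x = 2 / (P - 1)\<close> satisfies \<open>x * P - 1 = x + 1\<close>:
  raising \<open>b powr (j * x)\<close> to the power \<open>P\<close> pays for the loss
  \<open>b powr (- j)\<close> and still leaves \<open>b powr (j * x + j)\<close>. The hypothesis
  \<open>big\<close> supplies the further factor \<open>b powr x\<close> needed for the next
  index.\<close>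

lemma superlinear_recursion_unbounded:
  fixes F :: "nat \<Rightarrow> real"
  assumes P: "1 < P" and b: "1 < b" and A: "0 < A" and F0: "0 < F 0"
    and step: "\<And>j. A * b powr (- real j) * F j powr P \<le> F (Suc j)"
    and big: "b powr (2 / (P - 1)) \<le> A * F 0 powr (P - 1)"
  shows "F 0 * b powr (real j * (2 / (P - 1))) \<le> F j"
proof (induction j)
  case (Suc j)
  let ?x = "2 / (P - 1)"
  have e: "real j * ?x * P - real j = real j * ?x + real j"
    using P by (simp add: field_simps)
  have "F 0 * b powr (real (Suc j) * ?x) = F 0 * b powr (real j * ?x) * b powr ?x"
    by (simp add: powr_add[symmetric] algebra_simps add_divide_distrib)
  also have "\<dots> \<le> F 0 * b powr (real j * ?x + real j) * (A * F 0 powr (P - 1))"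
    using F0 b big by (intro mult_mono mult_left_mono powr_mono) auto
  also have "\<dots> = A * b powr (- real j) * (F 0 * b powr (real j * ?x)) powr P"
  proof -
    have "(F 0 * b powr (real j * ?x)) powr P = F 0 powr P * b powr (real j * ?x * P)"
      using F0 by (simp add: powr_mult powr_powr)
    moreover have "F 0 powr P = F 0 * F 0 powr (P - 1)" using F0 powr_add[of "F 0" 1 "P - 1"] by simp
    moreover have "b powr (real j * ?x + real j) = b powr (- real j) * b powr (real j * ?x * P)"
      unfolding powr_add[symmetric] e[symmetric] by simp
    ultimately show ?thesis by (simp only: mult_ac)
  qed
  also have "\<dots> \<le> A * b powr (- real j) * F j powr P"
  proof -
    have "0 \<le> F 0 * b powr (real j * ?x)" using F0 by (intro mult_nonneg_nonneg) auto
    from powr_mono2[OF _ this Suc, of P] show ?thesis using A P by (intro mult_left_mono) auto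
  qed
  also have "\<dots> \<le> F (Suc j)" by (rule step)
  finally show ?case .
qed (use F0 b in simp)

text \<open>The hypothesis \<open>big\<close> of \<open>superlinear_recursion_unbounded\<close> with
  \<open>b = 2 powr m * (P + 1)\<close>, solved for the combination of \<Lambda> and
  \<open>d0\<close>: the factor \<open>2 powr P * (P + 1) / c\<close> inverts the constant in
  \<open>A * F 0 powr (P - 1)\<close>. It depends on neither \<epsilon> nor \<Lambda>.\<close>

definition iteration_threshold :: "real \<Rightarrow> real \<Rightarrow> real \<Rightarrow> real" where
  "iteration_threshold P c m = (2 powr m * (P + 1)) powr (2 / (P - 1)) * 2 powr P * (P + 1) / c"

text \<open>
  In the application \<open>Q D l \<beta>\<close> says that \<open>D (ln (y/l)) powr \<beta>\<close> is a lower bound on \<open>[l, exp \<Lambda>]\<close> and \<open>X\<close> is the value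
  at \<open>exp \<Lambda>\<close>. Choosing \<open>\<delta> = 2 powr -j\<close> in the \<open>j\<close>-th step keeps \<open>l\<close> below \<open>l\<^sub>0 exp 2\<close>, and the resulting
  geometric losses are absorbed by the superlinear power \<open>P\<close>.
\<close>

lemma logarithmic_slicing_iteration:
  fixes Q :: "real \<Rightarrow> real \<Rightarrow> real \<Rightarrow> bool"
  assumes P: "1 < P" and c: "0 < c" and m: "0 \<le> m" and l0: "0 < l0" and d0: "0 < d0"
    and base: "Q d0 l0 1"
    and step: "\<And>D l \<beta> \<delta>. 0 < D \<Longrightarrow> l0 \<le> l \<Longrightarrow> 1 \<le> \<beta> \<Longrightarrow> 0 < \<delta> \<Longrightarrow> \<delta> \<le> 1 \<Longrightarrow> Q D l \<beta> \<Longrightarrow>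
        Q (c * \<delta> powr m * \<Lambda> powr - a * D powr P / (P * \<beta> + 1)) (l * exp \<delta>) (P * \<beta> + 1)"
    and bound: "\<And>D l \<beta>. 0 < D \<Longrightarrow> l0 \<le> l \<Longrightarrow> ln l \<le> \<Lambda> / 2 \<Longrightarrow> 1 \<le> \<beta> \<Longrightarrow> Q D l \<beta> \<Longrightarrow> D * (\<Lambda> / 2) powr \<beta> \<le> X"
    and L1: "0 < \<Lambda>" and L2: "ln l0 + 2 \<le> \<Lambda> / 2"
    and big: "iteration_threshold P c m \<le> \<Lambda> powr (P - a) * d0 powr (P - 1)"
  shows False
proof -
  define \<beta> where "\<beta> = rec_nat (1::real) (\<lambda>_ x. P * x + 1)"
  have \<beta>0: "\<beta> 0 = 1" and \<beta>S: "\<beta> (Suc j) = P * \<beta> j + 1" for j by (simp_all add: \<beta>_def)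
  \<comment> \<open>Closed form of \<open>l0\<close> times the exponential of the sum of
    \<open>(1/2) ^ i\<close> over \<open>i < j\<close>.\<close>
  define l where "l j = l0 * exp (2 - 2 * (1/2) ^ j)" for j :: nat
  have lS: "l (Suc j) = l j * exp ((1/2) ^ j)" for j
    unfolding l_def by (simp add: mult.assoc exp_add[symmetric])
  have ll: "l0 \<le> l j" for j unfolding l_def using l0 by (simp add: power_le_one)
  define D where "D = rec_nat d0 (\<lambda>j x. c * ((1/2) ^ j) powr m * \<Lambda> powr - a * x powr P / (P * \<beta> j + 1))"
  have D0: "D 0 = d0" and DS: "D (Suc j) = c * ((1/2) ^ j) powr m * \<Lambda> powr - a * D j powr P / (P * \<beta> j + 1)" for j
    by (simp_all add: D_def)
  have \<beta>1: "1 \<le> \<beta> j" for j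
  proof (induction j)
    case (Suc j)
    then have "0 \<le> P * \<beta> j" using P by (intro mult_nonneg_nonneg) auto
    then show ?case by (simp add: \<beta>S)
  qed (simp add: \<beta>0)
  \<comment> \<open>The denominators grow at most geometrically and can therefore be charged to the
    base \<open>b\<close>, together with the factors \<open>((1/2) ^ j) powr m\<close>.\<close>
  have \<beta>b: "P * \<beta> j + 1 \<le> (P + 1) ^ Suc j" for j
  proof (induction j)
    case (Suc j)
    have "P * (P * \<beta> j + 1) + 1 \<le> (P + 1) * (P * \<beta> j + 1)"
      using P \<beta>1[of j] mult_nonneg_nonneg[of P "\<beta> j"] by (simp add: algebra_simps)
    also have "\<dots> \<le> (P + 1) * (P + 1) ^ Suc j" using Suc P by (intro mult_left_mono) auto
    finally show ?case by (simp add: \<beta>S)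
  qed (simp add: \<beta>0)
  have Dpos: "0 < D j" for j
  proof (induction j)
    case (Suc j)
    have "0 < P * \<beta> j + 1" using P \<beta>1[of j] by (intro add_nonneg_pos mult_nonneg_nonneg) auto
    then show ?case unfolding DS using c L1 Suc by (intro divide_pos_pos mult_pos_pos) auto
  qed (simp add: D0 d0)
  have Q: "Q (D j) (l j) (\<beta> j)" for j
  proof (induction j)
    case 0
    then show ?case using base by (simp add: D0 \<beta>0 l_def)
  next
    case (Suc j)
    show ?case unfolding DS lS \<beta>S
      by (rule step[OF Dpos ll \<beta>1 _ _ Suc]) (auto simp: power_le_one)
  qed
  \<comment> \<open>The j-th lower bound evaluated at the end point, with its logarithm replaced by
    \<Lambda>/2. Because \<open>\<beta> (Suc j) = P * \<beta> j + 1\<close>, the powers of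
    \<Lambda>/2 match from step to step and \<open>F\<close> obeys a recursion free of
    \<beta>.\<close>
  define F where "F j = D j * (\<Lambda> / 2) powr \<beta> j" for j
  have FX: "F j \<le> X" for j
  proof -
    have "ln (l j) = ln l0 + (2 - 2 * (1/2) ^ j)" unfolding l_def using l0 by (simp add: ln_mult)
    then have "ln (l j) \<le> \<Lambda> / 2" using L2 by (smt (verit) zero_le_power zero_le_divide_1_iff)
    then show ?thesis unfolding F_def by (intro bound[OF Dpos ll _ \<beta>1 Q])
  qed
  define b where "b = 2 powr m * (P + 1)"
  have "1 \<le> (2::real) powr m" using m by (simp add: ge_one_powr_ge_zero)
  then have Pb: "1 * (P + 1) \<le> b" unfolding b_def using P by (intro mult_right_mono) auto
  have "1 < 1 * (P + 1)" using P by simp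
  then have b: "1 < b" using Pb by (rule less_le_trans)
  define A where "A = c * \<Lambda> powr (1 - a) / (2 * (P + 1))"
  have A: "0 < A" using c L1 P by (simp add: A_def)
  have F0: "F 0 = d0 * \<Lambda> / 2" using L1 by (simp add: F_def D0 \<beta>0)
  have stepF: "A * b powr (- real j) * F j powr P \<le> F (Suc j)" for j
  proof -
    have Lp: "0 < \<Lambda> / 2" using L1 by simp
    have bj: "b powr (- real j) = ((1/2) ^ j) powr m / (P + 1) ^ j"
    proof -
      have "b powr (- real j) = 1 / b ^ j" using b by (simp add: powr_minus_divide powr_realpow)
      also have "b ^ j = (2 powr m) ^ j * (P + 1) ^ j" by (simp add: b_def power_mult_distrib)
      also have "(2 powr m) ^ j = (2 ^ j) powr m"
        by (simp add: powr_realpow[symmetric] powr_powr mult.commute)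
      finally show ?thesis by (simp add: power_one_over powr_divide)
    qed
    have "A * b powr (- real j) * F j powr P
       = c * \<Lambda> powr (1 - a) / (2 * (P + 1)) * (((1/2) ^ j) powr m / (P + 1) ^ j) * (D j powr P * (\<Lambda> / 2) powr (P * \<beta> j))"
      unfolding bj A_def F_def using Dpos[of j] Lp by (simp add: powr_mult powr_powr mult.commute)
    also have "\<dots> = c * ((1/2) ^ j) powr m * \<Lambda> powr - a * D j powr P / (P + 1) ^ Suc j * (\<Lambda> / 2) powr (P * \<beta> j + 1)"
      using L1 P by (simp add: powr_add powr_diff powr_minus field_simps)
    also have "\<dots> \<le> c * ((1/2) ^ j) powr m * \<Lambda> powr - a * D j powr P / (P * \<beta> j + 1) * (\<Lambda> / 2) powr (P * \<beta> j + 1)"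
    proof -
      have "0 < P * \<beta> j + 1" using P \<beta>1[of j] by (intro add_nonneg_pos mult_nonneg_nonneg) auto
      then show ?thesis using c \<beta>b[of j] by (intro mult_right_mono divide_left_mono mult_nonneg_nonneg mult_pos_pos) auto
    qed
    also have "\<dots> = F (Suc j)" by (simp add: F_def DS \<beta>S)
    finally show ?thesis .
  qed
  have bigF: "b powr (2 / (P - 1)) \<le> A * F 0 powr (P - 1)"
  proof -
    have "A * F 0 powr (P - 1) = c / (2 powr P * (P + 1)) * (\<Lambda> powr (P - a) * d0 powr (P - 1))"
    proof -
      have "F 0 powr (P - 1) = d0 powr (P - 1) * \<Lambda> powr (P - 1) / 2 powr (P - 1)"
        using L1 d0 by (simp add: F0 powr_mult powr_divide)
      moreover have "\<Lambda> powr (1 - a) * \<Lambda> powr (P - 1) = \<Lambda> powr (P - a)" by (simp add: powr_add[symmetric])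
      moreover have "2 * 2 powr (P - 1) = (2::real) powr P" using powr_add[of "2::real" 1 "P - 1"] by simp
      moreover have "A * (d0 powr (P - 1) * \<Lambda> powr (P - 1) / 2 powr (P - 1)) =
         c / (2 * 2 powr (P - 1) * (P + 1)) * ((\<Lambda> powr (1 - a) * \<Lambda> powr (P - 1)) * d0 powr (P - 1))"
      proof -
        have "c * x / (2 * Q) * (d * y / z) = c / (2 * z * Q) * ((x * y) * d)" for x y z d Q :: real
          by (simp add: mult_ac)
        then show ?thesis unfolding A_def .
      qed
      ultimately show ?thesis by simp
    qed
    also have "\<dots> \<ge> c / (2 powr P * (P + 1)) * iteration_threshold P c m"
      using big c P by (intro mult_left_mono) auto
    finally show ?thesis using c P by (simp add: iteration_threshold_def b_def)
  qed
  have "0 < F 0" unfolding F0 using d0 L1 by simp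
  have grow: "F 0 * b powr (real j * (2 / (P - 1))) \<le> F j" for j
    by (rule superlinear_recursion_unbounded[OF P b A \<open>0 < F 0\<close> stepF bigF])
  define y where "y = b powr (2 / (P - 1))"
  have y: "1 < y" unfolding y_def using b P powr_less_mono[of 0 "2 / (P - 1)" b] by simp
  obtain j where "X / F 0 < y ^ j" using real_arch_pow[OF y] by blast
  then have "X < F 0 * y ^ j" using \<open>0 < F 0\<close> by (simp add: divide_less_eq mult.commute)
  also have "y ^ j = b powr (real j * (2 / (P - 1)))"
    unfolding y_def using b by (simp add: powr_realpow[symmetric] powr_powr mult.commute)
  finally show False using grow[of j] FX[of j] by linarith
qed

section \<open>Growth estimates along the cone\<close>

text \<open>The weight exponent 1 gives \<theta> = q/(q-1) > 1, the range in which
  \<open>radial_factor\<close> is constant: passing from the mean to the integral of the power costs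
  no logarithm.\<close>

lemma source_growth_from_data:
  fixes b :: "real \<Rightarrow> real" and w0 w1 :: "real ^ 'n \<Rightarrow> real" and q R :: real
  defines "N \<equiv> (real CARD('n) - 1) / 2"
  assumes q: "1 < q"
  shows "\<exists>c>0. \<forall>\<epsilon> T u ut g t. damped_wave b R \<epsilon> w0 w1 T u ut g \<longrightarrow> t \<in> time_interval T \<longrightarrow> 1 \<le> t \<longrightarrow>
     ennreal (c * \<epsilon> powr q * (t + R + 2) powr (2 * N - N * q)) \<le> (\<integral>\<^sup>+x. ennreal (\<bar>u t x\<bar> powr q) \<partial>lebesgue)"
proof -
  obtain c1 where c1: "c1 > 0" "\<And>\<epsilon> T u ut g t. damped_wave b R \<epsilon> w0 w1 T u ut g \<Longrightarrow> t \<in> time_interval T \<Longrightarrow> 1 \<le> t \<Longrightarrow>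
     c1 * \<epsilon> * (t + R + 2) powr (N - 1) \<le> cone_mean R 1 u t"
    using cone_mean_data_bound[OF zero_less_one, of b R w0 w1] unfolding N_def by blast
  obtain c2 where c2: "c2 > 0" "\<And>b R \<epsilon> (w0 :: real ^ 'n \<Rightarrow> real) w1 T u ut g t. damped_wave b R \<epsilon> w0 w1 T u ut g \<Longrightarrow> t \<in> time_interval T \<Longrightarrow>
     ennreal (c2 * cone_mean R 1 u t powr q * ((t + R + 2) powr (2 * N - q / (q - 1)) * radial_factor (q / (q - 1)) (t + R + 2)) powr - (q - 1))
       \<le> (\<integral>\<^sup>+x. ennreal (\<bar>u t x\<bar> powr q) \<partial>lebesgue)"
    using cone_mean_Holder[OF zero_less_one q, where 'n='n] unfolding N_def mult_1 by blast
  define c where "c = c2 * c1 powr q"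
  have "c > 0" using c1 c2 by (simp add: c_def)
  moreover have "ennreal (c * \<epsilon> powr q * (t + R + 2) powr (2 * N - N * q)) \<le> (\<integral>\<^sup>+x. ennreal (\<bar>u t x\<bar> powr q) \<partial>lebesgue)"
    if dw: "damped_wave b R \<epsilon> w0 w1 T u ut g" and t: "t \<in> time_interval T" "1 \<le> t" for \<epsilon> T u ut g t
  proof -
    have eps: "0 < \<epsilon>" and R: "0 < R" using dw by (auto simp: damped_wave_def)
    define \<tau> where "\<tau> = t + R + 2"
    have \<tau>: "0 < \<tau>" using t R by (simp add: \<tau>_def)
    have rf: "radial_factor (q / (q - 1)) \<tau> = 1" using q by (simp add: radial_factor_def divide_simps)
    have "c * \<epsilon> powr q * \<tau> powr (2 * N - N * q) = c2 * (c1 * \<epsilon> * \<tau> powr (N - 1)) powr q * (\<tau> powr (2 * N - q / (q - 1))) powr - (q - 1)"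
    proof -
      have "(2 * N - q / (q - 1)) * - (q - 1) = - 2 * N * (q - 1) + q" using q by (simp add: field_simps)
      then have "(N - 1) * q + (2 * N - q / (q - 1)) * - (q - 1) = 2 * N - N * q" by (simp add: algebra_simps)
      then have "\<tau> powr ((N - 1) * q) * \<tau> powr ((2 * N - q / (q - 1)) * - (q - 1)) = \<tau> powr (2 * N - N * q)"
        unfolding powr_add[symmetric] by simp
      moreover have "(c1 * \<epsilon> * \<tau> powr (N - 1)) powr q = c1 powr q * \<epsilon> powr q * \<tau> powr ((N - 1) * q)"
        using c1 eps by (simp add: powr_mult powr_powr)
      moreover have "(\<tau> powr (2 * N - q / (q - 1))) powr - (q - 1) = \<tau> powr ((2 * N - q / (q - 1)) * - (q - 1))"
        by (rule powr_powr)
      ultimately show ?thesis by (simp only: c_def mult_ac)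
    qed
    also have "\<dots> \<le> c2 * cone_mean R 1 u t powr q * (\<tau> powr (2 * N - q / (q - 1))) powr - (q - 1)"
      using c1(2)[OF dw t] c1(1) c2(1) eps q unfolding \<tau>_def[symmetric]
      by (intro mult_right_mono mult_left_mono powr_mono2) auto
    finally have "ennreal (c * \<epsilon> powr q * \<tau> powr (2 * N - N * q)) \<le> ennreal (c2 * cone_mean R 1 u t powr q * (\<tau> powr (2 * N - q / (q - 1))) powr - (q - 1))"
      by (rule ennreal_leI)
    also have "\<dots> \<le> (\<integral>\<^sup>+x. ennreal (\<bar>u t x\<bar> powr q) \<partial>lebesgue)"
      using c2(2)[OF dw t(1)] unfolding \<tau>_def[symmetric] rf by simp
    finally show ?thesis by (simp add: \<tau>_def)
  qed
  ultimately show ?thesis by blast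
qed

text \<open>The power of \<tau> is the one already provided by the data, so a lower bound for the
  normalised mean changes the source estimate only by logarithms. The negative power of the
  logarithm is the price of \<theta> = 1.\<close>

lemma source_growth_from_mean:
  fixes q :: real
  defines "N \<equiv> (real CARD('n::finite) - 1) / 2"
  assumes q: "1 < q"
  shows "\<exists>c>0. \<forall>b R \<epsilon> (w0 :: real ^ 'n \<Rightarrow> real) w1 T u ut g t x. damped_wave b R \<epsilon> w0 w1 T u ut g \<longrightarrow> t \<in> time_interval T \<longrightarrow>
     0 \<le> x \<longrightarrow> x \<le> (t + R + 2) powr (1 - 1 / q - N) * cone_mean R (1 - 1 / q) u t \<longrightarrow>
     ennreal (c * x powr q * ln (t + R + 2) powr - (q - 1) * (t + R + 2) powr (2 * N - N * q)) \<le> (\<integral>\<^sup>+x. ennreal (\<bar>u t x\<bar> powr q) \<partial>lebesgue)"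
proof -
  define \<gamma> where "\<gamma> = 1 - 1 / q"
  have \<gamma>: "0 < \<gamma>" using q by (simp add: \<gamma>_def)
  have \<theta>: "\<gamma> * (q / (q - 1)) = 1" using q by (simp add: \<gamma>_def field_simps)
  have rf: "radial_factor 1 x = ln x" for x by (simp add: radial_factor_def)
  obtain c where c: "c > 0" "\<And>b R \<epsilon> (w0 :: real ^ 'n \<Rightarrow> real) w1 T u ut g t. damped_wave b R \<epsilon> w0 w1 T u ut g \<Longrightarrow> t \<in> time_interval T \<Longrightarrow>
     ennreal (c * cone_mean R \<gamma> u t powr q * ((t + R + 2) powr (2 * N - 1) * ln (t + R + 2)) powr - (q - 1))
       \<le> (\<integral>\<^sup>+x. ennreal (\<bar>u t x\<bar> powr q) \<partial>lebesgue)"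
    using cone_mean_Holder[OF \<gamma> q, where 'n='n] unfolding N_def \<theta> rf by blast
  have "ennreal (c * x powr q * ln (t + R + 2) powr - (q - 1) * (t + R + 2) powr (2 * N - N * q)) \<le> (\<integral>\<^sup>+x. ennreal (\<bar>u t x\<bar> powr q) \<partial>lebesgue)"
    if dw: "damped_wave b R \<epsilon> w0 w1 T u ut g" and t: "t \<in> time_interval T" and x: "0 \<le> x"
      "x \<le> (t + R + 2) powr (\<gamma> - N) * cone_mean R \<gamma> u t" for b R \<epsilon> T u ut g t x and w0 w1 :: "real ^ 'n \<Rightarrow> real"
  proof -
    have R: "0 < R" using dw by (auto simp: damped_wave_def)
    define \<tau> where "\<tau> = t + R + 2"
    have \<tau>: "2 < \<tau>" using t R by (simp add: \<tau>_def time_interval_def)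
    have "x * \<tau> powr (N - \<gamma>) \<le> cone_mean R \<gamma> u t"
    proof -
      have "x * \<tau> powr (N - \<gamma>) \<le> (\<tau> powr (\<gamma> - N) * cone_mean R \<gamma> u t) * \<tau> powr (N - \<gamma>)"
        using x by (intro mult_right_mono) (auto simp: \<tau>_def)
      also have "\<dots> = cone_mean R \<gamma> u t * (\<tau> powr (\<gamma> - N) * \<tau> powr (N - \<gamma>))" by simp
      also have "\<tau> powr (\<gamma> - N) * \<tau> powr (N - \<gamma>) = 1" using \<tau> unfolding powr_add[symmetric] by simp
      finally show ?thesis by simp
    qed
    then have "c * (x * \<tau> powr (N - \<gamma>)) powr q * (\<tau> powr (2 * N - 1) * ln \<tau>) powr - (q - 1)
       \<le> c * cone_mean R \<gamma> u t powr q * (\<tau> powr (2 * N - 1) * ln \<tau>) powr - (q - 1)"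
      using x c(1) q by (intro mult_right_mono mult_left_mono powr_mono2) auto
    also have "c * (x * \<tau> powr (N - \<gamma>)) powr q * (\<tau> powr (2 * N - 1) * ln \<tau>) powr - (q - 1)
      = c * x powr q * ln \<tau> powr - (q - 1) * (\<tau> powr ((N - \<gamma>) * q) * \<tau> powr ((2 * N - 1) * - (q - 1)))"
      using x \<tau> by (simp add: powr_mult powr_powr)
    also have "\<tau> powr ((N - \<gamma>) * q) * \<tau> powr ((2 * N - 1) * - (q - 1)) = \<tau> powr (2 * N - N * q)"
    proof -
      have "\<gamma> * q = q - 1" using q by (simp add: \<gamma>_def field_simps)
      then have "(N - \<gamma>) * q + (2 * N - 1) * - (q - 1) = 2 * N - N * q" by (simp add: algebra_simps)
      then show ?thesis unfolding powr_add[symmetric] by simp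
    qed
    finally have "ennreal (c * x powr q * ln \<tau> powr - (q - 1) * \<tau> powr (2 * N - N * q)) \<le> ennreal (c * cone_mean R \<gamma> u t powr q * (\<tau> powr (2 * N - 1) * ln \<tau>) powr - (q - 1))"
      by (rule ennreal_leI)
    also have "\<dots> \<le> (\<integral>\<^sup>+x. ennreal (\<bar>u t x\<bar> powr q) \<partial>lebesgue)"
      using c(2)[OF dw t] unfolding \<tau>_def by simp
    finally show ?thesis by (simp add: \<tau>_def)
  qed
  then show ?thesis using c(1) unfolding \<gamma>_def by blast
qed

text \<open>A version that looks only at the last fraction \<kappa> of the time scale \<tau>. A
  slowly varying factor such as a power of a logarithm can be treated as the constant
  \<open>K\<close> on this window, at the cost of a power of \<kappa> but of no logarithm.\<close>

lemma cone_mean_local_source: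
  fixes b :: "real \<Rightarrow> real" and \<gamma> R e :: real
  defines "N \<equiv> (real CARD('n::finite) - 1) / 2"
  assumes \<gamma>: "0 < \<gamma>"
  shows "\<exists>c>0. \<forall>\<epsilon> (w0 :: real ^ 'n \<Rightarrow> real) w1 T u ut g t \<kappa> K. damped_wave b R \<epsilon> w0 w1 T u ut g \<longrightarrow> t \<in> time_interval T \<longrightarrow>
     0 < \<kappa> \<longrightarrow> \<kappa> \<le> 1 / 2 \<longrightarrow> 0 \<le> K \<longrightarrow> R + 2 \<le> (1 - \<kappa>) * (t + R + 2) \<longrightarrow>
     (\<forall>s\<in>{0..t}. (1 - \<kappa>) * (t + R + 2) \<le> s + R + 2 \<longrightarrow> ennreal (K * (s + R + 2) powr e) \<le> (\<integral>\<^sup>+x. ennreal (g s x) \<partial>lebesgue)) \<longrightarrow>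
     c * \<kappa>\<^sup>2 * K * (t + R + 2) powr (2 - 2 * \<gamma> + e) \<le> cone_mean R \<gamma> u t"
proof -
  obtain c where c: "c > 0" and src: "\<And>\<epsilon> (w0 :: real ^ 'n \<Rightarrow> real) w1 T u ut g t ell. damped_wave b R \<epsilon> w0 w1 T u ut g \<Longrightarrow> t \<in> time_interval T \<Longrightarrow>
     (AE s in lebesgue. s \<in> {0..t} \<longrightarrow> ennreal (ell s) \<le> (\<integral>\<^sup>+x. ennreal (g s x) \<partial>lebesgue)) \<Longrightarrow>
     (\<integral>\<^sup>+s. ennreal (indicator {0..t} s * (c * (t + R + 2) powr (N - 1 - \<gamma>)) * ((t - s) * (s + R + 2) powr (1 - N - \<gamma>)) * ell s) \<partial>lborel)
       \<le> ennreal (cone_mean R \<gamma> u t)"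
    using cone_mean_source_bound[OF \<gamma>, of b R, where 'n='n] unfolding N_def by blast
  define e' where "e' = 1 - N - \<gamma> + e"
  define C where "C = c * (1 / 4) * 3 powr - \<bar>e'\<bar> * (1/2) powr \<bar>e'\<bar>"
  have C: "C > 0" using c by (simp add: C_def)
  have "C * \<kappa>\<^sup>2 * K * (t + R + 2) powr (2 - 2 * \<gamma> + e) \<le> cone_mean R \<gamma> u t"
    if dw: "damped_wave b R \<epsilon> w0 w1 T u ut g" and t: "t \<in> time_interval T" and \<kappa>: "0 < \<kappa>" "\<kappa> \<le> 1 / 2"
     and K: "0 \<le> K" and l: "R + 2 \<le> (1 - \<kappa>) * (t + R + 2)"
     and g: "\<And>s. s \<in> {0..t} \<Longrightarrow> (1 - \<kappa>) * (t + R + 2) \<le> s + R + 2 \<Longrightarrow> ennreal (K * (s + R + 2) powr e) \<le> (\<integral>\<^sup>+x. ennreal (g s x) \<partial>lebesgue)"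
    for \<epsilon> T u ut g t \<kappa> K and w0 w1 :: "real ^ 'n \<Rightarrow> real"
  proof -
    interpret damped_wave b R \<epsilon> w0 w1 T u ut g by fact
    define \<tau> where "\<tau> = t + R + 2"
    have t0: "0 \<le> t" by (rule I_nonneg[OF t])
    have \<tau>: "0 < \<tau>" using t0 R_pos by (simp add: \<tau>_def)
    define ell where "ell s = (if (1 - \<kappa>) * \<tau> \<le> s + R + 2 then K * (s + R + 2) powr e else 0)" for s
    \<comment> \<open>The later half of the window is discarded to keep
      \<open>t - s \<ge> \<kappa> * \<tau> / 2\<close>. The kernel and the length of
      \<open>J\<close> each contribute this quantity, which gives \<kappa> squared and two powers of
      \<tau>.\<close>
    define J where "J = {t - \<kappa> * \<tau> .. t - \<kappa> * \<tau> / 2}"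
    define m where "m = c * \<tau> powr (N - 1 - \<gamma>) * (\<kappa> * \<tau> / 2) * K * (3 powr - \<bar>e'\<bar> * (1/2) powr \<bar>e'\<bar> * \<tau> powr e')"
    have m0: "0 \<le> m" using c \<kappa> K \<tau> by (simp add: m_def)
    have "ennreal (m * (\<kappa> * \<tau> / 2)) = (\<integral>\<^sup>+s. ennreal m * indicator J s \<partial>lborel)"
    proof -
      have "emeasure lborel J = ennreal (\<kappa> * \<tau> / 2)" unfolding J_def using \<kappa> \<tau> by simp
      moreover have "(\<integral>\<^sup>+s. ennreal m * indicator J s \<partial>lborel) = ennreal m * emeasure lborel J"
        by (rule nn_integral_cmult_indicator) (simp add: J_def)
      ultimately show ?thesis using ennreal_mult'[OF m0, of "\<kappa> * \<tau> / 2"] by (simp only:)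
    qed
    also have "\<dots> \<le> (\<integral>\<^sup>+s. ennreal (indicator {0..t} s * (c * \<tau> powr (N - 1 - \<gamma>)) * ((t - s) * (s + R + 2) powr (1 - N - \<gamma>)) * ell s) \<partial>lborel)"
    proof (rule nn_integral_mono)
      fix s
      show "ennreal m * indicator J s \<le> ennreal (indicator {0..t} s * (c * \<tau> powr (N - 1 - \<gamma>)) * ((t - s) * (s + R + 2) powr (1 - N - \<gamma>)) * ell s)"
      proof (cases "s \<in> J")
        case True
        define y where "y = s + R + 2"
        have y: "(1 - \<kappa>) * \<tau> \<le> y" "y \<le> \<tau>"
        proof -
          have "0 < \<kappa> * \<tau>" "t - \<kappa> * \<tau> \<le> s" "s \<le> t - \<kappa> * \<tau> / 2"
            using True mult_pos_pos[OF \<kappa>(1) \<tau>] by (auto simp: J_def)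
          moreover have "(1 - \<kappa>) * \<tau> = \<tau> - \<kappa> * \<tau>" by (simp add: left_diff_distrib)
          ultimately show "(1 - \<kappa>) * \<tau> \<le> y" "y \<le> \<tau>" unfolding y_def \<tau>_def by linarith+
        qed
        have s: "0 \<le> s" "s \<le> t" using y l by (auto simp: y_def \<tau>_def)
        have yp: "0 < y" using s R_pos by (simp add: y_def)
        have half: "\<tau> / 2 \<le> y"
        proof -
          have "1 / 2 * \<tau> \<le> (1 - \<kappa>) * \<tau>" using \<kappa> \<tau> by (intro mult_right_mono) auto
          then show ?thesis using y by simp
        qed
        have ye: "3 powr - \<bar>e'\<bar> * (1/2) powr \<bar>e'\<bar> * \<tau> powr e' \<le> y powr e'"
        proof -
          have "3 powr - \<bar>e'\<bar> * (1/2) powr \<bar>e'\<bar> * \<tau> powr e' \<le> 3 powr - \<bar>e'\<bar> * (1/2) powr e' * \<tau> powr e'"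
            by (intro mult_right_mono mult_left_mono powr_mono') auto
          also have "\<dots> = 3 powr - \<bar>e'\<bar> * (\<tau> / 2) powr e'" using \<tau> by (simp add: powr_divide)
          also have "\<dots> \<le> y powr e'" using half y \<tau> by (intro powr_ge_bounded_ratio) auto
          finally show ?thesis .
        qed
        have "\<kappa> * \<tau> / 2 \<le> t - s" using True by (simp add: J_def)
        then have "m \<le> c * \<tau> powr (N - 1 - \<gamma>) * (t - s) * K * y powr e'"
          unfolding m_def using c \<kappa> K \<tau> ye s by (intro mult_mono mult_left_mono mult_right_mono mult_nonneg_nonneg) auto
        also have "\<dots> = indicator {0..t} s * (c * \<tau> powr (N - 1 - \<gamma>)) * ((t - s) * (s + R + 2) powr (1 - N - \<gamma>)) * ell s"
        proof -
          have "y powr e' = y powr (1 - N - \<gamma>) * y powr e" unfolding e'_def by (rule powr_add)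
          then show ?thesis using s y by (simp add: ell_def y_def)
        qed
        finally show ?thesis using True by (simp add: ennreal_leI)
      qed simp
    qed
    also have "\<dots> \<le> ennreal (cone_mean R \<gamma> u t)"
      unfolding \<tau>_def by (rule src[OF dw t]) (use g in \<open>auto simp: ell_def \<tau>_def\<close>)
    finally have "m * (\<kappa> * \<tau> / 2) \<le> cone_mean R \<gamma> u t"
      using cone_mean_nonneg[OF t \<gamma>] by (subst (asm) ennreal_le_iff)
    moreover have "m * (\<kappa> * \<tau> / 2) = C * \<kappa>\<^sup>2 * K * \<tau> powr (2 - 2 * \<gamma> + e)"
    proof -
      have "\<tau> powr (2 - 2 * \<gamma> + e) = \<tau> powr (N - 1 - \<gamma>) * \<tau> powr e' * \<tau> powr 2"
      proof -
        have "2 - 2 * \<gamma> + e = N - 1 - \<gamma> + e' + 2" by (simp add: e'_def)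
        then show ?thesis by (simp only: powr_add)
      qed
      then have "\<tau> powr (2 - 2 * \<gamma> + e) = \<tau> powr (N - 1 - \<gamma>) * \<tau> powr e' * \<tau>\<^sup>2" using \<tau> by simp
      then show ?thesis by (simp add: m_def C_def power2_eq_square)
    qed
    ultimately show ?thesis by (simp add: \<tau>_def)
  qed
  with C show ?thesis by blast
qed

text \<open>
  The exponent \<open>\<gamma> = (1 - 1/p)/2\<close> is subcritical in Hoelder's inequality, so no logarithm is lost here; its value
  drops out of the final power.
\<close>

lemma source_growth_from_source:
  fixes b :: "real \<Rightarrow> real" and R e p :: real
  defines "N \<equiv> (real CARD('n::finite) - 1) / 2"
  assumes p: "1 < p"
  shows "\<exists>c>0. \<forall>\<epsilon> (w0 :: real ^ 'n \<Rightarrow> real) w1 T u ut g t \<kappa> K. damped_wave b R \<epsilon> w0 w1 T u ut g \<longrightarrow> t \<in> time_interval T \<longrightarrow>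
     0 < \<kappa> \<longrightarrow> \<kappa> \<le> 1 / 2 \<longrightarrow> 0 \<le> K \<longrightarrow> R + 2 \<le> (1 - \<kappa>) * (t + R + 2) \<longrightarrow>
     (\<forall>s\<in>{0..t}. (1 - \<kappa>) * (t + R + 2) \<le> s + R + 2 \<longrightarrow> ennreal (K * (s + R + 2) powr e) \<le> (\<integral>\<^sup>+x. ennreal (g s x) \<partial>lebesgue)) \<longrightarrow>
     ennreal (c * \<kappa> powr (2 * p) * K powr p * (t + R + 2) powr (p * (2 + e) - (2 * N + 1) * (p - 1))) \<le> (\<integral>\<^sup>+x. ennreal (\<bar>u t x\<bar> powr p) \<partial>lebesgue)"
proof -
  define \<gamma> where "\<gamma> = (1 - 1 / p) / 2"
  have \<gamma>: "0 < \<gamma>" using p by (simp add: \<gamma>_def)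
  have \<theta>: "\<gamma> * (p / (p - 1)) = 1 / 2" using p by (simp add: \<gamma>_def field_simps)
  obtain c1 where c1: "c1 > 0" and loc: "\<And>\<epsilon> (w0 :: real ^ 'n \<Rightarrow> real) w1 T u ut g t \<kappa> K. damped_wave b R \<epsilon> w0 w1 T u ut g \<Longrightarrow> t \<in> time_interval T \<Longrightarrow>
     0 < \<kappa> \<Longrightarrow> \<kappa> \<le> 1 / 2 \<Longrightarrow> 0 \<le> K \<Longrightarrow> R + 2 \<le> (1 - \<kappa>) * (t + R + 2) \<Longrightarrow>
     (\<forall>s\<in>{0..t}. (1 - \<kappa>) * (t + R + 2) \<le> s + R + 2 \<longrightarrow> ennreal (K * (s + R + 2) powr e) \<le> (\<integral>\<^sup>+x. ennreal (g s x) \<partial>lebesgue)) \<Longrightarrow>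
     c1 * \<kappa>\<^sup>2 * K * (t + R + 2) powr (2 - 2 * \<gamma> + e) \<le> cone_mean R \<gamma> u t"
    using cone_mean_local_source[OF \<gamma>, of b R e, where 'n='n] by metis
  have rf: "radial_factor (1 / 2) x = x powr (1 / 2)" for x by (simp add: radial_factor_def)
  obtain c2 where c2: "c2 > 0" "\<And>b R \<epsilon> (w0 :: real ^ 'n \<Rightarrow> real) w1 T u ut g t. damped_wave b R \<epsilon> w0 w1 T u ut g \<Longrightarrow> t \<in> time_interval T \<Longrightarrow>
     ennreal (c2 * cone_mean R \<gamma> u t powr p * ((t + R + 2) powr (2 * N - 1 / 2) * (t + R + 2) powr (1 / 2)) powr - (p - 1))
       \<le> (\<integral>\<^sup>+x. ennreal (\<bar>u t x\<bar> powr p) \<partial>lebesgue)"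
    using cone_mean_Holder[OF \<gamma> p, where 'n='n] unfolding N_def \<theta> rf by blast
  define c where "c = c2 * c1 powr p"
  have "c > 0" using c1 c2 by (simp add: c_def)
  moreover have "ennreal (c * \<kappa> powr (2 * p) * K powr p * (t + R + 2) powr (p * (2 + e) - (2 * N + 1) * (p - 1))) \<le> (\<integral>\<^sup>+x. ennreal (\<bar>u t x\<bar> powr p) \<partial>lebesgue)"
    if dw: "damped_wave b R \<epsilon> w0 w1 T u ut g" and t: "t \<in> time_interval T" and \<kappa>: "0 < \<kappa>" "\<kappa> \<le> 1 / 2"
     and K: "0 \<le> K" and l: "R + 2 \<le> (1 - \<kappa>) * (t + R + 2)"
     and g: "\<forall>s\<in>{0..t}. (1 - \<kappa>) * (t + R + 2) \<le> s + R + 2 \<longrightarrow> ennreal (K * (s + R + 2) powr e) \<le> (\<integral>\<^sup>+x. ennreal (g s x) \<partial>lebesgue)"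
    for \<epsilon> T u ut g t \<kappa> K and w0 w1 :: "real ^ 'n \<Rightarrow> real"
  proof -
    have R: "0 < R" using dw by (auto simp: damped_wave_def)
    define \<tau> where "\<tau> = t + R + 2"
    have \<tau>: "0 < \<tau>" using t R by (simp add: \<tau>_def time_interval_def)
    have "c * \<kappa> powr (2 * p) * K powr p * \<tau> powr (p * (2 + e) - (2 * N + 1) * (p - 1))
      = c2 * (c1 * \<kappa>\<^sup>2 * K * \<tau> powr (2 - 2 * \<gamma> + e)) powr p * (\<tau> powr (2 * N - 1 / 2) * \<tau> powr (1 / 2)) powr - (p - 1)"
    proof -
      have gp: "2 * \<gamma> * p = p - 1" using p by (simp add: \<gamma>_def field_simps)
      have "(2 - 2 * \<gamma> + e) * p + 2 * N * - (p - 1) = p * (2 + e) - (2 * \<gamma> * p) - 2 * N * (p - 1)" by (simp add: algebra_simps)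
      then have "(2 - 2 * \<gamma> + e) * p + 2 * N * - (p - 1) = p * (2 + e) - (2 * N + 1) * (p - 1)" unfolding gp by (simp add: algebra_simps)
      then have "\<tau> powr ((2 - 2 * \<gamma> + e) * p) * \<tau> powr (2 * N * - (p - 1)) = \<tau> powr (p * (2 + e) - (2 * N + 1) * (p - 1))"
        unfolding powr_add[symmetric] by simp
      moreover have "(\<tau> powr (2 * N - 1 / 2) * \<tau> powr (1 / 2)) powr - (p - 1) = \<tau> powr (2 * N * - (p - 1))"
        unfolding powr_add[symmetric] powr_powr by simp
      moreover have "(c1 * \<kappa>\<^sup>2 * K * \<tau> powr (2 - 2 * \<gamma> + e)) powr p = c1 powr p * \<kappa> powr (2 * p) * K powr p * \<tau> powr ((2 - 2 * \<gamma> + e) * p)"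
      proof -
        have "(\<kappa>\<^sup>2) powr p = \<kappa> powr (2 * p)" using \<kappa> by (simp add: powr_powr[symmetric])
        then show ?thesis using c1 \<kappa> K \<tau> by (simp add: powr_mult powr_powr)
      qed
      ultimately show ?thesis by (simp only: c_def mult_ac)
    qed
    also have "\<dots> \<le> c2 * cone_mean R \<gamma> u t powr p * (\<tau> powr (2 * N - 1 / 2) * \<tau> powr (1 / 2)) powr - (p - 1)"
      using loc[OF dw t \<kappa> K l g] c1(1) c2(1) K p unfolding \<tau>_def[symmetric]
      by (intro mult_right_mono mult_left_mono powr_mono2) auto
    finally have "ennreal (c * \<kappa> powr (2 * p) * K powr p * \<tau> powr (p * (2 + e) - (2 * N + 1) * (p - 1)))
       \<le> ennreal (c2 * cone_mean R \<gamma> u t powr p * (\<tau> powr (2 * N - 1 / 2) * \<tau> powr (1 / 2)) powr - (p - 1))"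
      by (rule ennreal_leI)
    also have "\<dots> \<le> (\<integral>\<^sup>+x. ennreal (\<bar>u t x\<bar> powr p) \<partial>lebesgue)"
      using c2(2)[OF dw t] unfolding \<tau>_def by simp
    finally show ?thesis by (simp add: \<tau>_def)
  qed
  ultimately show ?thesis by blast
qed

lemma nn_integral_ln_powr:
  fixes l z \<beta> R :: real
  assumes l: "0 < l" "l \<le> z" and \<beta>: "0 \<le> \<beta>"
  shows "(\<integral>\<^sup>+s. ennreal (indicator {l - R..z - R} s * (ln ((s + R) / l) powr \<beta> / (s + R))) \<partial>lborel) = ennreal (ln (z / l) powr (\<beta> + 1) / (\<beta> + 1))"
proof -
  have "((\<lambda>s. ln ((s + R) / l) powr \<beta> / (s + R)) has_integral
      (ln ((z - R + R) / l) powr (\<beta> + 1) / (\<beta> + 1) - ln ((l - R + R) / l) powr (\<beta> + 1) / (\<beta> + 1))) {l - R..z - R}"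
  proof (rule fundamental_theorem_of_calculus_interior)
    have "continuous_on {l - R..z - R} (\<lambda>s. ln ((s + R) / l))"
      using l by (intro continuous_intros) auto
    then show "continuous_on {l - R..z - R} (\<lambda>s. ln ((s + R) / l) powr (\<beta> + 1) / (\<beta> + 1))"
      using l \<beta> by (intro continuous_on_divide continuous_on_powr' continuous_intros) auto
    fix s assume s: "s \<in> {l - R<..<z - R}"
    have pos: "0 < ln ((s + R) / l)" using s l by simp
    have "((\<lambda>s. ln ((s + R) / l)) has_real_derivative 1 / (s + R)) (at s)"
      using s l by (auto intro!: derivative_eq_intros simp: field_simps)
    from DERIV_chain2[OF has_real_derivative_powr[OF pos] this]
    have "((\<lambda>s. ln ((s + R) / l) powr (\<beta> + 1)) has_real_derivative (\<beta> + 1) * ln ((s + R) / l) powr (\<beta> + 1 - 1) * (1 / (s + R))) (at s)" .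
    from DERIV_cdivide[OF this, of "\<beta> + 1"]
    show "((\<lambda>s. ln ((s + R) / l) powr (\<beta> + 1) / (\<beta> + 1)) has_vector_derivative ln ((s + R) / l) powr \<beta> / (s + R)) (at s)"
      using \<beta> by (simp add: has_real_derivative_iff_has_vector_derivative)
  qed (use l in auto)
  then have "((\<lambda>s. ln ((s + R) / l) powr \<beta> / (s + R)) has_integral (ln (z / l) powr (\<beta> + 1) / (\<beta> + 1))) {l - R..z - R}"
    using l \<beta> by simp
  then have "((\<lambda>s. \<bar>ln ((s + R) / l) powr \<beta> / (s + R)\<bar>) has_integral (ln (z / l) powr (\<beta> + 1) / (\<beta> + 1))) {l - R..z - R}"
    by (rule has_integral_eq[rotated]) (use l in auto)
  from nn_integral_has_integral_lebesgue[OF _ this]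
  have "(\<integral>\<^sup>+s. ennreal (indicator {l - R..z - R} s * \<bar>ln ((s + R) / l) powr \<beta> / (s + R)\<bar>) \<partial>lborel) = ennreal (ln (z / l) powr (\<beta> + 1) / (\<beta> + 1))"
    by simp
  moreover have "(\<integral>\<^sup>+s. ennreal (indicator {l - R..z - R} s * \<bar>ln ((s + R) / l) powr \<beta> / (s + R)\<bar>) \<partial>lborel)
     = (\<integral>\<^sup>+s. ennreal (indicator {l - R..z - R} s * (ln ((s + R) / l) powr \<beta> / (s + R))) \<partial>lborel)"
    using l by (intro nn_integral_cong) (auto simp: indicator_def)
  ultimately show ?thesis by simp
qed

text \<open>The power N + \<gamma> - 2 is the one that meets the kernel's 1 - N - \<gamma> to give
  exactly 1/y, and integrating \<open>ln (y / l) powr \<beta> / y\<close> raises the power of the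
  logarithm by one. Cutting the integral at \<open>(1 - \<kappa>) * \<tau>\<close> keeps
  \<open>t - s \<ge> \<kappa> * \<tau>\<close>, so the vanishing of the kernel at
  \<open>s = t\<close> costs only a factor \<kappa>.\<close>

lemma mean_growth_from_critical_source:
  fixes b :: "real \<Rightarrow> real" and \<gamma> R :: real
  defines "N \<equiv> (real CARD('n::finite) - 1) / 2"
  assumes \<gamma>: "0 < \<gamma>"
  shows "\<exists>c>0. \<forall>\<epsilon> (w0 :: real ^ 'n \<Rightarrow> real) w1 T u ut g t \<kappa> K l \<beta>. damped_wave b R \<epsilon> w0 w1 T u ut g \<longrightarrow> t \<in> time_interval T \<longrightarrow>
     0 < \<kappa> \<longrightarrow> \<kappa> \<le> 1 / 2 \<longrightarrow> 0 \<le> K \<longrightarrow> 0 \<le> \<beta> \<longrightarrow> R + 2 \<le> l \<longrightarrow> l \<le> (1 - \<kappa>) * (t + R + 2) \<longrightarrow>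
     (\<forall>s\<in>{0..t}. l \<le> s + R + 2 \<longrightarrow> ennreal (K * ln ((s + R + 2) / l) powr \<beta> * (s + R + 2) powr (N + \<gamma> - 2)) \<le> (\<integral>\<^sup>+x. ennreal (g s x) \<partial>lebesgue)) \<longrightarrow>
     c * \<kappa> * K * ln ((1 - \<kappa>) * (t + R + 2) / l) powr (\<beta> + 1) / (\<beta> + 1) \<le> (t + R + 2) powr (\<gamma> - N) * cone_mean R \<gamma> u t"
proof -
  obtain c where c: "c > 0" and src: "\<And>\<epsilon> (w0 :: real ^ 'n \<Rightarrow> real) w1 T u ut g t ell. damped_wave b R \<epsilon> w0 w1 T u ut g \<Longrightarrow> t \<in> time_interval T \<Longrightarrow>
     (AE s in lebesgue. s \<in> {0..t} \<longrightarrow> ennreal (ell s) \<le> (\<integral>\<^sup>+x. ennreal (g s x) \<partial>lebesgue)) \<Longrightarrow>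
     (\<integral>\<^sup>+s. ennreal (indicator {0..t} s * (c * (t + R + 2) powr (N - 1 - \<gamma>)) * ((t - s) * (s + R + 2) powr (1 - N - \<gamma>)) * ell s) \<partial>lborel)
       \<le> ennreal (cone_mean R \<gamma> u t)"
    using cone_mean_source_bound[OF \<gamma>, of b R, where 'n='n] unfolding N_def by blast
  have "c * \<kappa> * K * ln ((1 - \<kappa>) * (t + R + 2) / l) powr (\<beta> + 1) / (\<beta> + 1) \<le> (t + R + 2) powr (\<gamma> - N) * cone_mean R \<gamma> u t"
    if dw: "damped_wave b R \<epsilon> w0 w1 T u ut g" and t: "t \<in> time_interval T" and \<kappa>: "0 < \<kappa>" "\<kappa> \<le> 1 / 2"
     and K: "0 \<le> K" and \<beta>: "0 \<le> \<beta>" and l: "R + 2 \<le> l" "l \<le> (1 - \<kappa>) * (t + R + 2)"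
     and g: "\<And>s. s \<in> {0..t} \<Longrightarrow> l \<le> s + R + 2 \<Longrightarrow> ennreal (K * ln ((s + R + 2) / l) powr \<beta> * (s + R + 2) powr (N + \<gamma> - 2)) \<le> (\<integral>\<^sup>+x. ennreal (g s x) \<partial>lebesgue)"
    for \<epsilon> T u ut g t \<kappa> K l \<beta> and w0 w1 :: "real ^ 'n \<Rightarrow> real"
  proof -
    interpret damped_wave b R \<epsilon> w0 w1 T u ut g by fact
    define \<tau> where "\<tau> = t + R + 2"
    have t0: "0 \<le> t" by (rule I_nonneg[OF t])
    have \<tau>: "0 < \<tau>" using t0 R_pos by (simp add: \<tau>_def)
    have l0: "0 < l" using l R_pos by simp
    define ell where "ell s = (if l \<le> s + R + 2 then K * ln ((s + R + 2) / l) powr \<beta> * (s + R + 2) powr (N + \<gamma> - 2) else 0)" for s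
    define z where "z = (1 - \<kappa>) * \<tau>"
    have lz: "l \<le> z" using l by (simp add: z_def \<tau>_def)
    have z\<tau>: "z \<le> \<tau>" using \<kappa> \<tau> by (simp add: z_def algebra_simps)
    define m where "m = c * \<tau> powr (N - 1 - \<gamma>) * (\<kappa> * \<tau>) * K"
    have m0: "0 \<le> m" using c \<kappa> K \<tau> by (simp add: m_def)
    have meas: "(\<lambda>s. ennreal (indicator {l - (R + 2)..z - (R + 2)} s * (ln ((s + (R + 2)) / l) powr \<beta> / (s + (R + 2))))) \<in> borel_measurable borel"
      by measurable
    have "ennreal (m * (ln (z / l) powr (\<beta> + 1) / (\<beta> + 1))) = ennreal m * (\<integral>\<^sup>+s. ennreal (indicator {l - (R + 2)..z - (R + 2)} s * (ln ((s + (R + 2)) / l) powr \<beta> / (s + (R + 2)))) \<partial>lborel)"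
      unfolding nn_integral_ln_powr[OF l0 lz \<beta>] using m0 by (rule ennreal_mult')
    also have "\<dots> = (\<integral>\<^sup>+s. ennreal m * ennreal (indicator {l - (R + 2)..z - (R + 2)} s * (ln ((s + (R + 2)) / l) powr \<beta> / (s + (R + 2)))) \<partial>lborel)"
      using meas by (intro nn_integral_cmult[symmetric]) simp
    also have "\<dots> \<le> (\<integral>\<^sup>+s. ennreal (indicator {0..t} s * (c * \<tau> powr (N - 1 - \<gamma>)) * ((t - s) * (s + R + 2) powr (1 - N - \<gamma>)) * ell s) \<partial>lborel)"
    proof (rule nn_integral_mono)
      fix s
      show "ennreal m * ennreal (indicator {l - (R + 2)..z - (R + 2)} s * (ln ((s + (R + 2)) / l) powr \<beta> / (s + (R + 2))))
         \<le> ennreal (indicator {0..t} s * (c * \<tau> powr (N - 1 - \<gamma>)) * ((t - s) * (s + R + 2) powr (1 - N - \<gamma>)) * ell s)"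
      proof (cases "s \<in> {l - (R + 2)..z - (R + 2)}")
        case True
        define y where "y = s + R + 2"
        have y: "l \<le> y" "y \<le> z" using True by (auto simp: y_def)
        have s: "s \<in> {0..t}" using y l z\<tau> by (auto simp: y_def \<tau>_def)
        have yp: "0 < y" using y l0 by simp
        have "\<kappa> * \<tau> \<le> t - s" using y by (simp add: z_def \<tau>_def y_def algebra_simps)
        then have "m * (ln (y / l) powr \<beta> / y) \<le> c * \<tau> powr (N - 1 - \<gamma>) * (t - s) * K * (ln (y / l) powr \<beta> / y)"
          unfolding m_def using c K yp by (intro mult_right_mono mult_left_mono) auto
        also have "\<dots> = indicator {0..t} s * (c * \<tau> powr (N - 1 - \<gamma>)) * ((t - s) * y powr (1 - N - \<gamma>)) * ell s"
        proof -
          have "y powr (1 - N - \<gamma>) * y powr (N + \<gamma> - 2) = y powr - 1" unfolding powr_add[symmetric] by simp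
          then have e1: "y powr (1 - N - \<gamma>) * y powr (N + \<gamma> - 2) = 1 / y" using yp by (simp add: powr_minus_divide)
          have e2: "ell s = K * ln (y / l) powr \<beta> * y powr (N + \<gamma> - 2)" using y by (simp add: ell_def y_def)
          have "c * \<tau> powr (N - 1 - \<gamma>) * ((t - s) * y powr (1 - N - \<gamma>)) * ell s
             = c * \<tau> powr (N - 1 - \<gamma>) * (t - s) * K * (ln (y / l) powr \<beta> * (y powr (1 - N - \<gamma>) * y powr (N + \<gamma> - 2)))"
            unfolding e2 by (simp only: mult_ac)
          then show ?thesis unfolding e1 using s by simp
        qed
        finally show ?thesis using True m0 unfolding y_def by (simp add: ennreal_mult'[symmetric] ennreal_leI add.assoc)
      qed simp
    qed
    also have "\<dots> \<le> ennreal (cone_mean R \<gamma> u t)"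
      unfolding \<tau>_def by (rule src[OF dw t]) (use g in \<open>auto simp: ell_def\<close>)
    finally have "m * (ln (z / l) powr (\<beta> + 1) / (\<beta> + 1)) \<le> cone_mean R \<gamma> u t"
      using cone_mean_nonneg[OF t \<gamma>] by (subst (asm) ennreal_le_iff)
    then have "\<tau> powr (\<gamma> - N) * (m * (ln (z / l) powr (\<beta> + 1) / (\<beta> + 1))) \<le> \<tau> powr (\<gamma> - N) * cone_mean R \<gamma> u t"
      by (intro mult_left_mono) auto
    moreover have "\<tau> powr (\<gamma> - N) * m = c * \<kappa> * K"
    proof -
      have "\<tau> powr (\<gamma> - N) * \<tau> powr (N - 1 - \<gamma>) * \<tau> powr 1 = 1"
        unfolding powr_add[symmetric] using \<tau> by simp
      then have "c * \<kappa> * K * (\<tau> powr (\<gamma> - N) * \<tau> powr (N - 1 - \<gamma>) * \<tau>) = c * \<kappa> * K" using \<tau> by simp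
      then show ?thesis by (simp add: m_def mult_ac)
    qed
    ultimately show ?thesis by (simp add: z_def \<tau>_def mult.assoc[symmetric])
  qed
  with c show ?thesis by blast
qed

section \<open>Lifespan bounds\<close>

lemma one_minus_exp_bounds:
  assumes "0 < x" "x \<le> (1/2 :: real)"
  shows "0 < 1 - exp (- x)" "1 - exp (- x) \<le> 1 / 2" "x / 2 \<le> 1 - exp (- x)"
proof -
  show "0 < 1 - exp (- x)" using assms by simp
  have "1 - x \<le> exp (- x)" using exp_ge_add_one_self[of "- x"] by simp
  then show "1 - exp (- x) \<le> 1 / 2" using assms by linarith
  have "(1 + x) * exp (- x) \<le> exp x * exp (- x)" by (intro mult_right_mono exp_ge_add_one_self) auto
  then have "exp (- x) + x * exp (- x) \<le> 1" by (simp add: exp_add[symmetric] distrib_right)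
  moreover have "x * (1/2) \<le> x * exp (- x)" using \<open>1 - x \<le> exp (- x)\<close> assms by (intro mult_left_mono) auto
  ultimately show "x / 2 \<le> 1 - exp (- x)" by linarith
qed

text \<open>The hypothesis \<open>crit\<close> makes the mean of \<open>u\<close> critical, and one
  round runs through both equations. The mean of \<open>u\<close> bounds the source of the
  \<open>v\<close> equation, with a logarithmic loss; the \<open>v\<close> equation is then used on
  short windows without further loss; the resulting source of the \<open>u\<close> equation has
  exactly the critical power (\<open>e2\<close>), so the new mean gains a logarithm. The first round
  is fed by the data of \<open>u\<close>.\<close>

lemma lifespan_bound_distinct_exponents:
  fixes b1 b2 :: "real \<Rightarrow> real" and u0 u1 v0 v1 :: "real ^ 'n \<Rightarrow> real" and p q R :: real
  defines "N \<equiv> (real CARD('n) - 1) / 2"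
  assumes p: "1 < p" and q: "1 < q" and crit: "N * (p * q) = N + p + 2 + 1 / q" and R: "0 < R"
  shows "\<exists>C>0. \<forall>\<epsilon> T u ut v vt. 0 < \<epsilon> \<longrightarrow> \<epsilon> \<le> 1 \<longrightarrow>
     damped_wave b1 R \<epsilon> u0 u1 T u ut (\<lambda>s x. \<bar>v s x\<bar> powr p) \<longrightarrow>
     damped_wave b2 R \<epsilon> v0 v1 T v vt (\<lambda>s x. \<bar>u s x\<bar> powr q) \<longrightarrow>
     T \<le> ereal (exp (C * \<epsilon> powr - (q * (p * q - 1))))"
proof -
  define \<gamma> where "\<gamma> = 1 - 1 / q"
  define e where "e = 2 * N - N * q"
  have \<gamma>: "0 < \<gamma>" using q by (simp add: \<gamma>_def)
  have e2: "p * (2 + e) - (2 * N + 1) * (p - 1) = N + \<gamma> - 2"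
  proof -
    have "p * (2 + e) - (2 * N + 1) * (p - 1) = p + 2 * N + 1 - N * (p * q)" by (simp add: e_def algebra_simps)
    then show ?thesis unfolding crit by (simp add: \<gamma>_def)
  qed
  obtain cD where cD: "cD > 0" "\<And>\<epsilon> T u ut g t. damped_wave b1 R \<epsilon> u0 u1 T u ut g \<Longrightarrow> t \<in> time_interval T \<Longrightarrow> 1 \<le> t \<Longrightarrow>
     ennreal (cD * \<epsilon> powr q * (t + R + 2) powr e) \<le> (\<integral>\<^sup>+x. ennreal (\<bar>u t x\<bar> powr q) \<partial>lebesgue)"
    using source_growth_from_data[OF q, of b1 R u0 u1] unfolding N_def e_def by blast
  obtain cM where cM: "cM > 0" "\<And>b R \<epsilon> (w0 :: real ^ 'n \<Rightarrow> real) w1 T u ut g t x. damped_wave b R \<epsilon> w0 w1 T u ut g \<Longrightarrow> t \<in> time_interval T \<Longrightarrow>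
     0 \<le> x \<Longrightarrow> x \<le> (t + R + 2) powr (\<gamma> - N) * cone_mean R \<gamma> u t \<Longrightarrow>
     ennreal (cM * x powr q * ln (t + R + 2) powr - (q - 1) * (t + R + 2) powr e) \<le> (\<integral>\<^sup>+x. ennreal (\<bar>u t x\<bar> powr q) \<partial>lebesgue)"
    using source_growth_from_mean[OF q, where 'n='n] unfolding N_def e_def \<gamma>_def by blast
  obtain cS where cS: "cS > 0" "\<And>\<epsilon> (w0 :: real ^ 'n \<Rightarrow> real) w1 T u ut g t \<kappa> K. damped_wave b2 R \<epsilon> w0 w1 T u ut g \<Longrightarrow> t \<in> time_interval T \<Longrightarrow>
     0 < \<kappa> \<Longrightarrow> \<kappa> \<le> 1 / 2 \<Longrightarrow> 0 \<le> K \<Longrightarrow> R + 2 \<le> (1 - \<kappa>) * (t + R + 2) \<Longrightarrow>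
     (\<forall>s\<in>{0..t}. (1 - \<kappa>) * (t + R + 2) \<le> s + R + 2 \<longrightarrow> ennreal (K * (s + R + 2) powr e) \<le> (\<integral>\<^sup>+x. ennreal (g s x) \<partial>lebesgue)) \<Longrightarrow>
     ennreal (cS * \<kappa> powr (2 * p) * K powr p * (t + R + 2) powr (N + \<gamma> - 2)) \<le> (\<integral>\<^sup>+x. ennreal (\<bar>u t x\<bar> powr p) \<partial>lebesgue)"
    using source_growth_from_source[OF p, of b2 R e, where 'n='n, folded N_def, unfolded e2] by blast
  obtain cX where cX: "cX > 0" "\<And>\<epsilon> (w0 :: real ^ 'n \<Rightarrow> real) w1 T u ut g t \<kappa> K l \<beta>. damped_wave b1 R \<epsilon> w0 w1 T u ut g \<Longrightarrow> t \<in> time_interval T \<Longrightarrow>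
     0 < \<kappa> \<Longrightarrow> \<kappa> \<le> 1 / 2 \<Longrightarrow> 0 \<le> K \<Longrightarrow> 0 \<le> \<beta> \<Longrightarrow> R + 2 \<le> l \<Longrightarrow> l \<le> (1 - \<kappa>) * (t + R + 2) \<Longrightarrow>
     (\<forall>s\<in>{0..t}. l \<le> s + R + 2 \<longrightarrow> ennreal (K * ln ((s + R + 2) / l) powr \<beta> * (s + R + 2) powr (N + \<gamma> - 2)) \<le> (\<integral>\<^sup>+x. ennreal (g s x) \<partial>lebesgue)) \<Longrightarrow>
     cX * \<kappa> * K * ln ((1 - \<kappa>) * (t + R + 2) / l) powr (\<beta> + 1) / (\<beta> + 1) \<le> (t + R + 2) powr (\<gamma> - N) * cone_mean R \<gamma> u t"
    using mean_growth_from_critical_source[OF \<gamma>, of b1 R, where 'n='n, folded N_def] by blast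
  define P where "P = p * q"
  \<comment> \<open>\<open>m\<close> collects \<open>\<kappa> powr (2 * p)\<close> from the
    \<open>v\<close> equation and one \<kappa> from the \<open>u\<close> equation. The exponent
    \<open>a\<close> is the loss \<open>q - 1\<close> of logarithms, raised to the power
    \<open>p\<close> on its way through the \<open>v\<close> equation.\<close>
  define m where "m = 2 * p + 1"
  define a where "a = p * (q - 1)"
  define c where "c = cX * cS * cM powr p * (1 / 4) powr m"
  define d1 where "d1 = cX * (1 / 2) * (cS * (1 / 2) powr (2 * p) * cD powr p)"
  \<comment> \<open>The data bound starts at \<open>t = 1\<close>, that is at \<open>R + 3\<close>
    on the scale \<open>t + R + 2\<close>. The first round uses \<kappa> = 1/2 and cuts by
    \<open>1 - \<kappa>\<close> twice, hence the factor 4.\<close>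
  define l0 where "l0 = 4 * (R + 3)"
  define M where "M = iteration_threshold P c m"
  \<comment> \<open>The first summand makes \<Lambda> exceed the iteration threshold, the second
    leaves room for the slices below \<Lambda>/2.\<close>
  define C where "C = (M / d1 powr (P - 1)) powr (1 / p) + 2 * (ln l0 + 2)"
  have P: "1 < P" using p q by (simp add: P_def less_1_mult)
  have Pa: "P - a = p" by (simp add: P_def a_def algebra_simps)
  have c: "0 < c" using cX cS cM by (simp add: c_def)
  have d1: "0 < d1" using cX cS cD by (simp add: d1_def)
  have l0: "1 < l0" using R by (simp add: l0_def)
  have M: "0 < M" using P c by (simp add: M_def iteration_threshold_def)
  have lnl0: "0 < ln l0" using l0 by simp
  have C: "0 < C" using lnl0 by (simp add: C_def add_nonneg_pos)
  have "T \<le> ereal (exp (C * \<epsilon> powr - (q * (p * q - 1))))"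
    if eps: "0 < \<epsilon>" "\<epsilon> \<le> 1"
      and dwu: "damped_wave b1 R \<epsilon> u0 u1 T u ut (\<lambda>s x. \<bar>v s x\<bar> powr p)"
      and dwv: "damped_wave b2 R \<epsilon> v0 v1 T v vt (\<lambda>s x. \<bar>u s x\<bar> powr q)" for \<epsilon> T u ut v vt
  proof (rule ccontr)
    define \<Lambda> where "\<Lambda> = C * \<epsilon> powr - (q * (p * q - 1))"
    assume "\<not> T \<le> ereal (exp (C * \<epsilon> powr - (q * (p * q - 1))))"
    then have T: "ereal (exp \<Lambda>) < T" by (simp add: \<Lambda>_def)
    have qP: "0 < q * (p * q - 1)" using q P by (simp add: P_def)
    have eps1: "1 \<le> \<epsilon> powr - (q * (p * q - 1))"
      using powr_mono2'[of "- (q * (p * q - 1))" \<epsilon> 1] eps qP by simp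
    have LC: "C \<le> \<Lambda>" using mult_left_mono[OF eps1, of C] C by (simp add: \<Lambda>_def)
    have L2: "ln l0 + 2 \<le> \<Lambda> / 2"
    proof -
      have "2 * (ln l0 + 2) \<le> C" by (simp add: C_def)
      then have "2 * (ln l0 + 2) \<le> \<Lambda>" using LC by (rule order_trans)
      then show ?thesis by simp
    qed
    have L1: "0 < \<Lambda>" using LC C by linarith
    \<comment> \<open>The time at which \<open>ts + R + 2 = exp \<Lambda>\<close>; the assumption to
      be refuted places it inside the lifespan.\<close>
    define ts where "ts = exp \<Lambda> - (R + 2)"
    have ts0: "0 \<le> ts"
    proof -
      have "ln l0 \<le> \<Lambda>" using L2 lnl0 by linarith
      then have "exp (ln l0) \<le> exp \<Lambda>" by simp
      then have "l0 \<le> exp \<Lambda>" using l0 by simp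
      then show ?thesis using R by (simp add: ts_def l0_def)
    qed
    have tsI: "ts \<in> time_interval T"
    proof -
      have "ereal ts < ereal (exp \<Lambda>)" using R by (simp add: ts_def)
      then have "ereal ts < T" using T by (rule less_trans)
      then show ?thesis using ts0 by (simp add: time_interval_def)
    qed
    have tI: "t \<in> time_interval T" if "t \<in> {0..ts}" for t
      using that tsI by (auto simp: time_interval_def intro: le_less_trans[rotated])
    have two_step: "cX * \<kappa> * (cS * \<kappa> powr (2 * p) * K powr p) * ln ((1 - \<kappa>)\<^sup>2 * (t + R + 2) / l) powr (p * \<beta> + 1) / (p * \<beta> + 1)
        \<le> (t + R + 2) powr (\<gamma> - N) * cone_mean R \<gamma> u t"
      if src: "\<And>s. s \<in> {0..ts} \<Longrightarrow> l \<le> s + R + 2 \<Longrightarrow>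
            ennreal (K * ln ((s + R + 2) / l) powr \<beta> * (s + R + 2) powr e) \<le> (\<integral>\<^sup>+x. ennreal (\<bar>u s x\<bar> powr q) \<partial>lebesgue)"
        and K: "0 \<le> K" and \<beta>: "0 \<le> \<beta>" and l: "R + 2 \<le> l" and \<kappa>: "0 < \<kappa>" "\<kappa> \<le> 1 / 2"
        and t: "t \<in> {0..ts}" and lt: "l \<le> (1 - \<kappa>)\<^sup>2 * (t + R + 2)" for K \<beta> l \<kappa> t
    proof -
      \<comment> \<open>On the window that ends at \<open>s\<close>, the logarithm is bounded below
        by its value at the left end \<open>(1 - \<kappa>) * (s + R + 2)\<close>, which is
        \<open>ln ((s + R + 2) / l')\<close>. This value serves as the constant for the
        \<open>v\<close> equation.\<close>
      define l' where "l' = l / (1 - \<kappa>)"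
      have k1: "0 < 1 - \<kappa>" using \<kappa> by simp
      have lpos: "0 < l" using l R by simp
      have ll': "l \<le> l'" using k1 \<kappa> lpos by (simp add: l'_def pos_le_divide_eq algebra_simps)
      have "ennreal ((cS * \<kappa> powr (2 * p) * K powr p) * ln ((s + R + 2) / l') powr (p * \<beta>) * (s + R + 2) powr (N + \<gamma> - 2))
          \<le> (\<integral>\<^sup>+x. ennreal (\<bar>v s x\<bar> powr p) \<partial>lebesgue)" if s: "s \<in> {0..ts}" "l' \<le> s + R + 2" for s
      proof -
        have ls: "l \<le> (1 - \<kappa>) * (s + R + 2)" using s k1 by (simp add: l'_def pos_divide_le_eq mult.commute)
        have eq: "(s + R + 2) / l' = (1 - \<kappa>) * (s + R + 2) / l" using k1 by (simp add: l'_def)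
        have ln0: "0 \<le> ln ((s + R + 2) / l')" unfolding eq using ls lpos by simp
        have "ennreal (cS * \<kappa> powr (2 * p) * (K * ln ((s + R + 2) / l') powr \<beta>) powr p * (s + R + 2) powr (N + \<gamma> - 2)) \<le> (\<integral>\<^sup>+x. ennreal (\<bar>v s x\<bar> powr p) \<partial>lebesgue)"
        proof (rule cS(2)[OF dwv tI[OF s(1)] \<kappa>])
          show "\<forall>r\<in>{0..s}. (1 - \<kappa>) * (s + R + 2) \<le> r + R + 2 \<longrightarrow>
            ennreal (K * ln ((s + R + 2) / l') powr \<beta> * (r + R + 2) powr e) \<le> (\<integral>\<^sup>+x. ennreal (\<bar>u r x\<bar> powr q) \<partial>lebesgue)"
          proof (intro ballI impI)
            fix r assume r: "r \<in> {0..s}" "(1 - \<kappa>) * (s + R + 2) \<le> r + R + 2"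
            have "ln ((s + R + 2) / l') \<le> ln ((r + R + 2) / l)"
              unfolding eq using r ls lpos by (intro ln_mono divide_right_mono) auto
            then have "K * ln ((s + R + 2) / l') powr \<beta> * (r + R + 2) powr e \<le> K * ln ((r + R + 2) / l) powr \<beta> * (r + R + 2) powr e"
              using ln0 K \<beta> by (intro mult_right_mono mult_left_mono powr_mono2) auto
            then have "ennreal (K * ln ((s + R + 2) / l') powr \<beta> * (r + R + 2) powr e) \<le> ennreal (K * ln ((r + R + 2) / l) powr \<beta> * (r + R + 2) powr e)"
              by (rule ennreal_leI)
            also have "\<dots> \<le> (\<integral>\<^sup>+x. ennreal (\<bar>u r x\<bar> powr q) \<partial>lebesgue)"
              using r s ls by (intro src) auto
            finally show "ennreal (K * ln ((s + R + 2) / l') powr \<beta> * (r + R + 2) powr e) \<le> (\<integral>\<^sup>+x. ennreal (\<bar>u r x\<bar> powr q) \<partial>lebesgue)" .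
          qed
        qed (use K l ls in auto)
        moreover have "(K * ln ((s + R + 2) / l') powr \<beta>) powr p = K powr p * ln ((s + R + 2) / l') powr (p * \<beta>)"
          using K by (simp add: powr_mult powr_powr mult.commute)
        ultimately show ?thesis by (simp only: mult.assoc)
      qed
      then have "cX * \<kappa> * (cS * \<kappa> powr (2 * p) * K powr p) * ln ((1 - \<kappa>) * (t + R + 2) / l') powr (p * \<beta> + 1) / (p * \<beta> + 1)
        \<le> (t + R + 2) powr (\<gamma> - N) * cone_mean R \<gamma> u t"
        using p \<beta> cS(1) K l ll' t lt k1
        by (intro cX(2)[OF dwu tI[OF t] \<kappa>]) (auto simp: l'_def pos_divide_le_eq power2_eq_square mult_ac)
      moreover have "(1 - \<kappa>) * (t + R + 2) / l' = (1 - \<kappa>)\<^sup>2 * (t + R + 2) / l" using k1 by (simp add: l'_def power2_eq_square)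
      ultimately show ?thesis by simp
    qed
    \<comment> \<open>The bound is claimed only up to \<open>ts\<close>, so that every logarithm
      lost in Hoelder's inequality is at most \<Lambda>.\<close>
    define Q where "Q D l \<beta> \<longleftrightarrow> (\<forall>t\<in>{0..ts}. l \<le> t + R + 2 \<longrightarrow>
        D * ln ((t + R + 2) / l) powr \<beta> \<le> (t + R + 2) powr (\<gamma> - N) * cone_mean R \<gamma> u t)" for D l \<beta>
    define d0 where "d0 = d1 * \<epsilon> powr P"
    have d0: "0 < d0" using d1 eps by (simp add: d0_def)
    have base: "Q d0 l0 1"
      unfolding Q_def
    proof (intro ballI impI)
      fix t assume t: "t \<in> {0..ts}" "l0 \<le> t + R + 2"
      have "cX * (1/2) * (cS * (1/2) powr (2 * p) * (cD * \<epsilon> powr q) powr p) * ln ((1 - 1/2)\<^sup>2 * (t + R + 2) / (R + 3)) powr (p * 0 + 1) / (p * 0 + 1)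
        \<le> (t + R + 2) powr (\<gamma> - N) * cone_mean R \<gamma> u t"
      proof (rule two_step)
        fix s assume s: "s \<in> {0..ts}" "R + 3 \<le> s + R + 2"
        \<comment> \<open>Only an inequality, since \<open>0 powr 0 = 0\<close> and the logarithm
          vanishes at \<open>s = 1\<close>.\<close>
        have "cD * \<epsilon> powr q * ln ((s + R + 2) / (R + 3)) powr 0 * (s + R + 2) powr e \<le> cD * \<epsilon> powr q * 1 * (s + R + 2) powr e"
          using cD(1) by (intro mult_right_mono mult_left_mono) auto
        then have "ennreal (cD * \<epsilon> powr q * ln ((s + R + 2) / (R + 3)) powr 0 * (s + R + 2) powr e) \<le> ennreal (cD * \<epsilon> powr q * (s + R + 2) powr e)"
          by (intro ennreal_leI) simp
        also have "\<dots> \<le> (\<integral>\<^sup>+x. ennreal (\<bar>u s x\<bar> powr q) \<partial>lebesgue)"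
          using s by (intro cD(2)[OF dwu tI]) auto
        finally show "ennreal (cD * \<epsilon> powr q * ln ((s + R + 2) / (R + 3)) powr 0 * (s + R + 2) powr e) \<le> (\<integral>\<^sup>+x. ennreal (\<bar>u s x\<bar> powr q) \<partial>lebesgue)" .
      qed (use cD(1) t in \<open>auto simp: l0_def power2_eq_square\<close>)
      moreover have "(1 - 1/2)\<^sup>2 * (t + R + 2) / (R + 3) = (t + R + 2) / l0" by (simp add: l0_def power2_eq_square)
      moreover have "cX * (1/2) * (cS * (1/2) powr (2 * p) * (cD * \<epsilon> powr q) powr p) = d0"
        using cD(1) by (simp add: d0_def d1_def P_def powr_mult powr_powr mult.commute)
      ultimately show "d0 * ln ((t + R + 2) / l0) powr 1 \<le> (t + R + 2) powr (\<gamma> - N) * cone_mean R \<gamma> u t" by simp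
    qed
    show False
    proof (rule logarithmic_slicing_iteration[where Q=Q and m=m and a=a and X="exp \<Lambda> powr (\<gamma> - N) * cone_mean R \<gamma> u ts", OF P c _ _ d0 base _ _ L1 L2])
      show "0 \<le> m" using p by (simp add: m_def)
      show "0 < l0" using l0 by simp
      \<comment> \<open>\<open>d0 powr (P - 1)\<close> carries \<epsilon> to the power P(P-1) and
        \<Lambda> enters with exponent \<open>P - a = p\<close>. The two balance precisely for the
        lifespan exponent P(P-1)/p = q(pq-1), and the constants are covered by
        \<open>C\<close>.\<close>
      show "iteration_threshold P c m \<le> \<Lambda> powr (P - a) * d0 powr (P - 1)"
      proof -
        have "M / d1 powr (P - 1) = ((M / d1 powr (P - 1)) powr (1 / p)) powr p"
          using p M d1 by (simp add: powr_powr)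
        also have "\<dots> \<le> C powr p" using p lnl0 by (intro powr_mono2) (auto simp: C_def)
        finally have "M \<le> C powr p * d1 powr (P - 1)" using d1 by (simp add: pos_divide_le_eq)
        also have "\<dots> = \<Lambda> powr p * d0 powr (P - 1)"
        proof -
          have "\<Lambda> powr p = C powr p * \<epsilon> powr (- (P * (P - 1)))"
            using C by (simp add: \<Lambda>_def powr_mult powr_powr P_def mult_ac)
          moreover have "d0 powr (P - 1) = d1 powr (P - 1) * \<epsilon> powr (P * (P - 1))"
            using d1 by (simp add: d0_def powr_mult powr_powr)
          moreover have "\<epsilon> powr (- (P * (P - 1))) * \<epsilon> powr (P * (P - 1)) = 1"
            unfolding powr_add[symmetric] using eps by simp
          ultimately show ?thesis by (simp add: mult_ac)
        qed
        finally show ?thesis unfolding Pa M_def .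
      qed
    next
      fix D l \<beta> :: real assume D: "0 < D" and l: "l0 \<le> l" "ln l \<le> \<Lambda> / 2" and \<beta>: "1 \<le> \<beta>" and Q: "Q D l \<beta>"
      have lp: "0 < l" using l l0 by simp
      have le: "l \<le> exp \<Lambda>" using l lp L1 exp_le_cancel_iff[of "ln l" \<Lambda>] by simp
      have e1: "ts + R + 2 = exp \<Lambda>" by (simp add: ts_def)
      have "D * ln (exp \<Lambda> / l) powr \<beta> \<le> exp \<Lambda> powr (\<gamma> - N) * cone_mean R \<gamma> u ts"
        using Q[unfolded Q_def, rule_format, of ts] ts0 le unfolding e1 by simp
      moreover have "ln (exp \<Lambda> / l) = \<Lambda> - ln l" using lp by (simp add: ln_div)
      ultimately have *: "D * (\<Lambda> - ln l) powr \<beta> \<le> exp \<Lambda> powr (\<gamma> - N) * cone_mean R \<gamma> u ts" by simp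
      show "D * (\<Lambda> / 2) powr \<beta> \<le> exp \<Lambda> powr (\<gamma> - N) * cone_mean R \<gamma> u ts"
      proof -
        have "(\<Lambda> / 2) powr \<beta> \<le> (\<Lambda> - ln l) powr \<beta>" using l L1 \<beta> by (intro powr_mono2) auto
        then have "D * (\<Lambda> / 2) powr \<beta> \<le> D * (\<Lambda> - ln l) powr \<beta>" using D by (intro mult_left_mono) auto
        then show ?thesis using * by linarith
      qed
    next
      fix D l \<beta> \<delta> :: real assume D: "0 < D" and l: "l0 \<le> l" and \<beta>: "1 \<le> \<beta>" and \<delta>: "0 < \<delta>" "\<delta> \<le> 1" and Q: "Q D l \<beta>"
      \<comment> \<open>Each of the two equations of a round cuts by \<open>1 - \<kappa>\<close>.
        With this \<kappa> the two cuts together shift \<open>l\<close> to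
        \<open>l * exp \<delta>\<close>, while \<open>\<delta> / 4 \<le> \<kappa>\<close> retains
        the power of \<delta>.\<close>
      define \<kappa> where "\<kappa> = 1 - exp (- (\<delta> / 2))"
      have \<kappa>: "0 < \<kappa>" "\<kappa> \<le> 1 / 2" "\<delta> / 4 \<le> \<kappa>"
        using one_minus_exp_bounds[of "\<delta> / 2"] \<delta> by (auto simp: \<kappa>_def)
      have k2: "(1 - \<kappa>)\<^sup>2 = exp (- \<delta>)" by (simp add: \<kappa>_def power2_eq_square exp_add[symmetric])
      define K where "K = cM * D powr q * \<Lambda> powr - (q - 1)"
      have K0: "0 \<le> K" using cM by (simp add: K_def)
      show "Q (c * \<delta> powr m * \<Lambda> powr - a * D powr P / (P * \<beta> + 1)) (l * exp \<delta>) (P * \<beta> + 1)"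
        unfolding Q_def
      proof (intro ballI impI)
        fix t assume t: "t \<in> {0..ts}" "l * exp \<delta> \<le> t + R + 2"
        have "l = l * exp \<delta> * exp (- \<delta>)" by (simp add: mult.assoc exp_add[symmetric])
        also have "\<dots> \<le> (t + R + 2) * exp (- \<delta>)" using t by (intro mult_right_mono) auto
        finally have lt: "l \<le> (1 - \<kappa>)\<^sup>2 * (t + R + 2)" unfolding k2 by (simp only: mult.commute)
        have "cX * \<kappa> * (cS * \<kappa> powr (2 * p) * K powr p) * ln ((1 - \<kappa>)\<^sup>2 * (t + R + 2) / l) powr (p * (q * \<beta>) + 1) / (p * (q * \<beta>) + 1)
          \<le> (t + R + 2) powr (\<gamma> - N) * cone_mean R \<gamma> u t"
        proof (rule two_step[OF _ K0 _ _ \<kappa>(1,2) t(1) lt])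
          fix s assume s: "s \<in> {0..ts}" "l \<le> s + R + 2"
          define y where "y = s + R + 2"
          have y: "l \<le> y" "y \<le> exp \<Lambda>" using s by (auto simp: y_def ts_def)
          have y1: "1 < y" using y l l0 by simp
          have lny: "0 < ln y" "ln y \<le> \<Lambda>" using y y1 by (auto simp: ln_le_cancel_iff[of y "exp \<Lambda>", symmetric])
          have lnyl: "0 \<le> ln (y / l)" using y l l0 by simp
          have "K * ln (y / l) powr (q * \<beta>) * y powr e = cM * (D * ln (y / l) powr \<beta>) powr q * \<Lambda> powr - (q - 1) * y powr e"
            using D by (simp add: K_def powr_mult powr_powr mult_ac)
          \<comment> \<open>The logarithm occurs with a negative power and is at most \<Lambda> up
            to \<open>ts\<close>; trading it for \<Lambda> makes the loss of the whole round a
            constant.\<close>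
          also have "\<dots> \<le> cM * (D * ln (y / l) powr \<beta>) powr q * ln y powr - (q - 1) * y powr e"
            using cM(1) q lny L1 by (intro mult_right_mono mult_left_mono powr_mono2') auto
          finally have "ennreal (K * ln (y / l) powr (q * \<beta>) * y powr e) \<le> ennreal (cM * (D * ln (y / l) powr \<beta>) powr q * ln y powr - (q - 1) * y powr e)"
            by (rule ennreal_leI)
          also have "\<dots> \<le> (\<integral>\<^sup>+x. ennreal (\<bar>u s x\<bar> powr q) \<partial>lebesgue)"
            unfolding y_def
            by (rule cM(2)[OF dwu tI[OF s(1)]]) (use D Q s in \<open>auto simp: Q_def\<close>)
          finally show "ennreal (K * ln ((s + R + 2) / l) powr (q * \<beta>) * (s + R + 2) powr e) \<le> (\<integral>\<^sup>+x. ennreal (\<bar>u s x\<bar> powr q) \<partial>lebesgue)"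
            unfolding y_def .
        qed (use q \<beta> l R in \<open>auto simp: l0_def\<close>)
        moreover have "(1 - \<kappa>)\<^sup>2 * (t + R + 2) / l = (t + R + 2) / (l * exp \<delta>)"
          unfolding k2 by (simp add: exp_minus field_simps)
        moreover have "p * (q * \<beta>) = P * \<beta>" by (simp add: P_def)
        ultimately have *: "cX * \<kappa> * (cS * \<kappa> powr (2 * p) * K powr p) * ln ((t + R + 2) / (l * exp \<delta>)) powr (P * \<beta> + 1) / (P * \<beta> + 1)
          \<le> (t + R + 2) powr (\<gamma> - N) * cone_mean R \<gamma> u t" by simp
        have "c * \<delta> powr m * \<Lambda> powr - a * D powr P \<le> cX * \<kappa> * (cS * \<kappa> powr (2 * p) * K powr p)"
        proof -
          have "(\<delta> / 4) powr m \<le> \<kappa> powr m" using \<kappa> \<delta> p by (intro powr_mono2) (auto simp: m_def)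
          also have "\<kappa> powr m = \<kappa> * \<kappa> powr (2 * p)" using \<kappa> by (simp add: m_def powr_add)
          finally have "(1 / 4) powr m * \<delta> powr m \<le> \<kappa> * \<kappa> powr (2 * p)" using \<delta> by (simp add: powr_divide)
          then have "cX * cS * (cM powr p * \<Lambda> powr - a * D powr P) * ((1 / 4) powr m * \<delta> powr m)
             \<le> cX * cS * (cM powr p * \<Lambda> powr - a * D powr P) * (\<kappa> * \<kappa> powr (2 * p))"
            using cX cS by (intro mult_left_mono) auto
          moreover have "K powr p = cM powr p * \<Lambda> powr - a * D powr P"
          proof -
            have "q * p = P" "- (q - 1) * p = - a" by (simp_all add: P_def a_def algebra_simps)
            moreover have "K powr p = cM powr p * \<Lambda> powr (- (q - 1) * p) * D powr (q * p)"
              using cM(1) D L1 unfolding K_def by (simp only: powr_mult powr_powr mult_nonneg_nonneg powr_ge_zero less_imp_le mult_ac)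
            ultimately show ?thesis by (simp only:)
          qed
          ultimately show ?thesis by (simp add: c_def mult_ac)
        qed
        then have "c * \<delta> powr m * \<Lambda> powr - a * D powr P / (P * \<beta> + 1) * ln ((t + R + 2) / (l * exp \<delta>)) powr (P * \<beta> + 1)
           \<le> cX * \<kappa> * (cS * \<kappa> powr (2 * p) * K powr p) / (P * \<beta> + 1) * ln ((t + R + 2) / (l * exp \<delta>)) powr (P * \<beta> + 1)"
          using P \<beta> by (intro mult_right_mono divide_right_mono) auto
        then show "c * \<delta> powr m * \<Lambda> powr - a * D powr P / (P * \<beta> + 1) * ln ((t + R + 2) / (l * exp \<delta>)) powr (P * \<beta> + 1)
           \<le> (t + R + 2) powr (\<gamma> - N) * cone_mean R \<gamma> u t" using * by simp
      qed
    qed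
  qed
  with C show ?thesis by blast
qed

text \<open>For equal exponents both means are critical and the two source powers coincide
  (\<open>e2\<close>). Carrying the smaller of the two normalised means makes a single pass through
  either equation a full round, so the superlinear power is \<open>p\<close> instead of
  \<open>p * p\<close>. This gives the exponent p(p-1), sharper than the p(p^2-1) of the two-step
  argument, and it uses the data of both components.\<close>

lemma lifespan_bound_equal_exponents:
  fixes b1 b2 :: "real \<Rightarrow> real" and u0 u1 v0 v1 :: "real ^ 'n \<Rightarrow> real" and p R :: real
  defines "N \<equiv> (real CARD('n) - 1) / 2"
  assumes p: "1 < p" and crit: "N * (p - 1) = 1 + 1 / p" and R: "0 < R"
  shows "\<exists>C>0. \<forall>\<epsilon> T u ut v vt. 0 < \<epsilon> \<longrightarrow> \<epsilon> \<le> 1 \<longrightarrow>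
     damped_wave b1 R \<epsilon> u0 u1 T u ut (\<lambda>s x. \<bar>v s x\<bar> powr p) \<longrightarrow>
     damped_wave b2 R \<epsilon> v0 v1 T v vt (\<lambda>s x. \<bar>u s x\<bar> powr p) \<longrightarrow>
     T \<le> ereal (exp (C * \<epsilon> powr - (p * (p - 1))))"
proof -
  define \<gamma> where "\<gamma> = 1 - 1 / p"
  define e where "e = 2 * N - N * p"
  have \<gamma>: "0 < \<gamma>" using p by (simp add: \<gamma>_def)
  have e2: "N + \<gamma> - 2 = e"
  proof -
    have "e = N - N * (p - 1)" by (simp add: e_def algebra_simps)
    then show ?thesis unfolding crit by (simp add: \<gamma>_def)
  qed
  have data: "\<exists>c>0. \<forall>\<epsilon> T u ut g t. damped_wave b R \<epsilon> w0 w1 T u ut g \<longrightarrow> t \<in> time_interval T \<longrightarrow> 1 \<le> t \<longrightarrow>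
     ennreal (c * \<epsilon> powr p * (t + R + 2) powr e) \<le> (\<integral>\<^sup>+x. ennreal (\<bar>u t x\<bar> powr p) \<partial>lebesgue)"
    for b and w0 w1 :: "real ^ 'n \<Rightarrow> real"
    using source_growth_from_data[OF p, of b R w0 w1] unfolding N_def e_def .
  obtain c1 where c1: "c1 > 0" "\<And>\<epsilon> T u ut g t. damped_wave b1 R \<epsilon> u0 u1 T u ut g \<Longrightarrow> t \<in> time_interval T \<Longrightarrow> 1 \<le> t \<Longrightarrow>
     ennreal (c1 * \<epsilon> powr p * (t + R + 2) powr e) \<le> (\<integral>\<^sup>+x. ennreal (\<bar>u t x\<bar> powr p) \<partial>lebesgue)"
    using data[of b1 u0 u1] by blast
  obtain c2 where c2: "c2 > 0" "\<And>\<epsilon> T u ut g t. damped_wave b2 R \<epsilon> v0 v1 T u ut g \<Longrightarrow> t \<in> time_interval T \<Longrightarrow> 1 \<le> t \<Longrightarrow>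
     ennreal (c2 * \<epsilon> powr p * (t + R + 2) powr e) \<le> (\<integral>\<^sup>+x. ennreal (\<bar>u t x\<bar> powr p) \<partial>lebesgue)"
    using data[of b2 v0 v1] by blast
  define cD where "cD = min c1 c2"
  have cD: "cD > 0" "cD \<le> c1" "cD \<le> c2" using c1 c2 by (auto simp: cD_def)
  obtain cM where cM: "cM > 0" "\<And>b R \<epsilon> (w0 :: real ^ 'n \<Rightarrow> real) w1 T u ut g t x. damped_wave b R \<epsilon> w0 w1 T u ut g \<Longrightarrow> t \<in> time_interval T \<Longrightarrow>
     0 \<le> x \<Longrightarrow> x \<le> (t + R + 2) powr (\<gamma> - N) * cone_mean R \<gamma> u t \<Longrightarrow>
     ennreal (cM * x powr p * ln (t + R + 2) powr - (p - 1) * (t + R + 2) powr e) \<le> (\<integral>\<^sup>+x. ennreal (\<bar>u t x\<bar> powr p) \<partial>lebesgue)"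
    using source_growth_from_mean[OF p, where 'n='n] unfolding N_def e_def \<gamma>_def by blast
  have growth: "\<exists>c>0. \<forall>\<epsilon> (w0 :: real ^ 'n \<Rightarrow> real) w1 T u ut g t \<kappa> K l \<beta>. damped_wave b R \<epsilon> w0 w1 T u ut g \<longrightarrow> t \<in> time_interval T \<longrightarrow>
     0 < \<kappa> \<longrightarrow> \<kappa> \<le> 1 / 2 \<longrightarrow> 0 \<le> K \<longrightarrow> 0 \<le> \<beta> \<longrightarrow> R + 2 \<le> l \<longrightarrow> l \<le> (1 - \<kappa>) * (t + R + 2) \<longrightarrow>
     (\<forall>s\<in>{0..t}. l \<le> s + R + 2 \<longrightarrow> ennreal (K * ln ((s + R + 2) / l) powr \<beta> * (s + R + 2) powr e) \<le> (\<integral>\<^sup>+x. ennreal (g s x) \<partial>lebesgue)) \<longrightarrow>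
     c * \<kappa> * K * ln ((1 - \<kappa>) * (t + R + 2) / l) powr (\<beta> + 1) / (\<beta> + 1) \<le> (t + R + 2) powr (\<gamma> - N) * cone_mean R \<gamma> u t" for b
    using mean_growth_from_critical_source[OF \<gamma>, of b R, where 'n='n, folded N_def, unfolded e2] .
  obtain x1 where x1: "x1 > 0" "\<And>\<epsilon> (w0 :: real ^ 'n \<Rightarrow> real) w1 T u ut g t \<kappa> K l \<beta>. damped_wave b1 R \<epsilon> w0 w1 T u ut g \<Longrightarrow> t \<in> time_interval T \<Longrightarrow>
     0 < \<kappa> \<Longrightarrow> \<kappa> \<le> 1 / 2 \<Longrightarrow> 0 \<le> K \<Longrightarrow> 0 \<le> \<beta> \<Longrightarrow> R + 2 \<le> l \<Longrightarrow> l \<le> (1 - \<kappa>) * (t + R + 2) \<Longrightarrow>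
     (\<forall>s\<in>{0..t}. l \<le> s + R + 2 \<longrightarrow> ennreal (K * ln ((s + R + 2) / l) powr \<beta> * (s + R + 2) powr e) \<le> (\<integral>\<^sup>+x. ennreal (g s x) \<partial>lebesgue)) \<Longrightarrow>
     x1 * \<kappa> * K * ln ((1 - \<kappa>) * (t + R + 2) / l) powr (\<beta> + 1) / (\<beta> + 1) \<le> (t + R + 2) powr (\<gamma> - N) * cone_mean R \<gamma> u t"
    using growth[of b1] by blast
  obtain x2 where x2: "x2 > 0" "\<And>\<epsilon> (w0 :: real ^ 'n \<Rightarrow> real) w1 T u ut g t \<kappa> K l \<beta>. damped_wave b2 R \<epsilon> w0 w1 T u ut g \<Longrightarrow> t \<in> time_interval T \<Longrightarrow>
     0 < \<kappa> \<Longrightarrow> \<kappa> \<le> 1 / 2 \<Longrightarrow> 0 \<le> K \<Longrightarrow> 0 \<le> \<beta> \<Longrightarrow> R + 2 \<le> l \<Longrightarrow> l \<le> (1 - \<kappa>) * (t + R + 2) \<Longrightarrow>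
     (\<forall>s\<in>{0..t}. l \<le> s + R + 2 \<longrightarrow> ennreal (K * ln ((s + R + 2) / l) powr \<beta> * (s + R + 2) powr e) \<le> (\<integral>\<^sup>+x. ennreal (g s x) \<partial>lebesgue)) \<Longrightarrow>
     x2 * \<kappa> * K * ln ((1 - \<kappa>) * (t + R + 2) / l) powr (\<beta> + 1) / (\<beta> + 1) \<le> (t + R + 2) powr (\<gamma> - N) * cone_mean R \<gamma> u t"
    using growth[of b2] by blast
  define cX where "cX = min x1 x2"
  have cX: "cX > 0" "cX \<le> x1" "cX \<le> x2" using x1 x2 by (auto simp: cX_def)
  define a where "a = p - 1"
  define c where "c = cX * (1 / 4) * cM"
  define d1 where "d1 = cX * (1 / 2) * cD"
  \<comment> \<open>The start \<open>R + 3\<close> corresponds to \<open>t = 1\<close>; a single cut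
    with \<kappa> = 1/2 doubles it.\<close>
  define l0 where "l0 = 2 * (R + 3)"
  define M where "M = iteration_threshold p c 1"
  define C where "C = M / d1 powr (p - 1) + 2 * (ln l0 + 2)"
  have pa: "p - a = 1" by (simp add: a_def)
  have c: "0 < c" using cX cM by (simp add: c_def)
  have d1: "0 < d1" using cX cD by (simp add: d1_def)
  have l0: "1 < l0" using R by (simp add: l0_def)
  have M: "0 < M" using p c by (simp add: M_def iteration_threshold_def)
  have lnl0: "0 < ln l0" using l0 by simp
  have C: "0 < C" using lnl0 M d1 by (simp add: C_def add_pos_pos)
  have "T \<le> ereal (exp (C * \<epsilon> powr - (p * (p - 1))))"
    if eps: "0 < \<epsilon>" "\<epsilon> \<le> 1"
      and dwu: "damped_wave b1 R \<epsilon> u0 u1 T u ut (\<lambda>s x. \<bar>v s x\<bar> powr p)"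
      and dwv: "damped_wave b2 R \<epsilon> v0 v1 T v vt (\<lambda>s x. \<bar>u s x\<bar> powr p)" for \<epsilon> T u ut v vt
  proof (rule ccontr)
    define \<Lambda> where "\<Lambda> = C * \<epsilon> powr - (p * (p - 1))"
    assume "\<not> T \<le> ereal (exp (C * \<epsilon> powr - (p * (p - 1))))"
    then have T: "ereal (exp \<Lambda>) < T" by (simp add: \<Lambda>_def)
    have pp: "0 < p * (p - 1)" using p by simp
    have eps1: "1 \<le> \<epsilon> powr - (p * (p - 1))"
      using powr_mono2'[of "- (p * (p - 1))" \<epsilon> 1] eps pp by simp
    have LC: "C \<le> \<Lambda>" using mult_left_mono[OF eps1, of C] C by (simp add: \<Lambda>_def)
    have L2: "ln l0 + 2 \<le> \<Lambda> / 2"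
    proof -
      have "2 * (ln l0 + 2) \<le> C" using M d1 by (simp add: C_def)
      then have "2 * (ln l0 + 2) \<le> \<Lambda>" using LC by (rule order_trans)
      then show ?thesis by simp
    qed
    have L1: "0 < \<Lambda>" using LC C by linarith
    define ts where "ts = exp \<Lambda> - (R + 2)"
    have ts0: "0 \<le> ts"
    proof -
      have "ln l0 \<le> \<Lambda>" using L2 lnl0 by linarith
      then have "exp (ln l0) \<le> exp \<Lambda>" by simp
      then have "l0 \<le> exp \<Lambda>" using l0 by simp
      then show ?thesis using R by (simp add: ts_def l0_def)
    qed
    have tsI: "ts \<in> time_interval T"
    proof -
      have "ereal ts < ereal (exp \<Lambda>)" using R by (simp add: ts_def)
      then have "ereal ts < T" using T by (rule less_trans)
      then show ?thesis using ts0 by (simp add: time_interval_def)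
    qed
    have tI: "t \<in> time_interval T" if "t \<in> {0..ts}" for t
      using that tsI by (auto simp: time_interval_def intro: le_less_trans[rotated])
    define X where "X t = min ((t + R + 2) powr (\<gamma> - N) * cone_mean R \<gamma> u t) ((t + R + 2) powr (\<gamma> - N) * cone_mean R \<gamma> v t)" for t
    define S where "S t = min (\<integral>\<^sup>+x. ennreal (\<bar>u t x\<bar> powr p) \<partial>lebesgue) (\<integral>\<^sup>+x. ennreal (\<bar>v t x\<bar> powr p) \<partial>lebesgue)" for t
    have one_step: "cX * \<kappa> * K * ln ((1 - \<kappa>) * (t + R + 2) / l) powr (\<beta> + 1) / (\<beta> + 1) \<le> X t"
      if src: "\<And>s. s \<in> {0..ts} \<Longrightarrow> l \<le> s + R + 2 \<Longrightarrow> ennreal (K * ln ((s + R + 2) / l) powr \<beta> * (s + R + 2) powr e) \<le> S s"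
        and K: "0 \<le> K" and \<beta>: "0 \<le> \<beta>" and l: "R + 2 \<le> l" and \<kappa>: "0 < \<kappa>" "\<kappa> \<le> 1 / 2"
        and t: "t \<in> {0..ts}" and lt: "l \<le> (1 - \<kappa>) * (t + R + 2)" for K \<beta> l \<kappa> t
    proof -
      have s: "s \<in> {0..ts}" if "s \<in> {0..t}" for s using that t by auto
      have mono: "cX * \<kappa> * K * L / (\<beta> + 1) \<le> y * \<kappa> * K * L / (\<beta> + 1)" if "cX \<le> y" "0 \<le> L" for y L
        using that \<kappa> K \<beta> by (intro divide_right_mono mult_right_mono) auto
      have "x1 * \<kappa> * K * ln ((1 - \<kappa>) * (t + R + 2) / l) powr (\<beta> + 1) / (\<beta> + 1) \<le> (t + R + 2) powr (\<gamma> - N) * cone_mean R \<gamma> u t"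
        by (rule x1(2)[OF dwu tI[OF t] \<kappa> K \<beta> l lt]) (use src s in \<open>auto simp: S_def\<close>)
      moreover have "x2 * \<kappa> * K * ln ((1 - \<kappa>) * (t + R + 2) / l) powr (\<beta> + 1) / (\<beta> + 1) \<le> (t + R + 2) powr (\<gamma> - N) * cone_mean R \<gamma> v t"
        by (rule x2(2)[OF dwv tI[OF t] \<kappa> K \<beta> l lt]) (use src s in \<open>auto simp: S_def\<close>)
      ultimately show ?thesis unfolding X_def
        using order_trans[OF mono[OF cX(2)]] order_trans[OF mono[OF cX(3)]] by (simp add: powr_ge_zero)
    qed
    define Q where "Q D l \<beta> \<longleftrightarrow> (\<forall>t\<in>{0..ts}. l \<le> t + R + 2 \<longrightarrow> D * ln ((t + R + 2) / l) powr \<beta> \<le> X t)" for D l \<beta>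
    define d0 where "d0 = d1 * \<epsilon> powr p"
    have d0: "0 < d0" using d1 eps by (simp add: d0_def)
    have base: "Q d0 l0 1"
      unfolding Q_def
    proof (intro ballI impI)
      fix t assume t: "t \<in> {0..ts}" "l0 \<le> t + R + 2"
      have A: "cX * (1/2) * (cD * \<epsilon> powr p) * ln ((1 - 1/2) * (t + R + 2) / (R + 3)) powr (0 + 1) / (0 + 1) \<le> X t"
      proof (rule one_step)
        fix s assume s: "s \<in> {0..ts}" "R + 3 \<le> s + R + 2"
        have le: "ennreal (cD * \<epsilon> powr p * ln ((s + R + 2) / (R + 3)) powr 0 * (s + R + 2) powr e) \<le> ennreal (y * \<epsilon> powr p * (s + R + 2) powr e)"
          if "cD \<le> y" for y
        proof -
          have "cD * \<epsilon> powr p * ln ((s + R + 2) / (R + 3)) powr 0 * (s + R + 2) powr e \<le> y * \<epsilon> powr p * 1 * (s + R + 2) powr e"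
            using that cD(1) by (intro mult_mono) auto
          then show ?thesis by (intro ennreal_leI) simp
        qed
        have "ennreal (c1 * \<epsilon> powr p * (s + R + 2) powr e) \<le> (\<integral>\<^sup>+x. ennreal (\<bar>u s x\<bar> powr p) \<partial>lebesgue)"
          using s by (intro c1(2)[OF dwu tI]) auto
        moreover have "ennreal (c2 * \<epsilon> powr p * (s + R + 2) powr e) \<le> (\<integral>\<^sup>+x. ennreal (\<bar>v s x\<bar> powr p) \<partial>lebesgue)"
          using s by (intro c2(2)[OF dwv tI]) auto
        ultimately show "ennreal (cD * \<epsilon> powr p * ln ((s + R + 2) / (R + 3)) powr 0 * (s + R + 2) powr e) \<le> S s"
          unfolding S_def using order_trans[OF le[OF cD(2)]] order_trans[OF le[OF cD(3)]] by (simp only: min.bounded_iff)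
      qed (use cD(1) t in \<open>auto simp: l0_def\<close>)
      have e1: "(1 - 1/2) * (t + R + 2) / (R + 3) = (t + R + 2) / l0" by (simp add: l0_def)
      have e2: "cX * (1/2) * (cD * \<epsilon> powr p) = d0" by (simp add: d0_def d1_def)
      show "d0 * ln ((t + R + 2) / l0) powr 1 \<le> X t" using A unfolding e1 e2 by simp
    qed
    show False
    proof (rule logarithmic_slicing_iteration[where Q=Q and m=1 and a=a and X="X ts", OF p c _ _ d0 base _ _ L1 L2])
      show "0 < l0" using l0 by simp
      show "iteration_threshold p c 1 \<le> \<Lambda> powr (p - a) * d0 powr (p - 1)"
      proof -
        have "M / d1 powr (p - 1) \<le> C" using lnl0 by (simp add: C_def)
        then have "M \<le> C * d1 powr (p - 1)" using d1 by (simp add: pos_divide_le_eq)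
        also have "\<dots> = \<Lambda> * d0 powr (p - 1)"
        proof -
          have "d0 powr (p - 1) = d1 powr (p - 1) * \<epsilon> powr (p * (p - 1))"
            using d1 by (simp add: d0_def powr_mult powr_powr)
          moreover have "\<epsilon> powr - (p * (p - 1)) * \<epsilon> powr (p * (p - 1)) = 1"
            unfolding powr_add[symmetric] using eps by simp
          ultimately show ?thesis by (simp add: \<Lambda>_def mult_ac)
        qed
        finally show ?thesis unfolding pa M_def using L1 by simp
      qed
    next
      fix D l \<beta> :: real assume D: "0 < D" and l: "l0 \<le> l" "ln l \<le> \<Lambda> / 2" and \<beta>: "1 \<le> \<beta>" and Q: "Q D l \<beta>"
      have lp: "0 < l" using l l0 by simp
      have le: "l \<le> exp \<Lambda>" using l lp L1 exp_le_cancel_iff[of "ln l" \<Lambda>] by simp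
      have e1: "ts + R + 2 = exp \<Lambda>" by (simp add: ts_def)
      have "D * ln (exp \<Lambda> / l) powr \<beta> \<le> X ts"
        using Q[unfolded Q_def, rule_format, of ts] ts0 le unfolding e1 by simp
      moreover have "ln (exp \<Lambda> / l) = \<Lambda> - ln l" using lp by (simp add: ln_div)
      ultimately have *: "D * (\<Lambda> - ln l) powr \<beta> \<le> X ts" by simp
      have "(\<Lambda> / 2) powr \<beta> \<le> (\<Lambda> - ln l) powr \<beta>" using l L1 \<beta> by (intro powr_mono2) auto
      then have "D * (\<Lambda> / 2) powr \<beta> \<le> D * (\<Lambda> - ln l) powr \<beta>" using D by (intro mult_left_mono) auto
      then show "D * (\<Lambda> / 2) powr \<beta> \<le> X ts" using * by linarith
    next
      fix D l \<beta> \<delta> :: real assume D: "0 < D" and l: "l0 \<le> l" and \<beta>: "1 \<le> \<beta>" and \<delta>: "0 < \<delta>" "\<delta> \<le> 1" and Q: "Q D l \<beta>"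
      define \<kappa> where "\<kappa> = 1 - exp (- (\<delta> / 2))"
      have \<kappa>: "0 < \<kappa>" "\<kappa> \<le> 1 / 2" "\<delta> / 4 \<le> \<kappa>"
        using one_minus_exp_bounds[of "\<delta> / 2"] \<delta> by (auto simp: \<kappa>_def)
      define K where "K = cM * D powr p * \<Lambda> powr - a"
      have K0: "0 \<le> K" using cM by (simp add: K_def)
      show "Q (c * \<delta> powr 1 * \<Lambda> powr - a * D powr p / (p * \<beta> + 1)) (l * exp \<delta>) (p * \<beta> + 1)"
        unfolding Q_def
      proof (intro ballI impI)
        fix t assume t: "t \<in> {0..ts}" "l * exp \<delta> \<le> t + R + 2"
        show "c * \<delta> powr 1 * \<Lambda> powr - a * D powr p / (p * \<beta> + 1) * ln ((t + R + 2) / (l * exp \<delta>)) powr (p * \<beta> + 1) \<le> X t"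
        proof -
          define y where "y = t + R + 2"
          have lp: "0 < l" using l l0 by simp
          have y: "l * exp \<delta> \<le> y" using t by (simp add: y_def)
          have yp: "0 < y" using y lp by (meson exp_gt_zero less_le_trans mult_pos_pos)
          \<comment> \<open>A round makes only one cut here, and
            \<open>1 - \<kappa> = exp (- (\<delta> / 2))\<close> leaves slack against the required
            \<open>exp (- \<delta>)\<close>.\<close>
          have kd: "1 / (l * exp \<delta>) \<le> (1 - \<kappa>) / l"
          proof -
            have "exp (- \<delta>) \<le> 1 - \<kappa>" using \<delta> by (simp add: \<kappa>_def)
            then have "exp (- \<delta>) / l \<le> (1 - \<kappa>) / l" using lp by (intro divide_right_mono) auto
            then show ?thesis by (simp add: exp_minus divide_inverse mult.commute)
          qed
          have "1 / (l * exp \<delta>) * y \<le> (1 - \<kappa>) / l * y" using kd yp by (intro mult_right_mono) auto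
          then have q: "y / (l * exp \<delta>) \<le> (1 - \<kappa>) * y / l" by simp
          have q1: "1 \<le> y / (l * exp \<delta>)" using y lp by simp
          have lt: "l \<le> (1 - \<kappa>) * (t + R + 2)" using order_trans[OF q1 q] lp by (simp add: y_def)
          have "cX * \<kappa> * K * ln ((1 - \<kappa>) * (t + R + 2) / l) powr (p * \<beta> + 1) / (p * \<beta> + 1) \<le> X t"
          proof (rule one_step[OF _ K0 _ _ \<kappa>(1,2) t(1) lt])
            fix s assume s: "s \<in> {0..ts}" "l \<le> s + R + 2"
            define z where "z = s + R + 2"
            have z: "l \<le> z" "z \<le> exp \<Lambda>" using s by (auto simp: z_def ts_def)
            have z1: "1 < z" using z l l0 by simp
            have lnz: "0 < ln z" "ln z \<le> \<Lambda>" using z z1 by (auto simp: ln_le_cancel_iff[of z "exp \<Lambda>", symmetric])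
            have "K * ln (z / l) powr (p * \<beta>) * z powr e = cM * (D * ln (z / l) powr \<beta>) powr p * \<Lambda> powr - a * z powr e"
              using D by (simp add: K_def powr_mult powr_powr mult_ac)
            also have "\<dots> \<le> cM * (D * ln (z / l) powr \<beta>) powr p * ln z powr - (p - 1) * z powr e"
              using cM(1) p lnz L1 unfolding a_def by (intro mult_right_mono mult_left_mono powr_mono2') auto
            finally have le: "ennreal (K * ln (z / l) powr (p * \<beta>) * z powr e) \<le> ennreal (cM * (D * ln (z / l) powr \<beta>) powr p * ln z powr - (p - 1) * z powr e)"
              by (rule ennreal_leI)
            have D0: "0 \<le> D * ln (z / l) powr \<beta>" using D by simp
            have DX: "D * ln (z / l) powr \<beta> \<le> X s" using Q s unfolding Q_def z_def by blast
            have "ennreal (cM * (D * ln (z / l) powr \<beta>) powr p * ln z powr - (p - 1) * z powr e) \<le> (\<integral>\<^sup>+x. ennreal (\<bar>u s x\<bar> powr p) \<partial>lebesgue)"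
              unfolding z_def by (rule cM(2)[OF dwu tI[OF s(1)]]) (use D0 DX in \<open>auto simp: X_def z_def\<close>)
            moreover have "ennreal (cM * (D * ln (z / l) powr \<beta>) powr p * ln z powr - (p - 1) * z powr e) \<le> (\<integral>\<^sup>+x. ennreal (\<bar>v s x\<bar> powr p) \<partial>lebesgue)"
              unfolding z_def by (rule cM(2)[OF dwv tI[OF s(1)]]) (use D0 DX in \<open>auto simp: X_def z_def\<close>)
            ultimately show "ennreal (K * ln ((s + R + 2) / l) powr (p * \<beta>) * (s + R + 2) powr e) \<le> S s"
              using le unfolding S_def z_def[symmetric] by (auto intro: order_trans)
          qed (use p \<beta> l R in \<open>auto simp: l0_def\<close>)
          moreover have "c * \<delta> powr 1 * \<Lambda> powr - a * D powr p / (p * \<beta> + 1) * ln (y / (l * exp \<delta>)) powr (p * \<beta> + 1)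
             \<le> cX * \<kappa> * K * ln ((1 - \<kappa>) * y / l) powr (p * \<beta> + 1) / (p * \<beta> + 1)"
          proof -
            have "cX * cM * (D powr p * \<Lambda> powr - a) * (\<delta> / 4) \<le> cX * cM * (D powr p * \<Lambda> powr - a) * \<kappa>"
              using cX cM \<kappa> by (intro mult_left_mono) auto
            then have 1: "c * \<delta> powr 1 * \<Lambda> powr - a * D powr p \<le> cX * \<kappa> * K"
              using \<delta> by (simp add: c_def K_def mult_ac)
            have 2: "ln (y / (l * exp \<delta>)) powr (p * \<beta> + 1) \<le> ln ((1 - \<kappa>) * y / l) powr (p * \<beta> + 1)"
              using q q1 p \<beta> by (intro powr_mono2 ln_mono) auto
            have "c * \<delta> powr 1 * \<Lambda> powr - a * D powr p * ln (y / (l * exp \<delta>)) powr (p * \<beta> + 1)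
               \<le> cX * \<kappa> * K * ln ((1 - \<kappa>) * y / l) powr (p * \<beta> + 1)"
              using cX \<kappa> K0 by (intro mult_mono[OF 1 2]) auto
            then have "c * \<delta> powr 1 * \<Lambda> powr - a * D powr p * ln (y / (l * exp \<delta>)) powr (p * \<beta> + 1) / (p * \<beta> + 1)
               \<le> cX * \<kappa> * K * ln ((1 - \<kappa>) * y / l) powr (p * \<beta> + 1) / (p * \<beta> + 1)"
              using p \<beta> by (intro divide_right_mono) auto
            then show ?thesis by simp
          qed
          ultimately show ?thesis unfolding y_def by linarith
        qed
      qed
    qed auto
  qed
  with C show ?thesis by blast
qed

section \<open>From energy solutions to two instances of the damped equation\<close>

lemma damped_waveI:
  fixes u v ut :: "real \<Rightarrow> real ^ 'n \<Rightarrow> real" and r R \<epsilon> :: real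
  assumes "C1_halfline b" "b absolutely_integrable_on {0..}" "\<forall>t\<ge>0. b t \<ge> 0" "R > 0" "0 < \<epsilon>" "0 < T"
    and "H1 w0" "L2 w1" "AE x in lebesgue. w0 x \<ge> 0" "AE x in lebesgue. w1 x \<ge> 0"
    and "\<not> ((AE x in lebesgue. w0 x = 0) \<and> (AE x in lebesgue. w1 x = 0))"
    and w: "ess_supp UNIV w0 \<subseteq> cball 0 R" "ess_supp UNIV w1 \<subseteq> cball 0 R"
    and "C_H1 (time_interval T) u" "C1_L2 (time_interval T) u ut" "AE x in lebesgue. u 0 x = \<epsilon> * w0 x"
    and "weak_damped_wave T b (\<lambda>x. \<epsilon> * w1 x) u ut (\<lambda>s x. \<bar>v s x\<bar> powr r)"
    and L: "Lloc r (time_interval T) v"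
    and supp: "ess_supp (time_interval T \<times> UNIV) (\<lambda>(t, x). u t x) \<subseteq> {(t, x). norm x \<le> t + R}"
      "ess_supp (time_interval T \<times> UNIV) (\<lambda>(t, x). v t x) \<subseteq> {(t, x). norm x \<le> t + R}"
  shows "damped_wave b R \<epsilon> w0 w1 T u ut (\<lambda>s x. \<bar>v s x\<bar> powr r)"
proof
  show "L2 w0" using \<open>H1 w0\<close> by (auto simp: H1_def has_weak_grad_def)
  show "AE x in lebesgue. R < norm x \<longrightarrow> w0 x = 0"
    using AE_ess_supp[OF w(1)] by (auto elim!: eventually_mono)
  show "AE x in lebesgue. R < norm x \<longrightarrow> w1 x = 0"
    using AE_ess_supp[OF w(2)] by (auto elim!: eventually_mono)
  show "AE (s, x) in lebesgue. s \<in> time_interval T \<longrightarrow> s + R < norm x \<longrightarrow> u s x = 0"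
    using AE_ess_supp[OF supp(1)] by (auto elim!: eventually_mono)
  show "AE (s, x) in lebesgue. s \<in> time_interval T \<longrightarrow> s + R < norm x \<longrightarrow> \<bar>v s x\<bar> powr r = 0"
    using AE_ess_supp[OF supp(2)] by (auto elim!: eventually_mono)
  have m: "(\<lambda>(t, x). v t x) \<in> borel_measurable (lebesgue_on (time_interval T \<times> UNIV))"
    using L by (simp add: Lloc_def)
  have "(\<lambda>z. \<bar>(\<lambda>(t, x). v t x) z\<bar> powr r) \<in> borel_measurable (lebesgue_on (time_interval T \<times> UNIV))"
    using m by measurable
  then show "(\<lambda>(s, x). \<bar>v s x\<bar> powr r) \<in> borel_measurable (lebesgue_on (time_interval T \<times> UNIV))"
    by (simp add: case_prod_beta')
  show "set_integrable lebesgue K (\<lambda>(s, x). \<bar>v s x\<bar> powr r)" if "compact K" "K \<subseteq> time_interval T \<times> UNIV" for K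
    using L that by (simp add: Lloc_def)
qed (use assms in \<open>auto simp: C_H1_def\<close>)

theorem theorem1p6:
  fixes b1 b2 :: "real \<Rightarrow> real"
    and p q R :: real
    and u0 u1 v0 v1 :: "real ^ 'n \<Rightarrow> real"
  assumes "CARD('n) \<ge> 2"
    and "C1_halfline b1" and "b1 absolutely_integrable_on {0..}" and "\<forall>t\<ge>0. b1 t \<ge> 0"
    and "C1_halfline b2" and "b2 absolutely_integrable_on {0..}" and "\<forall>t\<ge>0. b2 t \<ge> 0"
    and "p > 1" and "q > 1"
    and "max ((p + 2 + 1 / q) / (p * q - 1)) ((q + 2 + 1 / p) / (p * q - 1))
           = (real CARD('n) - 1) / 2"
    and "R > 0"
    and "H1 u0" and "H1 v0" and "L2 u1" and "L2 v1"
    and "AE x in lebesgue. u0 x \<ge> 0" and "AE x in lebesgue. u1 x \<ge> 0"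
    and "AE x in lebesgue. v0 x \<ge> 0" and "AE x in lebesgue. v1 x \<ge> 0"
    and "\<not> ((AE x in lebesgue. u0 x = 0) \<and> (AE x in lebesgue. u1 x = 0))"
    and "\<not> ((AE x in lebesgue. v0 x = 0) \<and> (AE x in lebesgue. v1 x = 0))"
    and "ess_supp UNIV u0 \<subseteq> cball 0 R" and "ess_supp UNIV u1 \<subseteq> cball 0 R"
    and "ess_supp UNIV v0 \<subseteq> cball 0 R" and "ess_supp UNIV v1 \<subseteq> cball 0 R"
  shows "\<exists>\<epsilon>0>0. \<exists>C>0. \<forall>\<epsilon> (T::ereal) u v.
    0 < \<epsilon> \<and> \<epsilon> \<le> \<epsilon>0 \<and> 0 < T \<and>
    energy_solution p q b1 b2 \<epsilon> u0 u1 v0 v1 T u v \<and>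
    ess_supp (time_interval T \<times> UNIV) (\<lambda>(t, x). u t x) \<subseteq> {(t, x). norm x \<le> t + R} \<and>
    ess_supp (time_interval T \<times> UNIV) (\<lambda>(t, x). v t x) \<subseteq> {(t, x). norm x \<le> t + R}
    \<longrightarrow> T < \<infinity> \<and>
        T \<le> ereal (if p \<noteq> q then exp (C * \<epsilon> powr - (min (q * (p * q - 1)) (p * (p * q - 1))))
                   else exp (C * \<epsilon> powr - (p * (p - 1))))"
proof -
  define N where "N = (real CARD('n) - 1) / 2"
  define bound where "bound C \<epsilon> = (if p \<noteq> q then exp (C * \<epsilon> powr - (min (q * (p * q - 1)) (p * (p * q - 1))))
                   else exp (C * \<epsilon> powr - (p * (p - 1))))" for C \<epsilon>
  note p = \<open>p > 1\<close> and q = \<open>q > 1\<close> and R = \<open>R > 0\<close>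
  have pq: "1 < p * q" using p q by (rule less_1_mult)
  have crit: "max ((p + 2 + 1 / q) / (p * q - 1)) ((q + 2 + 1 / p) / (p * q - 1)) = N"
    using assms by (simp add: N_def)
  \<comment> \<open>The sign of \<open>p - q\<close> decides which of the two fractions is the
    maximum, and hence which mean is critical.\<close>
  have diff: "(p + 2 + 1 / q) - (q + 2 + 1 / p) = (p - q) * (1 + 1 / (p * q))"
    using p q by (simp add: field_simps)
  have sol: "damped_wave b1 R \<epsilon> u0 u1 T u ut (\<lambda>s x. \<bar>v s x\<bar> powr p) \<and> damped_wave b2 R \<epsilon> v0 v1 T v vt (\<lambda>s x. \<bar>u s x\<bar> powr q)"
    if "0 < \<epsilon>" "0 < T" "C_H1 (time_interval T) u" "Lloc q (time_interval T) u" "C_H1 (time_interval T) v" "Lloc p (time_interval T) v"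
      "AE x in lebesgue. u 0 x = \<epsilon> * u0 x" "AE x in lebesgue. v 0 x = \<epsilon> * v0 x"
      "C1_L2 (time_interval T) u ut" "C1_L2 (time_interval T) v vt"
      "weak_damped_wave T b1 (\<lambda>x. \<epsilon> * u1 x) u ut (\<lambda>s x. \<bar>v s x\<bar> powr p)"
      "weak_damped_wave T b2 (\<lambda>x. \<epsilon> * v1 x) v vt (\<lambda>s x. \<bar>u s x\<bar> powr q)"
      "ess_supp (time_interval T \<times> UNIV) (\<lambda>(t, x). u t x) \<subseteq> {(t, x). norm x \<le> t + R}"
      "ess_supp (time_interval T \<times> UNIV) (\<lambda>(t, x). v t x) \<subseteq> {(t, x). norm x \<le> t + R}" for \<epsilon> T u ut v vt
    using that assms by (intro conjI damped_waveI)
  have "\<exists>C>0. \<forall>\<epsilon> T u ut v vt. 0 < \<epsilon> \<longrightarrow> \<epsilon> \<le> 1 \<longrightarrow>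
     damped_wave b1 R \<epsilon> u0 u1 T u ut (\<lambda>s x. \<bar>v s x\<bar> powr p) \<longrightarrow>
     damped_wave b2 R \<epsilon> v0 v1 T v vt (\<lambda>s x. \<bar>u s x\<bar> powr q) \<longrightarrow>
     T \<le> ereal (bound C \<epsilon>)"
  proof -
    consider "q < p" | "p < q" | "p = q" by linarith
    then show ?thesis
    proof cases
      case 1
      have "0 < (p - q) * (1 + 1 / (p * q))" using 1 pq by (intro mult_pos_pos add_pos_pos) auto
      then have "(q + 2 + 1 / p) / (p * q - 1) \<le> (p + 2 + 1 / q) / (p * q - 1)"
        using diff pq by (intro divide_right_mono) auto
      then have "N = (p + 2 + 1 / q) / (p * q - 1)" using crit by simp
      then have "N * (p * q) = N + p + 2 + 1 / q" using pq by (simp add: field_simps)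
      moreover have "bound C \<epsilon> = exp (C * \<epsilon> powr - (q * (p * q - 1)))" for C \<epsilon>
        using 1 pq by (simp add: bound_def min_def)
      ultimately show ?thesis
        using lifespan_bound_distinct_exponents[OF p q _ R, where 'n='n, of b1 u0 u1 b2 v0 v1] by (simp only: N_def)
    next
      case 2
      \<comment> \<open>The system is invariant under exchanging the components together with their
        exponents, damping terms and data, so this case is the previous one with the roles of
        \<open>u\<close> and \<open>v\<close> exchanged.\<close>
      have "(p - q) * (1 + 1 / (p * q)) < 0" using 2 pq by (intro mult_neg_pos add_pos_pos) auto
      then have "(p + 2 + 1 / q) / (p * q - 1) \<le> (q + 2 + 1 / p) / (p * q - 1)"
        using diff pq by (intro divide_right_mono) auto
      then have "N = (q + 2 + 1 / p) / (p * q - 1)" using crit by simp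
      then have "N * (q * p) = N + q + 2 + 1 / p" using pq by (simp add: field_simps)
      moreover have "bound C \<epsilon> = exp (C * \<epsilon> powr - (p * (q * p - 1)))" for C \<epsilon>
        using 2 pq by (simp add: bound_def min_def mult.commute)
      ultimately show ?thesis
        using lifespan_bound_distinct_exponents[OF q p _ R, where 'n='n, of b2 v0 v1 b1 u0 u1] unfolding N_def by metis
    next
      case 3
      have "N = (p + 2 + 1 / p) / (p * p - 1)" using crit 3 by simp
      \<comment> \<open>The common factor \<open>p + 1\<close> cancels, which leaves the criticality
        condition of a single equation.\<close>
      moreover have "(p + 2 + 1 / p) = (p + 1) * (1 + 1 / p)" "p * p - 1 = (p + 1) * (p - 1)"
        using p by (simp_all add: field_simps)
      ultimately have "N = (1 + 1 / p) / (p - 1)" using p by simp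
      then have "N * (p - 1) = 1 + 1 / p" using p by simp
      moreover have "bound C \<epsilon> = exp (C * \<epsilon> powr - (p * (p - 1)))" for C \<epsilon>
        using 3 by (simp add: bound_def)
      ultimately show ?thesis
        using lifespan_bound_equal_exponents[OF p _ R, where 'n='n, of b1 u0 u1 b2 v0 v1] 3 by (simp only: N_def)
    qed
  qed
  then obtain C where C: "C > 0" "\<And>\<epsilon> T u ut v vt. 0 < \<epsilon> \<Longrightarrow> \<epsilon> \<le> 1 \<Longrightarrow>
     damped_wave b1 R \<epsilon> u0 u1 T u ut (\<lambda>s x. \<bar>v s x\<bar> powr p) \<Longrightarrow>
     damped_wave b2 R \<epsilon> v0 v1 T v vt (\<lambda>s x. \<bar>u s x\<bar> powr q) \<Longrightarrow>
     T \<le> ereal (bound C \<epsilon>)" by blast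
  have key: "T < \<infinity> \<and> T \<le> ereal (bound C \<epsilon>)"
    if H: "0 < \<epsilon> \<and> \<epsilon> \<le> 1 \<and> 0 < T \<and> energy_solution p q b1 b2 \<epsilon> u0 u1 v0 v1 T u v \<and>
      ess_supp (time_interval T \<times> UNIV) (\<lambda>(t, x). u t x) \<subseteq> {(t, x). norm x \<le> t + R} \<and>
      ess_supp (time_interval T \<times> UNIV) (\<lambda>(t, x). v t x) \<subseteq> {(t, x). norm x \<le> t + R}" for \<epsilon> T u v
  proof -
    obtain ut vt where "damped_wave b1 R \<epsilon> u0 u1 T u ut (\<lambda>s x. \<bar>v s x\<bar> powr p)"
      "damped_wave b2 R \<epsilon> v0 v1 T v vt (\<lambda>s x. \<bar>u s x\<bar> powr q)"
      using H sol unfolding energy_solution_def by blast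
    then have T: "T \<le> ereal (bound C \<epsilon>)" using C(2) H by blast
    then have "T < \<infinity>" by (rule le_less_trans) simp
    with T show ?thesis by simp
  qed
  \<comment> \<open>The choice \<open>\<epsilon>0 = 1\<close> suffices: smallness of \<epsilon>
    served only to make its negative power at least 1, so that \<Lambda> is at least
    \<open>C\<close>. All other requirements were put into \<open>C\<close>.\<close>
  show ?thesis
    by (rule exI[of _ 1], rule conjI[OF zero_less_one], rule exI[of _ C], rule conjI[OF C(1)], intro allI impI,
        rule key[unfolded bound_def])
qed

end
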